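(* Let $f:X\to X$ be a homeomorphism of a compact metric space $X$ preserving a probability measure $\mu$. Let $\epsilon>0$, and let $A_\theta\in C^0(X,\mathrm{SL}(2,\mathbb{R}))$ be a one-parameter family ($\theta$ in an open interval $J\subset\mathbb{R}$) which is monotonic and $C^{2+\epsilon}$ in $\theta$. Then for Lebesgue almost every $\theta$, if $L(f,A_\theta)=0$ then $(f,A_\theta)$ is $L^2$-conjugate to rotations.
   Context: For $A\in C^0(X,\mathrm{SL}(2,\mathbb{R}))$, the cocycle $(f,A)$ is the skew-product $(x,w)\mapsto(f(x),A(x)\cdot w)$ on $X\times\mathbb{R}^2$; $A_n(x)=A(f^{n-1}(x))\cdots A(x)$ for $n\ge1$; the Lyapunov exponent is $L(f,A)=\lim_{n\to\infty}\frac1n\int_X\ln\|A_n(x)\|\,d\mu(x)$. The family $A_\theta$ is $C^{2+\epsilon}$ in $\theta$ if there is a fixed compact subset of $C^{2+\epsilon}(J,\mathrm{SL}(2,\mathbb{R}))$ (compact-open topology) that contains $\theta\mapsto A_\theta(x)$ for every $x\in X$. It is monotonic in $\theta$ if for every $x\in X$ and $y\in\mathbb{R}^2\setminus\{0\}$, (any continuous determination of) the argument of $\theta\mapsto A_\theta(x)\cdot y$ has positive derivative. $(f,A)$ is $L^2$-conjugate to rotations if there is a measurable $B:X\to\mathrm{SL}(2,\mathbb{R})$ with $\int_X\|B(x)\|^2d\mu(x)<\infty$ and $B(f(x))A(x)B(x)^{-1}\in\mathrm{SO}(2,\mathbb{R})$ for $\mu$-almost every $x$. *)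

theory Defs
  imports "HOL-Probability.Probability"
begin

section \<open>Cocycles with values in SL(2,R)\<close>

definition SL2 :: "(real^2^2) set" where
  "SL2 = {A. det A = 1}"

abbreviation opnorm :: "real^2^2 \<Rightarrow> real" where
  "opnorm A \<equiv> onorm (\<lambda>w. A *v w)"

primrec cocycle_iter :: "('a \<Rightarrow> 'a) \<Rightarrow> ('a \<Rightarrow> real^2^2) \<Rightarrow> nat \<Rightarrow> 'a \<Rightarrow> real^2^2" where
  "cocycle_iter f A 0 x = mat 1"
| "cocycle_iter f A (Suc n) x = A ((f ^^ n) x) ** cocycle_iter f A n x"

definition lyapunov :: "'a measure \<Rightarrow> ('a \<Rightarrow> 'a) \<Rightarrow> ('a \<Rightarrow> real^2^2) \<Rightarrow> real" where
  "lyapunov M f A = lim (\<lambda>n. 1 / real n * (\<integral>x. ln (opnorm (cocycle_iter f A n x)) \<partial>M))"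

definition L2_conjugate_to_rotations ::
    "'a measure \<Rightarrow> ('a \<Rightarrow> 'a) \<Rightarrow> ('a \<Rightarrow> real^2^2) \<Rightarrow> bool" where
  "L2_conjugate_to_rotations M f A \<longleftrightarrow>
     (\<exists>B. B \<in> borel_measurable M \<and> (\<forall>x\<in>space M. B x \<in> SL2)
        \<and> (\<integral>\<^sup>+x. ennreal ((opnorm (B x))\<^sup>2) \<partial>M) < \<infinity>
        \<and> (AE x in M. rotation_matrix (B (f x) ** A x ** matrix_inv (B x))))"


section \<open>The space of maps of class C\<open>\<^sup>r\<close> on an open set of reals, for real r\<close>

text \<open>
  For real \<open>r \<ge> 0\<close> put \<open>k = \<lfloor>r\<rfloor>\<close> and \<open>\<alpha> = r - k \<in> [0,1)\<close>. A map is of class C\<open>\<^sup>r\<close> if it is \<open>k\<close> times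
  continuously differentiable and its \<open>k\<close>-th derivative is locally \<open>\<alpha>\<close>-Hoelder. For integral \<open>r\<close>
  we have \<open>\<alpha> = 0\<close>; then the Hoelder quotient is \<open>norm (D s - D t)\<close>, which is automatically bounded
  on compact intervals and controlled by twice the supremum of \<open>norm D\<close>, so both the space and the
  topology below are the usual ones for C\<open>\<^sup>k\<close>.
\<close>

definition vderiv :: "nat \<Rightarrow> (real \<Rightarrow> 'b::real_normed_vector) \<Rightarrow> real \<Rightarrow> 'b" where
  "vderiv j g = ((\<lambda>h t. vector_derivative h (at t)) ^^ j) g"

definition holder_quotients ::
    "real \<Rightarrow> real \<Rightarrow> real \<Rightarrow> (real \<Rightarrow> 'b::real_normed_vector) \<Rightarrow> real set" where
  "holder_quotients \<alpha> a b h =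
     {norm (h s - h t) / \<bar>s - t\<bar> powr \<alpha> | s t. s \<in> {a..b} \<and> t \<in> {a..b} \<and> s \<noteq> t}"

text \<open>
  Elements of the space are represented by functions that are \<open>undefined\<close> outside \<open>J\<close>; as \<open>J\<close> is
  open, this does not affect derivatives at points of \<open>J\<close>.
\<close>

definition Cr_space :: "real \<Rightarrow> real set \<Rightarrow> 'b::real_normed_vector set \<Rightarrow> (real \<Rightarrow> 'b) set" where
  "Cr_space r J S =
     {g \<in> J \<rightarrow>\<^sub>E S.
        (\<forall>j < nat \<lfloor>r\<rfloor>. \<forall>t\<in>J. vderiv j g differentiable (at t))
      \<and> continuous_on J (vderiv (nat \<lfloor>r\<rfloor>) g)
      \<and> (\<forall>a b. {a..b} \<subseteq> J \<longrightarrow> bdd_above (holder_quotients (frac r) a b (vderiv (nat \<lfloor>r\<rfloor>) g)))}"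

definition Cr_norm :: "real \<Rightarrow> real \<Rightarrow> real \<Rightarrow> (real \<Rightarrow> 'b::real_normed_vector) \<Rightarrow> real" where
  "Cr_norm r a b g =
     (\<Sum>j\<le>nat \<lfloor>r\<rfloor>. SUP t\<in>{a..b}. norm (vderiv j g t))
     + Sup (holder_quotients (frac r) a b (vderiv (nat \<lfloor>r\<rfloor>) g))"

text \<open>
  The (weak, or compact-open) C\<open>\<^sup>r\<close> topology: convergence in C\<open>\<^sup>r\<close> norm on each compact subinterval
  of \<open>J\<close>.
\<close>

definition Cr_topology ::
    "real \<Rightarrow> real set \<Rightarrow> 'b::real_normed_vector set \<Rightarrow> (real \<Rightarrow> 'b) topology" where
  "Cr_topology r J S = topology_generated_by
     {{h \<in> Cr_space r J S. Cr_norm r a b (\<lambda>t. h t - g t) < e} | a b g e.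
        a < b \<and> {a..b} \<subseteq> J \<and> g \<in> Cr_space r J S \<and> 0 < e}"


section \<open>One-parameter families\<close>

definition Cr_family :: "real \<Rightarrow> real set \<Rightarrow> (real \<Rightarrow> 'a \<Rightarrow> real^2^2) \<Rightarrow> bool" where
  "Cr_family r J A \<longleftrightarrow>
     (\<exists>K. compactin (Cr_topology r J SL2) K \<and> (\<forall>x. restrict (\<lambda>\<theta>. A \<theta> x) J \<in> K))"

definition argument_determination :: "real set \<Rightarrow> (real \<Rightarrow> real^2) \<Rightarrow> (real \<Rightarrow> real) \<Rightarrow> bool" where
  "argument_determination J v \<phi> \<longleftrightarrow>
     continuous_on J \<phi> \<and> (\<forall>\<theta>\<in>J. v \<theta> = norm (v \<theta>) *\<^sub>R vector [cos (\<phi> \<theta>), sin (\<phi> \<theta>)])"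

text \<open>
  A continuous determination of the argument exists on the interval \<open>J\<close> as soon as the matrices
  are invertible and depend continuously on the parameter, so the quantification over all
  determinations is not vacuous for the families considered.
\<close>

definition monotonic_family :: "real set \<Rightarrow> (real \<Rightarrow> 'a \<Rightarrow> real^2^2) \<Rightarrow> bool" where
  "monotonic_family J A \<longleftrightarrow>
     (\<forall>x y \<phi>. y \<noteq> 0 \<longrightarrow> argument_determination J (\<lambda>\<theta>. A \<theta> x *v y) \<phi> \<longrightarrow>
        (\<forall>\<theta>\<in>J. \<exists>d>0. (\<phi> has_real_derivative d) (at \<theta>)))"

end

theory Submission
  imports Defs
begin

text \<open>
  The proof is a form of Kotani theory that uses only the first-order complexification of the family in its parameter
  and passes to the limit with positive definite forms instead of boundary values of holomorphic functions.
  
  Fix a compact parameter interval. For \<open>s \<ge> 0\<close> put \<open>M = A\<^sub>\<theta> + \<i> s A'\<^sub>\<theta>\<close>, where the prime is the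
  derivative in \<open>\<theta>\<close>. A real matrix of determinant one preserves the indefinite Hermitian form
  \<open>Im (cnj v\<^sub>1 v\<^sub>2)\<close>; by monotonicity of the family, \<open>M\<close> increases this form, where it is nonnegative, by at least a
  constant times \<open>s |v|\<^sup>2\<close>, so that the perturbed cocycle contracts a half-plane (\<open>herm_col_act_ge\<close>, \<open>herm_row_act_le\<close>).
  Let \<open>c\<^sub>n(x) = (1, -\<i>) M(f\<^bsup>n-1\<^esup> x) \<dots> M(x)\<close> and let \<open>amp\<close> be the product of this row with the column
  \<open>(1, \<i>)\<close>. Three facts are proved for a single orbit.
  First, \<open>ln |amp|\<close> is nondecreasing in \<open>s\<close> (\<open>log_derivative_nonneg\<close>).
  Second, the logarithmic derivatives of \<open>amp\<close> satisfy the Cauchy-Riemann equation in \<open>\<theta> + \<i> s\<close> up to an error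
  \<open>O(n)\<close> (\<open>cauchy_riemann_defect\<close>): one factor violates it by \<open>s A''\<^sub>\<theta>\<close>, and the contraction makes the
  denominators at least a constant times \<open>s\<close>.
  Third, the argument of \<open>amp\<close> varies by \<open>O(n)\<close> over the interval (\<open>argument_variation\<close>).
  Together they bound the integral over \<open>\<theta>\<close> of \<open>ln |amp| - ln |amp|\<^bsub>s=0\<^esub>\<close> by \<open>K n s\<close>
  (\<open>integral_ln_amp_increment\<close>). By the theorems of Fubini and Fatou, for almost every \<open>\<theta>\<close> the space average of this
  increment is at most \<open>B n s\<close> for arbitrarily small \<open>s\<close> and, given \<open>s\<close>, arbitrarily large \<open>n\<close>
  (\<open>AE_increment_bounded\<close>). If the Lyapunov exponent vanishes at \<open>\<theta>\<close>, then the average of \<open>ln |amp|\<close> itself has such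
  a bound.
  
  Conversely, the Hermitian form of \<open>c\<^sub>n\<close> grows in absolute value at each step by a factor of at least one plus a constant times
  \<open>s |c\<^sub>n|\<^sup>2 / |herm c\<^sub>n|\<close>. So the
  growth bound controls the space and time average of \<open>|c\<^sub>n|\<^sup>2 / |herm c\<^sub>n|\<close> independently of \<open>s\<close>
  (\<open>trace_average_le\<close>). This number is the trace of the positive definite form
  \<open>\<xi> \<mapsto> |c\<^sub>n \<xi>|\<^sup>2 / |herm c\<^sub>n|\<close> of determinant one, and the time averages of these forms satisfy
  \<open>Q(x) \<le> A(x)\<^sup>T Q(f x) A(x) + error\<close> with an error that tends to zero in mean.
  Everything in this inequality is linear in \<open>Q\<close>, so convex combinations may be taken; suitable ones converge almost everywhere
  (\<open>convex_combinations_converge_AE\<close>), and the limit satisfies the inequality without error and has determinant at least one.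
  The determinant is then nondecreasing along orbits of a measure preserving map, hence invariant, and two ordered forms with equal
  determinant are equal. The Cholesky factor of the invariant form, normalised to determinant one, is the conjugacy; the square of its
  norm is at most the trace of the form, which is integrable (\<open>almost_invariant_forms_imp_conjugate\<close>).
\<close>

section \<open>The Hermitian form and tangent vectors to SL(2,R)\<close>

definition cdot :: "complex \<times> complex \<Rightarrow> complex \<times> complex \<Rightarrow> complex" where
  "cdot c v = fst c * fst v + snd c * snd v"

text \<open>
  A row vector times the complex matrix \<open>P + \<i> s Q\<close>; \<open>col_act\<close> is the same matrix times a column.
\<close>

definition row_act :: "complex \<times> complex \<Rightarrow> real^2^2 \<Rightarrow> real^2^2 \<Rightarrow> real \<Rightarrow> complex \<times> complex" where
  "row_act c P Q s = (fst c * Complex (P$1$1) (s * Q$1$1) + snd c * Complex (P$2$1) (s * Q$2$1),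
                   fst c * Complex (P$1$2) (s * Q$1$2) + snd c * Complex (P$2$2) (s * Q$2$2))"

definition col_act :: "real^2^2 \<Rightarrow> real^2^2 \<Rightarrow> real \<Rightarrow> complex \<times> complex \<Rightarrow> complex \<times> complex" where
  "col_act P Q s v = (Complex (P$1$1) (s * Q$1$1) * fst v + Complex (P$1$2) (s * Q$1$2) * snd v,
                   Complex (P$2$1) (s * Q$2$1) * fst v + Complex (P$2$2) (s * Q$2$2) * snd v)"

definition nsq :: "complex \<times> complex \<Rightarrow> real" where
  "nsq c = (cmod (fst c))\<^sup>2 + (cmod (snd c))\<^sup>2"

text \<open>
  The area spanned by the real and imaginary parts of \<open>v\<close>. It is invariant under real matrices of determinant one, and its sign
  tells in which half-plane the slope \<open>v\<^sub>2 / v\<^sub>1\<close> lies. Columns will have positive and rows negative values.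
\<close>

definition herm :: "complex \<times> complex \<Rightarrow> real" where
  "herm v = Im (cnj (fst v) * snd v)"

text \<open>
  The wedge product of \<open>P u\<close> and \<open>Q u\<close> for \<open>u = (y, z)\<close>. If \<open>Q\<close> is the derivative of \<open>P\<close> in a parameter, this is
  \<open>|P u|\<^sup>2\<close> times the angular speed of \<open>P u\<close>.
\<close>

definition qform :: "real^2^2 \<Rightarrow> real^2^2 \<Rightarrow> real \<Rightarrow> real \<Rightarrow> real" where
  "qform P Q y z = (P$1$1 * y + P$1$2 * z) * (Q$2$1 * y + Q$2$2 * z)
                 - (P$2$1 * y + P$2$2 * z) * (Q$1$1 * y + Q$1$2 * z)"

definition hqform :: "real^2^2 \<Rightarrow> real^2^2 \<Rightarrow> complex \<times> complex \<Rightarrow> real" where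
  "hqform P Q v = qform P Q (Re (fst v)) (Re (snd v)) + qform P Q (Im (fst v)) (Im (snd v))"

text \<open>
  The second condition is the vanishing of the derivative of the determinant at \<open>P\<close> in the direction \<open>Q\<close>. The last
  one is a quantitative form of monotonicity.
\<close>

definition tangent :: "real \<Rightarrow> real^2^2 \<Rightarrow> real^2^2 \<Rightarrow> bool" where
  "tangent \<kappa> P Q \<longleftrightarrow> P$1$1 * P$2$2 - P$1$2 * P$2$1 = 1
     \<and> P$1$1 * Q$2$2 + P$2$2 * Q$1$1 - P$1$2 * Q$2$1 - P$2$1 * Q$1$2 = 0
     \<and> (\<forall>y z. \<kappa> * (y\<^sup>2 + z\<^sup>2) \<le> qform P Q y z)"

lemma cdot_row_act: "cdot (row_act c P Q s) v = cdot c (col_act P Q s v)"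
  by (simp add: cdot_def row_act_def col_act_def algebra_simps)

lemma nsq_nonneg [simp]: "0 \<le> nsq c" by (simp add: nsq_def)

lemma herm_le_nsq: "2 * \<bar>herm v\<bar> \<le> nsq v"
proof -
  have 1: "\<bar>herm v\<bar> \<le> cmod (cnj (fst v) * snd v)" unfolding herm_def by (rule abs_Im_le_cmod)
  have 2: "cmod (cnj (fst v) * snd v) = cmod (fst v) * cmod (snd v)" by (simp add: norm_mult)
  have "0 \<le> (cmod (fst v) - cmod (snd v))\<^sup>2" by simp
  with 1 2 show ?thesis unfolding nsq_def by (simp add: power2_diff)
qed

lemma cmod_cdot_le: "(cmod (cdot c v))\<^sup>2 \<le> nsq c * nsq v"
proof -
  have "cmod (cdot c v) \<le> cmod (fst c) * cmod (fst v) + cmod (snd c) * cmod (snd v)"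
    unfolding cdot_def by (rule order_trans[OF norm_triangle_ineq]) (simp add: norm_mult)
  then have "(cmod (cdot c v))\<^sup>2 \<le> (cmod (fst c) * cmod (fst v) + cmod (snd c) * cmod (snd v))\<^sup>2"
    by (rule power_mono) simp
  also have "\<dots> \<le> nsq c * nsq v"
  proof -
    have "0 \<le> (cmod (fst c) * cmod (snd v) - cmod (snd c) * cmod (fst v))\<^sup>2" by simp
    then show ?thesis unfolding nsq_def by (simp add: power2_eq_square algebra_simps)
  qed
  finally show ?thesis .
qed

text \<open>
  A reversed Cauchy-Schwarz inequality for vectors on opposite sides of the null cone of the indefinite form. It is what bounds
  denominators from below throughout.
\<close>

lemma cdot_ge_herm: "- 4 * herm c * herm v \<le> (cmod (cdot c v))\<^sup>2"
proof -
  have "(cmod (cdot c v))\<^sup>2 + 4 * herm c * herm v = (cmod (cdot c (cnj (fst v), cnj (snd v))))\<^sup>2"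
    unfolding cdot_def herm_def cmod_power2
    by (simp add: power2_eq_square algebra_simps)
  moreover have "0 \<le> (cmod (cdot c (cnj (fst v), cnj (snd v))))\<^sup>2" by simp
  ultimately show ?thesis by linarith
qed

lemma cdot_plus: "(cmod (cdot c (1, \<i>)))\<^sup>2 = nsq c - 2 * herm c"
  unfolding cdot_def herm_def nsq_def cmod_power2
  by (simp add: power2_eq_square algebra_simps)

lemma cdot_minus: "(cmod (cdot c (1, -\<i>)))\<^sup>2 = nsq c + 2 * herm c"
  unfolding cdot_def herm_def nsq_def cmod_power2
  by (simp add: power2_eq_square algebra_simps)

text \<open>
  Rows are moved by the transposed matrices, which rotate in the opposite direction: for \<open>P\<close> of determinant one, the substitution
  \<open>(z1, z2) = J P (y1, y2)\<close> with \<open>J\<close> the rotation by a right angle turns the form of the transposed pair into minus the form of the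
  original pair.
\<close>

lemma tangent_transpose:
  assumes "tangent \<kappa> P Q" "0 \<le> \<kappa>" "(P$1$1)\<^sup>2 + (P$1$2)\<^sup>2 + (P$2$1)\<^sup>2 + (P$2$2)\<^sup>2 \<le> C" "0 < C"
  shows "qform (transpose P) (transpose Q) z1 z2 \<le> - (\<kappa> / C) * (z1\<^sup>2 + z2\<^sup>2)"
proof -
  define a b c d where "a = P$1$1" and "b = P$1$2" and "c = P$2$1" and "d = P$2$2"
  define e g h k where "e = Q$1$1" and "g = Q$1$2" and "h = Q$2$1" and "k = Q$2$2"
  note defs = a_def b_def c_def d_def e_def g_def h_def k_def
  have det: "a * d - b * c = 1" and tr: "a * k + d * e - b * h - c * g = 0"
    and q: "\<And>y z. \<kappa> * (y\<^sup>2 + z\<^sup>2) \<le> qform P Q y z"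
    using assms(1) unfolding tangent_def defs by auto
  define y1 y2 where "y1 = - d * z2 - b * z1" and "y2 = c * z2 + a * z1"
  have z2: "z2 = - (a * y1 + b * y2)" and z1: "z1 = c * y1 + d * y2"
    using det unfolding y1_def y2_def by algebra+
  have qP: "qform P Q y z = (a * y + b * z) * (h * y + k * z) - (c * y + d * z) * (e * y + g * z)" for y z
    by (simp add: qform_def defs)
  have qT: "qform (transpose P) (transpose Q) y z
      = (a * y + c * z) * (g * y + k * z) - (b * y + d * z) * (e * y + h * z)" for y z
    by (simp add: qform_def transpose_def defs)
  have 1: "a * z1 + c * z2 = y2" and 2: "b * z1 + d * z2 = - y1"
    using det unfolding z1 z2 by algebra+
  have eq: "qform (transpose P) (transpose Q) z1 z2 = - qform P Q y1 y2"
    unfolding qT qP 1 2 unfolding z1 z2 by (simp add: algebra_simps)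
  have "z1\<^sup>2 + z2\<^sup>2 \<le> (a\<^sup>2 + b\<^sup>2 + c\<^sup>2 + d\<^sup>2) * (y1\<^sup>2 + y2\<^sup>2)"
  proof -
    have "0 \<le> (c * y2 - d * y1)\<^sup>2 + (a * y2 - b * y1)\<^sup>2" by simp
    then show ?thesis unfolding z1 z2 by (simp add: power2_eq_square algebra_simps)
  qed
  also have "\<dots> \<le> C * (y1\<^sup>2 + y2\<^sup>2)"
    using assms(3) unfolding defs by (intro mult_right_mono) auto
  finally have "(z1\<^sup>2 + z2\<^sup>2) / C \<le> y1\<^sup>2 + y2\<^sup>2" using assms(4) by (simp add: field_simps)
  then have "\<kappa> * ((z1\<^sup>2 + z2\<^sup>2) / C) \<le> \<kappa> * (y1\<^sup>2 + y2\<^sup>2)" using assms(2) by (rule mult_left_mono)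
  also have "\<dots> \<le> qform P Q y1 y2" by (rule q)
  finally show ?thesis unfolding eq by (simp add: field_simps)
qed

text \<open>
  Under the two equations in \<open>tangent\<close>, the determinant of \<open>Q\<close> is the determinant of the symmetric matrix of the quadratic form
  \<open>qform P Q\<close>.
\<close>

lemma tangent_det_nonneg:
  assumes "tangent \<kappa> P Q" "0 < \<kappa>"
  shows "0 \<le> Q$1$1 * Q$2$2 - Q$1$2 * Q$2$1"
proof -
  define a b c d where "a = P$1$1" and "b = P$1$2" and "c = P$2$1" and "d = P$2$2"
  define e g h k where "e = Q$1$1" and "g = Q$1$2" and "h = Q$2$1" and "k = Q$2$2"
  note defs = a_def b_def c_def d_def e_def g_def h_def k_def
  have det: "a * d - b * c = 1" and tr: "a * k + d * e - b * h - c * g = 0"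
    and q: "\<And>y z. \<kappa> * (y\<^sup>2 + z\<^sup>2) \<le> qform P Q y z"
    using assms(1) unfolding tangent_def defs by auto
  define S1 S2 S3 where "S1 = a * h - c * e" and "S2 = a * k - c * g" and "S3 = b * k - d * g"
  have form: "qform P Q y z = S1 * y\<^sup>2 + 2 * S2 * y * z + S3 * z\<^sup>2" for y z
    unfolding qform_def S1_def S2_def S3_def defs[symmetric] using tr by algebra
  have "0 < S1" using q[of 1 0] form[of 1 0] assms(2) by simp
  have "0 \<le> qform P Q S2 (- S1)" 
    by (rule order_trans[OF _ q]) (use assms(2) in auto)
  also have "qform P Q S2 (-S1) = S1 * (S1 * S3 - S2\<^sup>2)"
    unfolding form by algebra
  finally have "0 \<le> S1 * S3 - S2\<^sup>2" using \<open>0 < S1\<close> by (simp add: zero_le_mult_iff)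
  also have "S1 * S3 - S2\<^sup>2 = e * k - g * h"
    unfolding S1_def S2_def S3_def using det tr by algebra
  finally show ?thesis unfolding defs .
qed

lemma herm_col_act:
  "herm (col_act P Q s v) = herm v * (P$1$1 * P$2$2 - P$1$2 * P$2$1 + s\<^sup>2 * (Q$1$1 * Q$2$2 - Q$1$2 * Q$2$1))
     + s * hqform P Q v"
  unfolding herm_def col_act_def hqform_def qform_def
  by (simp add: power2_eq_square algebra_simps)

lemma herm_row_act:
  "herm (row_act c P Q s) = herm c * (P$1$1 * P$2$2 - P$1$2 * P$2$1 + s\<^sup>2 * (Q$1$1 * Q$2$2 - Q$1$2 * Q$2$1))
           + s * hqform (transpose P) (transpose Q) c"
  unfolding herm_def row_act_def hqform_def qform_def transpose_def
  by (simp add: power2_eq_square algebra_simps)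

text \<open>
  The source of monotonicity in \<open>s\<close>: the left-hand side is, up to a positive factor, the derivative of \<open>ln |c (P + \<i> s Q) v|\<close>
  at \<open>s = 0\<close>, and the right-hand side is a sum of products of forms with known signs. It is an identity of polynomials.
\<close>

lemma twist_identity:
  "Re (\<i> * cnj (cdot c (col_act P 0 0 v)) * cdot c (col_act Q 0 0 v))
     = - hqform (transpose P) (transpose Q) c * herm v - hqform P Q v * herm c"
  unfolding herm_def col_act_def cdot_def hqform_def qform_def transpose_def
  by (simp add: power2_eq_square algebra_simps)


definition frob :: "real^2^2 \<Rightarrow> real" where
  "frob P = (P$1$1)\<^sup>2 + (P$1$2)\<^sup>2 + (P$2$1)\<^sup>2 + (P$2$2)\<^sup>2"

lemma nsq_col_act_le: "nsq (col_act P Q s v) \<le> (frob P + s\<^sup>2 * frob Q) * nsq v"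
proof -
  have 1: "(cmod (fst (col_act P Q s v)))\<^sup>2 \<le> nsq (Complex (P$1$1) (s * Q$1$1), Complex (P$1$2) (s * Q$1$2)) * nsq v"
    using cmod_cdot_le[of "(Complex (P$1$1) (s * Q$1$1), Complex (P$1$2) (s * Q$1$2))" v]
    by (simp add: col_act_def cdot_def)
  have 2: "(cmod (snd (col_act P Q s v)))\<^sup>2 \<le> nsq (Complex (P$2$1) (s * Q$2$1), Complex (P$2$2) (s * Q$2$2)) * nsq v"
    using cmod_cdot_le[of "(Complex (P$2$1) (s * Q$2$1), Complex (P$2$2) (s * Q$2$2))" v]
    by (simp add: col_act_def cdot_def)
  have "nsq (col_act P Q s v) \<le> (nsq (Complex (P$1$1) (s * Q$1$1), Complex (P$1$2) (s * Q$1$2))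
      + nsq (Complex (P$2$1) (s * Q$2$1), Complex (P$2$2) (s * Q$2$2))) * nsq v"
    using 1 2 unfolding nsq_def[of "col_act P Q s v"] by (simp add: algebra_simps)
  also have "\<dots> = (frob P + s\<^sup>2 * frob Q) * nsq v"
    by (simp add: nsq_def frob_def cmod_power2 power_mult_distrib algebra_simps)
  finally show ?thesis .
qed

lemma nsq_row_act_le: "nsq (row_act c P Q s) \<le> (frob P + s\<^sup>2 * frob Q) * nsq c"
proof -
  have "row_act c P Q s = col_act (transpose P) (transpose Q) s c"
    by (simp add: row_act_def col_act_def transpose_def mult.commute)
  moreover have "frob (transpose R) = frob R" for R
    by (simp add: frob_def transpose_def)
  ultimately show ?thesis using nsq_col_act_le[of "transpose P" "transpose Q" s c] by simp
qed

lemma frob_nonneg [simp]: "0 \<le> frob P" by (simp add: frob_def)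

lemma hqform_ge:
  assumes "tangent \<kappa> P Q"
  shows "\<kappa> * nsq v \<le> hqform P Q v"
proof -
  have "\<kappa> * ((Re (fst v))\<^sup>2 + (Re (snd v))\<^sup>2) + \<kappa> * ((Im (fst v))\<^sup>2 + (Im (snd v))\<^sup>2) \<le> hqform P Q v"
    using assms unfolding tangent_def hqform_def by (intro add_mono) auto
  then show ?thesis by (simp add: nsq_def cmod_power2 algebra_simps)
qed

lemma hqform_transpose_le:
  assumes "tangent \<kappa> P Q" "0 \<le> \<kappa>" "frob P \<le> C" "0 < C"
  shows "hqform (transpose P) (transpose Q) c \<le> - (\<kappa> / C) * nsq c"
proof -
  note * = tangent_transpose[OF assms(1,2) assms(3)[unfolded frob_def] assms(4)]
  show ?thesis using add_mono[OF *[of "Re (fst c)" "Re (snd c)"] *[of "Im (fst c)" "Im (snd c)"]]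
    by (simp add: hqform_def nsq_def cmod_power2 algebra_simps)
qed

text \<open>
  Monotonicity makes the complexified matrices contract the half-plane: the form grows by a definite multiple of \<open>s |v|\<^sup>2\<close>.
\<close>

lemma herm_col_act_ge:
  assumes "tangent \<kappa> P Q" "0 < \<kappa>" "0 \<le> herm v" "0 \<le> s"
  shows "herm v + s * \<kappa> * nsq v \<le> herm (col_act P Q s v)"
proof -
  have "0 \<le> herm v * (s\<^sup>2 * (Q$1$1 * Q$2$2 - Q$1$2 * Q$2$1))"
    using tangent_det_nonneg[OF assms(1,2)] assms(3) by (intro mult_nonneg_nonneg) auto
  moreover have "s * (\<kappa> * nsq v) \<le> s * hqform P Q v"
    using hqform_ge[OF assms(1)] assms(4) by (rule mult_left_mono)
  moreover have "P$1$1 * P$2$2 - P$1$2 * P$2$1 = 1" using assms(1) by (simp add: tangent_def)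
  ultimately show ?thesis unfolding herm_col_act by (simp add: algebra_simps)
qed

lemma herm_row_act_le:
  assumes "tangent \<kappa> P Q" "0 < \<kappa>" "frob P \<le> C" "0 < C" "herm c \<le> 0" "0 \<le> s"
  shows "herm (row_act c P Q s) \<le> herm c - s * (\<kappa> / C) * nsq c"
proof -
  have "herm c * (s\<^sup>2 * (Q$1$1 * Q$2$2 - Q$1$2 * Q$2$1)) \<le> 0"
    using tangent_det_nonneg[OF assms(1,2)] assms(5) by (intro mult_nonpos_nonneg) auto
  moreover have "s * hqform (transpose P) (transpose Q) c \<le> s * (- (\<kappa> / C) * nsq c)"
    using hqform_transpose_le[OF assms(1) _ assms(3,4)] assms(2,6) by (intro mult_left_mono) auto
  moreover have "P$1$1 * P$2$2 - P$1$2 * P$2$1 = 1" using assms(1) by (simp add: tangent_def)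
  ultimately show ?thesis unfolding herm_row_act by (simp add: algebra_simps)
qed

text \<open>
  The logarithmic derivative of \<open>c (P + \<i> s Q) v\<close> in \<open>s\<close> for frozen \<open>c\<close> and \<open>v\<close>. The numerator at general
  \<open>s\<close> differs from that at \<open>s = 0\<close> by \<open>s |c Q v|\<^sup>2 \<ge> 0\<close>.
\<close>

lemma twist_nonneg:
  assumes "tangent \<kappa> P Q" "0 < \<kappa>" "herm c \<le> 0" "0 \<le> herm v" "0 \<le> s"
  shows "0 \<le> Re (cdot c (col_act 0 Q 1 v) / cdot c (col_act P Q s v))"
proof -
  define X Y where "X = cdot c (col_act P 0 0 v)" and "Y = cdot c (col_act Q 0 0 v)"
  have 1: "cdot c (col_act 0 Q 1 v) = \<i> * Y" 
    unfolding Y_def cdot_def col_act_def by (simp add: complex_eq_iff algebra_simps)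
  have 2: "cdot c (col_act P Q s v) = X + \<i> * s * Y"
    unfolding X_def Y_def cdot_def col_act_def by (simp add: complex_eq_iff algebra_simps)
  define C where "C = frob P + 1"
  have C: "frob P \<le> C" "0 < C" unfolding C_def using frob_nonneg[of P] by linarith+
  have a: "hqform (transpose P) (transpose Q) c \<le> 0"
    by (rule order_trans[OF hqform_transpose_le[OF assms(1) _ C]]) (use assms(2) C in auto)
  have b: "0 \<le> hqform P Q v"
    by (rule order_trans[OF _ hqform_ge[OF assms(1)]]) (use assms(2) in auto)
  have "0 \<le> Re (\<i> * cnj X * Y)"
    unfolding X_def Y_def twist_identity 
    using mult_nonpos_nonneg[OF a assms(4)] mult_nonneg_nonpos[OF b assms(3)] by linarith
  moreover have "0 \<le> s * (cmod Y)\<^sup>2" using assms(5) by simp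
  moreover have "Re (\<i> * Y * cnj (X + \<i> * s * Y)) = Re (\<i> * cnj X * Y) + s * (cmod Y)\<^sup>2"
    by (simp add: cmod_power2) (simp add: power2_eq_square algebra_simps)
  ultimately have "0 \<le> Re (\<i> * Y * cnj (X + \<i> * s * Y))" by linarith
  then show ?thesis unfolding 1 2 by (metis Re_complex_div_ge_0)
qed

lemma has_real_derivative_ln_cmod:
  assumes "(F has_vector_derivative F') (at s within S)" "F s \<noteq> 0"
  shows "((\<lambda>s. ln (cmod (F s))) has_real_derivative Re (F' / F s)) (at s within S)"
proof -
  have d: "((\<lambda>s. Re (F s)) has_real_derivative Re F') (at s within S)"
          "((\<lambda>s. Im (F s)) has_real_derivative Im F') (at s within S)"
    using assms(1) by (auto simp: has_vector_derivative_complex_iff)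
  have pos: "0 < (Re (F s))\<^sup>2 + (Im (F s))\<^sup>2"
    using assms(2) by (metis cmod_power2 zero_less_norm_iff zero_less_power)
  have "((\<lambda>s. (Re (F s))\<^sup>2 + (Im (F s))\<^sup>2) has_real_derivative 2 * (Re (F s) * Re F' + Im (F s) * Im F')) (at s within S)"
    using DERIV_add[OF DERIV_power[OF d(1), of 2] DERIV_power[OF d(2), of 2]] by (simp add: algebra_simps)
  from DERIV_cdivide[OF DERIV_chain'[OF this DERIV_ln_divide[OF pos]], of 2]
  have "((\<lambda>s. ln ((Re (F s))\<^sup>2 + (Im (F s))\<^sup>2) / 2) has_real_derivative Re (F' / F s)) (at s within S)"
  proof (rule DERIV_cong)
    have "1 / p * (2 * q) / 2 = q / p" for p q :: real by simp
    then show "1 / ((Re (F s))\<^sup>2 + (Im (F s))\<^sup>2) * (2 * (Re (F s) * Re F' + Im (F s) * Im F')) / 2 = Re (F' / F s)"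
      unfolding Re_divide by (metis mult.commute)
  qed
  moreover have "ln ((Re (F s))\<^sup>2 + (Im (F s))\<^sup>2) / 2 = ln (cmod (F s))" for s
    by (simp add: cmod_def ln_sqrt)
  ultimately show ?thesis by simp
qed

section \<open>Logarithmic derivatives of the complexified cocycle\<close>

text \<open>
  The data on one compact parameter interval. The matrices \<open>A1\<close> and \<open>A2\<close> are the first two derivatives of \<open>A\<close> in the
  parameter, and the constants \<open>\<kappa>\<close> and \<open>C\<close> are uniform over the base. The inequalities \<open>\<kappa> \<le> 1 \<le> C\<close> are a
  normalisation.
\<close>

locale twisting_family =
  fixes f :: "'a \<Rightarrow> 'a" and A A1 A2 :: "real \<Rightarrow> 'a \<Rightarrow> real^2^2" and \<alpha> \<beta> \<kappa> C :: real
  assumes less: "\<alpha> < \<beta>" and kap: "0 < \<kappa>" "\<kappa> \<le> 1" and C1: "1 \<le> C"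
    and tan: "\<And>\<theta> x. \<theta> \<in> {\<alpha>..\<beta>} \<Longrightarrow> tangent \<kappa> (A \<theta> x) (A1 \<theta> x)"
    and d1: "\<And>\<theta> x i j. \<theta> \<in> {\<alpha>..\<beta>} \<Longrightarrow>
       ((\<lambda>\<theta>. A \<theta> x $ i $ j) has_real_derivative A1 \<theta> x $ i $ j) (at \<theta> within {\<alpha>..\<beta>})"
    and d2: "\<And>\<theta> x i j. \<theta> \<in> {\<alpha>..\<beta>} \<Longrightarrow>
       ((\<lambda>\<theta>. A1 \<theta> x $ i $ j) has_real_derivative A2 \<theta> x $ i $ j) (at \<theta> within {\<alpha>..\<beta>})"
    and c2: "\<And>x i j. continuous_on {\<alpha>..\<beta>} (\<lambda>\<theta>. A2 \<theta> x $ i $ j)"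
    and bd: "\<And>\<theta> x. \<theta> \<in> {\<alpha>..\<beta>} \<Longrightarrow> frob (A \<theta> x) \<le> C"
            "\<And>\<theta> x. \<theta> \<in> {\<alpha>..\<beta>} \<Longrightarrow> frob (A1 \<theta> x) \<le> C"
            "\<And>\<theta> x. \<theta> \<in> {\<alpha>..\<beta>} \<Longrightarrow> frob (A2 \<theta> x) \<le> C"
begin

text \<open>
  The row vector \<open>(1, -\<i>) M(f\<^bsup>n-1\<^esup> x) \<dots> M(x)\<close>. The orbit is followed forward from \<open>x\<close>, so the matrix at
  \<open>x\<close> comes last. \<open>row_ds\<close> and \<open>row_dtheta\<close> are its derivatives, written out by the product rule.
\<close>

primrec row :: "nat \<Rightarrow> real \<Rightarrow> real \<Rightarrow> 'a \<Rightarrow> complex \<times> complex" where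
  "row 0 \<theta> s x = (1, -\<i>)"
| "row (Suc n) \<theta> s x = row_act (row n \<theta> s (f x)) (A \<theta> x) (A1 \<theta> x) s"

primrec row_ds :: "nat \<Rightarrow> real \<Rightarrow> real \<Rightarrow> 'a \<Rightarrow> complex \<times> complex" where
  "row_ds 0 \<theta> s x = (0, 0)"
| "row_ds (Suc n) \<theta> s x = row_act (row_ds n \<theta> s (f x)) (A \<theta> x) (A1 \<theta> x) s + row_act (row n \<theta> s (f x)) 0 (A1 \<theta> x) 1"

primrec row_dtheta :: "nat \<Rightarrow> real \<Rightarrow> real \<Rightarrow> 'a \<Rightarrow> complex \<times> complex" where
  "row_dtheta 0 \<theta> s x = (0, 0)"
| "row_dtheta (Suc n) \<theta> s x = row_act (row_dtheta n \<theta> s (f x)) (A \<theta> x) (A1 \<theta> x) s + row_act (row n \<theta> s (f x)) (A1 \<theta> x) (A2 \<theta> x) s"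

definition amp :: "nat \<Rightarrow> real \<Rightarrow> real \<Rightarrow> 'a \<Rightarrow> complex" where
  "amp n \<theta> s x = cdot (row n \<theta> s x) (1, \<i>)"

definition \<delta> :: real where "\<delta> = \<kappa> / (2 * C\<^sup>2)"

lemma delta: "0 < \<delta>" "\<delta> \<le> 1/2" "\<kappa> / C / (2 * C) = \<delta>"
proof -
  show "0 < \<delta>" using kap C1 by (simp add: \<delta>_def)
  have "1 \<le> C\<^sup>2" using C1 by simp
  then have "\<kappa> \<le> C\<^sup>2" using kap by linarith
  then show "\<delta> \<le> 1/2" using C1 unfolding \<delta>_def by (simp add: field_simps)
  show "\<kappa> / C / (2 * C) = \<delta>" by (simp add: \<delta>_def power2_eq_square)
qed

lemma nsq_step:
  assumes "\<theta> \<in> {\<alpha>..\<beta>}" "s \<in> {0..1}"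
  shows "nsq (row_act c (A \<theta> x) (A1 \<theta> x) s) \<le> 2 * C * nsq c"
proof -
  have "s\<^sup>2 * frob (A1 \<theta> x) \<le> 1 * C" 
    using assms bd(2)[OF assms(1), of x] by (intro mult_mono) (auto simp: power_le_one)
  then have "frob (A \<theta> x) + s\<^sup>2 * frob (A1 \<theta> x) \<le> 2 * C" using bd(1)[OF assms(1), of x] by simp
  then show ?thesis using nsq_row_act_le[of c "A \<theta> x" "A1 \<theta> x" s] mult_right_mono[OF _ nsq_nonneg] 
    by (meson order_trans)
qed

text \<open>
  After one step the row is inside the contracted half-plane, at relative depth \<open>s \<delta>\<close>; the initial row \<open>(1, -\<i>)\<close> is as
  deep as possible.
\<close>

lemma herm_row:
  assumes "\<theta> \<in> {\<alpha>..\<beta>}" "s \<in> {0..1}"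
  shows "herm (row n \<theta> s x) \<le> -1" and "herm (row n \<theta> s x) \<le> - (s * \<delta> * nsq (row n \<theta> s x))"
proof -
  have step: "herm (row (Suc n) \<theta> s x) \<le> herm (row n \<theta> s (f x)) - s * (\<kappa> / C) * nsq (row n \<theta> s (f x))"
    if "herm (row n \<theta> s (f x)) \<le> -1" for n x
    using herm_row_act_le[OF tan[OF assms(1), of x] kap(1) bd(1)[OF assms(1), of x], of "row n \<theta> s (f x)" s] C1 assms(2) that
    by simp
  have 1: "herm (row n \<theta> s x) \<le> -1" for n x
  proof (induction n arbitrary: x)
    case 0 show ?case by (simp add: herm_def)
  next
    case (Suc n)
    have "0 \<le> s * (\<kappa> / C) * nsq (row n \<theta> s (f x))" using kap C1 assms(2) by simp
    then show ?case using step[OF Suc, of x] Suc[of "f x"] by linarith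
  qed
  show "herm (row n \<theta> s x) \<le> -1" by (rule 1)
  show "herm (row n \<theta> s x) \<le> - (s * \<delta> * nsq (row n \<theta> s x))"
  proof (cases n)
    case 0
    have "s * \<delta> \<le> 1 * (1/2)" using delta assms(2) by (intro mult_mono) auto
    then show ?thesis using 0 by (simp add: herm_def nsq_def)
  next
    case (Suc m)
    have "herm (row n \<theta> s x) \<le> - (s * (\<kappa> / C) * nsq (row m \<theta> s (f x)))"
      using step[OF 1, of m x] 1[of m "f x"] Suc by simp
    moreover have "s * (\<kappa> / C) * (nsq (row n \<theta> s x) / (2 * C)) \<le> s * (\<kappa> / C) * nsq (row m \<theta> s (f x))"
      using nsq_step[OF assms, of "row m \<theta> s (f x)" x] Suc C1 kap assms(2)
      by (intro mult_left_mono) (simp_all add: field_simps)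
    moreover have "s * (\<kappa> / C) * (nsq (row n \<theta> s x) / (2 * C)) = s * \<delta> * nsq (row n \<theta> s x)"
      by (simp add: delta(3)[symmetric])
    ultimately show ?thesis by linarith
  qed
qed

lemma cdot_row_nonzero:
  assumes "\<theta> \<in> {\<alpha>..\<beta>}" "s \<in> {0..1}" "0 < herm v"
  shows "cdot (row n \<theta> s x) v \<noteq> 0"
proof -
  have "0 < - 4 * herm (row n \<theta> s x) * herm v"
    using herm_row(1)[OF assms(1,2), of n x] assms(3) by (simp add: mult_neg_pos)
  then show ?thesis using cdot_ge_herm[of "row n \<theta> s x" v] by auto
qed

lemma herm_v0: "herm (1, \<i>) = 1" by (simp add: herm_def)

lemma amp_nonzero: "\<theta> \<in> {\<alpha>..\<beta>} \<Longrightarrow> s \<in> {0..1} \<Longrightarrow> amp n \<theta> s x \<noteq> 0"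
  unfolding amp_def by (rule cdot_row_nonzero) (auto simp: herm_v0)

lemma herm_step:
  assumes "\<theta> \<in> {\<alpha>..\<beta>}" "s \<in> {0..1}" "0 < herm v"
  shows "herm v + s * \<kappa> * nsq v \<le> herm (col_act (A \<theta> x) (A1 \<theta> x) s v)"
        "0 < herm (col_act (A \<theta> x) (A1 \<theta> x) s v)"
proof -
  show 1: "herm v + s * \<kappa> * nsq v \<le> herm (col_act (A \<theta> x) (A1 \<theta> x) s v)"
    using herm_col_act_ge[OF tan[OF assms(1)] kap(1)] assms(2,3) by simp
  have "0 \<le> s * \<kappa> * nsq v" using assms(2) kap by simp
  then show "0 < herm (col_act (A \<theta> x) (A1 \<theta> x) s v)" using 1 assms(3) by linarith
qed

lemma cdot_add: "cdot (c + d) v = cdot c v + cdot d v"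
  by (simp add: cdot_def algebra_simps)

text \<open>
  The product rule writes the logarithmic derivative as a sum over the factors of terms as in \<open>twist_nonneg\<close>. The induction peels
  the last factor off the row and absorbs it into the column, which is why \<open>v\<close> must be arbitrary.
\<close>

lemma log_derivative_nonneg:
  assumes "\<theta> \<in> {\<alpha>..\<beta>}" "s \<in> {0..1}" "0 < herm v"
  shows "0 \<le> Re (cdot (row_ds n \<theta> s x) v / cdot (row n \<theta> s x) v)"
  using assms(3)
proof (induction n arbitrary: x v)
  case 0 show ?case by (simp add: cdot_def)
next
  case (Suc n)
  let ?u = "col_act (A \<theta> x) (A1 \<theta> x) s v" and ?c = "row n \<theta> s (f x)"
  have "0 \<le> Re (cdot (row_ds n \<theta> s (f x)) ?u / cdot ?c ?u)"
    by (rule Suc.IH) (rule herm_step[OF assms(1,2) Suc.prems])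
  moreover have "0 \<le> Re (cdot ?c (col_act 0 (A1 \<theta> x) 1 v) / cdot ?c ?u)"
    using twist_nonneg[OF tan[OF assms(1)] kap(1), of ?c v s x] herm_row(1)[OF assms(1,2), of n "f x"]
      Suc.prems assms(2) by simp
  ultimately show ?case by (simp add: cdot_add cdot_row_act add_divide_distrib)
qed

text \<open>
  The bound for the violation of the Cauchy-Riemann equation by one factor. It does not depend on \<open>s\<close>: the violation is
  \<open>s A2\<close>, and the denominator is at least \<open>2 s (\<delta> \<kappa>)\<^bsup>1/2\<^esup> |c| |v|\<close> because both the row and the column have depth
  proportional to \<open>s\<close>.
\<close>

definition E0 :: real where "E0 = sqrt (C / (4 * \<delta> * \<kappa>))"

lemma E0_nonneg: "0 \<le> E0" using C1 delta kap by (simp add: E0_def)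

text \<open>
  A holomorphic extension would have \<open>\<partial>\<^sub>s = \<i> \<partial>\<^sub>\<theta>\<close>. The first-order extension satisfies this up to a bounded error per
  factor; the induction is that of \<open>log_derivative_nonneg\<close>.
\<close>

lemma cauchy_riemann_defect:
  assumes "\<theta> \<in> {\<alpha>..\<beta>}" "s \<in> {0..1}" "0 < herm v"
  shows "cmod ((cdot (row_ds n \<theta> s x) v - \<i> * cdot (row_dtheta n \<theta> s x) v) / cdot (row n \<theta> s x) v) \<le> real n * E0"
  using assms(3)
proof (induction n arbitrary: x v)
  case 0 show ?case by (simp add: cdot_def)
next
  case (Suc n)
  let ?u = "col_act (A \<theta> x) (A1 \<theta> x) s v" and ?c = "row n \<theta> s (f x)"
  have IH: "cmod ((cdot (row_ds n \<theta> s (f x)) ?u - \<i> * cdot (row_dtheta n \<theta> s (f x)) ?u) / cdot ?c ?u) \<le> real n * E0"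
    by (rule Suc.IH) (rule herm_step[OF assms(1,2) Suc.prems])
  let ?w = "cdot ?c (col_act (A2 \<theta> x) 0 0 v)"
  \<comment> \<open>The defect of a single factor.\<close>
  have eq: "cdot ?c (col_act 0 (A1 \<theta> x) 1 v) - \<i> * cdot ?c (col_act (A1 \<theta> x) (A2 \<theta> x) s v) = s * ?w"
    unfolding cdot_def col_act_def by (simp add: complex_eq_iff algebra_simps)
  have "cmod (s * ?w / cdot ?c ?u) \<le> E0"
  proof -
    have nz: "cdot ?c ?u \<noteq> 0" 
      by (rule cdot_row_nonzero[OF assms(1,2)]) (rule herm_step[OF assms(1,2) Suc.prems])
    have h1: "s * \<delta> * nsq ?c \<le> - herm ?c" using herm_row(2)[OF assms(1,2), of n "f x"] by linarith
    have h2: "s * \<kappa> * nsq v \<le> herm ?u" using herm_step(1)[OF assms(1,2) Suc.prems, of x] Suc.prems by linarith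
    have "4 * ((s * \<delta> * nsq ?c) * (s * \<kappa> * nsq v)) \<le> 4 * (- herm ?c * herm ?u)"
      using h1 h2 herm_row(1)[OF assms(1,2), of n "f x"] assms(2) kap delta
      by (intro mult_left_mono mult_mono) auto
    also have "\<dots> \<le> (cmod (cdot ?c ?u))\<^sup>2" using cdot_ge_herm[of ?c ?u] by simp
    finally have low: "4 * \<delta> * \<kappa> * (s\<^sup>2 * (nsq ?c * nsq v)) \<le> (cmod (cdot ?c ?u))\<^sup>2"
      by (simp add: power2_eq_square algebra_simps)
    have "(cmod ?w)\<^sup>2 \<le> nsq ?c * nsq (col_act (A2 \<theta> x) 0 0 v)" by (rule cmod_cdot_le)
    also have "\<dots> \<le> nsq ?c * (C * nsq v)"
    proof (rule mult_left_mono)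
      show "nsq (col_act (A2 \<theta> x) 0 0 v) \<le> C * nsq v"
        using nsq_col_act_le[of "A2 \<theta> x" 0 0 v] mult_right_mono[OF bd(3)[OF assms(1), of x] nsq_nonneg[of v]]
        by simp
    qed simp
    finally have "s\<^sup>2 * (cmod ?w)\<^sup>2 \<le> s\<^sup>2 * (nsq ?c * (C * nsq v))" by (rule mult_left_mono) simp
    also have "\<dots> = C / (4 * \<delta> * \<kappa>) * (4 * \<delta> * \<kappa> * (s\<^sup>2 * (nsq ?c * nsq v)))"
      using delta kap by simp
    also have "\<dots> \<le> C / (4 * \<delta> * \<kappa>) * (cmod (cdot ?c ?u))\<^sup>2"
      using low C1 delta kap by (intro mult_left_mono) auto
    finally have "(cmod (s * ?w / cdot ?c ?u))\<^sup>2 \<le> C / (4 * \<delta> * \<kappa>)"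
      using nz by (simp add: norm_divide norm_mult power_mult_distrib power_divide divide_le_eq)
    then show ?thesis unfolding E0_def by (rule real_le_rsqrt)
  qed
  moreover have "(cdot (row_ds (Suc n) \<theta> s x) v - \<i> * cdot (row_dtheta (Suc n) \<theta> s x) v) / cdot (row (Suc n) \<theta> s x) v
     = (cdot (row_ds n \<theta> s (f x)) ?u - \<i> * cdot (row_dtheta n \<theta> s (f x)) ?u) / cdot ?c ?u + s * ?w / cdot ?c ?u"
    unfolding eq[symmetric] by (simp add: cdot_add cdot_row_act diff_divide_distrib add_divide_distrib algebra_simps)
  ultimately show ?case using IH norm_triangle_ineq[of "(cdot (row_ds n \<theta> s (f x)) ?u - \<i> * cdot (row_dtheta n \<theta> s (f x)) ?u) / cdot ?c ?u" "s * ?w / cdot ?c ?u"]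
    by (simp add: algebra_simps)
qed


lemma row_act_has_vector_derivative:
  assumes "((\<lambda>t. fst (c t)) has_vector_derivative fst c') (at t within S)"
    "((\<lambda>t. snd (c t)) has_vector_derivative snd c') (at t within S)"
    "\<And>i j. ((\<lambda>t. P t $ i $ j) has_real_derivative P' $ i $ j) (at t within S)"
    "\<And>i j. ((\<lambda>t. r t * Q t $ i $ j) has_real_derivative r' * Q' $ i $ j) (at t within S)"
  shows "((\<lambda>t. fst (row_act (c t) (P t) (Q t) (r t))) has_vector_derivative
            fst (row_act c' (P t) (Q t) (r t) + row_act (c t) P' Q' r')) (at t within S)"
    "((\<lambda>t. snd (row_act (c t) (P t) (Q t) (r t))) has_vector_derivative
            snd (row_act c' (P t) (Q t) (r t) + row_act (c t) P' Q' r')) (at t within S)"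
proof -
  have C: "((\<lambda>t. Complex (P t $ i $ j) (r t * Q t $ i $ j)) has_vector_derivative
      Complex (P' $ i $ j) (r' * Q' $ i $ j)) (at t within S)" for i j
    using assms(3,4)[of i j] by (simp add: has_vector_derivative_complex_iff)
  note m1 = has_vector_derivative_mult[OF assms(1) C]
  note m2 = has_vector_derivative_mult[OF assms(2) C]
  show "((\<lambda>t. fst (row_act (c t) (P t) (Q t) (r t))) has_vector_derivative
            fst (row_act c' (P t) (Q t) (r t) + row_act (c t) P' Q' r')) (at t within S)"
    using has_vector_derivative_add[OF m1[of 1 1] m2[of 2 1]] by (simp add: row_act_def algebra_simps)
  show "((\<lambda>t. snd (row_act (c t) (P t) (Q t) (r t))) has_vector_derivative
            snd (row_act c' (P t) (Q t) (r t) + row_act (c t) P' Q' r')) (at t within S)"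
    using has_vector_derivative_add[OF m1[of 1 2] m2[of 2 2]] by (simp add: row_act_def algebra_simps)
qed

lemma row_derivative_s:
  "((\<lambda>s. fst (row n \<theta> s x)) has_vector_derivative fst (row_ds n \<theta> s x)) (at s within S) \<and>
   ((\<lambda>s. snd (row n \<theta> s x)) has_vector_derivative snd (row_ds n \<theta> s x)) (at s within S)"
proof (induction n arbitrary: x)
  case 0 show ?case by simp
next
  case (Suc n)
  show ?case unfolding row.simps row_ds.simps
    by (intro conjI row_act_has_vector_derivative[where P = "\<lambda>_. A \<theta> x" and Q = "\<lambda>_. A1 \<theta> x" and r = "\<lambda>s. s"])
       (use Suc[of "f x"] in \<open>auto intro!: derivative_eq_intros\<close>)
qed

lemma row_derivative_theta:
  assumes "\<theta> \<in> {\<alpha>..\<beta>}"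
  shows "((\<lambda>\<theta>. fst (row n \<theta> s x)) has_vector_derivative fst (row_dtheta n \<theta> s x)) (at \<theta> within {\<alpha>..\<beta>}) \<and>
   ((\<lambda>\<theta>. snd (row n \<theta> s x)) has_vector_derivative snd (row_dtheta n \<theta> s x)) (at \<theta> within {\<alpha>..\<beta>})"
proof (induction n arbitrary: x)
  case 0 show ?case by simp
next
  case (Suc n)
  have "((\<lambda>\<theta>. s * A1 \<theta> x $ i $ j) has_real_derivative s * A2 \<theta> x $ i $ j) (at \<theta> within {\<alpha>..\<beta>})" for i j
    using DERIV_cmult[OF d2[OF assms]] by auto
  then show ?case unfolding row.simps row_dtheta.simps
    by (intro conjI row_act_has_vector_derivative[where P = "\<lambda>\<theta>. A \<theta> x" and Q = "\<lambda>\<theta>. A1 \<theta> x" and r = "\<lambda>_. s"])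
       (use Suc[of "f x"] d1[OF assms] in auto)
qed

lemma cdot_has_vector_derivative:
  assumes "((\<lambda>t. fst (c t)) has_vector_derivative fst c') (at t within S) \<and>
    ((\<lambda>t. snd (c t)) has_vector_derivative snd c') (at t within S)"
  shows "((\<lambda>t. cdot (c t) v) has_vector_derivative cdot c' v) (at t within S)"
  unfolding cdot_def
  by (intro has_vector_derivative_add has_vector_derivative_mult_left) (use assms in auto)

lemma amp_derivative_s: "((\<lambda>s. amp n \<theta> s x) has_vector_derivative cdot (row_ds n \<theta> s x) (1, \<i>)) (at s within S)"
  unfolding amp_def by (rule cdot_has_vector_derivative) (rule row_derivative_s)

lemma amp_derivative_theta:
  "\<theta> \<in> {\<alpha>..\<beta>} \<Longrightarrow>
   ((\<lambda>\<theta>. amp n \<theta> s x) has_vector_derivative cdot (row_dtheta n \<theta> s x) (1, \<i>)) (at \<theta> within {\<alpha>..\<beta>})"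
  unfolding amp_def by (rule cdot_has_vector_derivative) (rule row_derivative_theta)

text \<open>
  Going off the real parameter axis can only increase growth. This sign makes the theorem of Fatou applicable later.
\<close>

lemma ln_amp_mono:
  assumes "\<theta> \<in> {\<alpha>..\<beta>}" "s \<in> {0..1}"
  shows "ln (cmod (amp n \<theta> 0 x)) \<le> ln (cmod (amp n \<theta> s x))"
proof (rule DERIV_nonneg_imp_nondecreasing[where f = "\<lambda>s. ln (cmod (amp n \<theta> s x))"])
  show "0 \<le> s" using assms by simp
  fix r assume r: "0 \<le> r" "r \<le> s"
  then have r': "r \<in> {0..1}" using assms by simp
  have "((\<lambda>r. ln (cmod (amp n \<theta> r x))) has_real_derivative Re (cdot (row_ds n \<theta> r x) (1, \<i>) / amp n \<theta> r x)) (at r)"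
    by (rule has_real_derivative_ln_cmod[OF amp_derivative_s amp_nonzero[OF assms(1) r']])
  moreover have "0 \<le> Re (cdot (row_ds n \<theta> r x) (1, \<i>) / amp n \<theta> r x)"
    unfolding amp_def by (rule log_derivative_nonneg[OF assms(1) r']) (simp add: herm_v0)
  ultimately show "\<exists>y. ((\<lambda>r. ln (cmod (amp n \<theta> r x))) has_real_derivative y) (at r) \<and> 0 \<le> y" by blast
qed

lemma coeff_continuous:
  "continuous_on {\<alpha>..\<beta>} (\<lambda>\<theta>. A \<theta> x $ i $ j)" "continuous_on {\<alpha>..\<beta>} (\<lambda>\<theta>. A1 \<theta> x $ i $ j)"
  by (rule DERIV_continuous_on[OF d1] DERIV_continuous_on[OF d2], assumption)+

lemma row_continuous:
  "continuous_on (S \<times> {\<alpha>..\<beta>}) (\<lambda>p. fst (row n (snd p) (fst p) x)) \<and>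
   continuous_on (S \<times> {\<alpha>..\<beta>}) (\<lambda>p. snd (row n (snd p) (fst p) x))"
proof (induction n arbitrary: x)
  case 0 show ?case by simp
next
  case (Suc n)
  have e: "continuous_on (S \<times> {\<alpha>..\<beta>}) (\<lambda>p. A (snd p) x $ i $ j)"
    "continuous_on (S \<times> {\<alpha>..\<beta>}) (\<lambda>p. A1 (snd p) x $ i $ j)" for x i j
    by (rule continuous_on_compose2[OF coeff_continuous(1)] continuous_on_compose2[OF coeff_continuous(2)];
        auto intro!: continuous_intros)+
  show ?case using Suc[of "f x"] by (auto simp: row_act_def intro!: continuous_intros e)
qed

lemma row_ds_continuous:
  "continuous_on (S \<times> {\<alpha>..\<beta>}) (\<lambda>p. fst (row_ds n (snd p) (fst p) x)) \<and>
   continuous_on (S \<times> {\<alpha>..\<beta>}) (\<lambda>p. snd (row_ds n (snd p) (fst p) x))"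
proof (induction n arbitrary: x)
  case 0 show ?case by simp
next
  case (Suc n)
  have e: "continuous_on (S \<times> {\<alpha>..\<beta>}) (\<lambda>p. A (snd p) x $ i $ j)"
    "continuous_on (S \<times> {\<alpha>..\<beta>}) (\<lambda>p. A1 (snd p) x $ i $ j)" for x i j
    by (rule continuous_on_compose2[OF coeff_continuous(1)] continuous_on_compose2[OF coeff_continuous(2)];
        auto intro!: continuous_intros)+
  show ?case using Suc[of "f x"] row_continuous[of S n "f x"]
    by (auto simp: row_act_def intro!: continuous_intros e)
qed

lemma amp_continuous: "continuous_on (S \<times> {\<alpha>..\<beta>}) (\<lambda>p. amp n (snd p) (fst p) x)"
  unfolding amp_def cdot_def using row_continuous[of S n x] by (auto intro!: continuous_intros)

lemma continuous_on_section:
  assumes "continuous_on ({r} \<times> S) (\<lambda>p. g (snd p) (fst p))"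
  shows "continuous_on S (\<lambda>\<theta>. g \<theta> r)"
proof -
  have "continuous_on S (\<lambda>\<theta>. (\<lambda>p. g (snd p) (fst p)) (r, \<theta>))"
    by (rule continuous_on_compose2[OF assms]) (auto intro!: continuous_intros)
  then show ?thesis by simp
qed

lemma amp_continuous_theta: "continuous_on {\<alpha>..\<beta>} (\<lambda>\<theta>. amp n \<theta> s x)"
  by (rule continuous_on_section[of s _ "\<lambda>\<theta> s. amp n \<theta> s x"]) (rule amp_continuous)

definition K1 :: real where "K1 = pi + 2 * sqrt (2 * C) * (\<beta> - \<alpha>)"

text \<open>
  The ratio of consecutive values of \<open>amp\<close> is \<open>a / 2\<close> times a factor in the right half-plane. Here \<open>a\<close> depends on one matrix only and
  has bounded logarithmic derivative, and the second factor cannot turn by more than \<open>\<pi>\<close>, whatever the row is.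
\<close>

lemma argument_variation:
  assumes s: "s \<in> {0..1}"
  shows "\<exists>I. ((\<lambda>\<theta>. Im (cdot (row_dtheta n \<theta> s x) (1, \<i>) / amp n \<theta> s x)) has_integral I) {\<alpha>..\<beta>} \<and> \<bar>I\<bar> \<le> real n * K1"
proof (induction n arbitrary: x)
  case 0 show ?case by (auto simp: cdot_def)
next
  case (Suc n)
  then obtain I where I: "((\<lambda>\<theta>. Im (cdot (row_dtheta n \<theta> s (f x)) (1, \<i>) / amp n \<theta> s (f x))) has_integral I) {\<alpha>..\<beta>}"
    and I_le: "\<bar>I\<bar> \<le> real n * K1" by blast
  define u where "u \<theta> = col_act (A \<theta> x) (A1 \<theta> x) s (1, \<i>)" for \<theta>
  define a where "a \<theta> = cdot (row_act (1, -\<i>) (A \<theta> x) (A1 \<theta> x) s) (1, \<i>)" for \<theta>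
  define a' where "a' \<theta> = cdot (row_act (1, -\<i>) (A1 \<theta> x) (A2 \<theta> x) s) (1, \<i>)" for \<theta>
  have a_u: "a \<theta> = cdot (1, -\<i>) (u \<theta>)" for \<theta> by (simp add: a_def u_def cdot_row_act)
  have hu: "1 \<le> herm (u \<theta>)" if "\<theta> \<in> {\<alpha>..\<beta>}" for \<theta>
  proof -
    have "0 \<le> s * \<kappa> * nsq (1, \<i>)" using s kap by simp
    then show ?thesis using herm_step(1)[OF that s, of "(1, \<i>)" x] by (simp add: herm_v0 u_def)
  qed
  have da: "(a has_vector_derivative a' \<theta>) (at \<theta> within {\<alpha>..\<beta>})" if "\<theta> \<in> {\<alpha>..\<beta>}" for \<theta>
  proof -
    have dA1: "((\<lambda>\<theta>. s * A1 \<theta> x $ i $ j) has_real_derivative s * A2 \<theta> x $ i $ j) (at \<theta> within {\<alpha>..\<beta>})" for i j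
      using DERIV_cmult[OF d2[OF that]] by auto
    have "(a has_vector_derivative cdot (row_act (0, 0) (A \<theta> x) (A1 \<theta> x) s + row_act (1, -\<i>) (A1 \<theta> x) (A2 \<theta> x) s) (1, \<i>))
        (at \<theta> within {\<alpha>..\<beta>})"
      unfolding a_def
      by (intro cdot_has_vector_derivative conjI
           row_act_has_vector_derivative[where P = "\<lambda>\<theta>. A \<theta> x" and Q = "\<lambda>\<theta>. A1 \<theta> x" and r = "\<lambda>_. s" and c = "\<lambda>_. (1, -\<i>)"])
         (use d1[OF that] dA1 in auto)
    then show ?thesis by (simp add: a'_def cdot_add) (simp add: cdot_def row_act_def)
  qed
  have a_ge: "1 \<le> cmod (a \<theta>)" if "\<theta> \<in> {\<alpha>..\<beta>}" for \<theta>
  proof -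
    have "(1::real)\<^sup>2 \<le> (cmod (a \<theta>))\<^sup>2"
      using cdot_ge_herm[of "(1, -\<i>)" "u \<theta>"] hu[OF that] by (simp add: a_u herm_def)
    then show ?thesis by (rule power2_le_imp_le) simp
  qed
  have a'_le: "cmod (a' \<theta>) \<le> 2 * sqrt (2 * C)" if "\<theta> \<in> {\<alpha>..\<beta>}" for \<theta>
  proof -
    have "(cmod (a' \<theta>))\<^sup>2 \<le> nsq (1, -\<i>) * nsq (col_act (A1 \<theta> x) (A2 \<theta> x) s (1, \<i>))"
      unfolding a'_def cdot_row_act by (rule cmod_cdot_le)
    also have "\<dots> \<le> 2 * ((C + 1 * C) * 2)"
    proof -
      have "nsq (col_act (A1 \<theta> x) (A2 \<theta> x) s (1, \<i>)) \<le> (frob (A1 \<theta> x) + s\<^sup>2 * frob (A2 \<theta> x)) * nsq (1, \<i>)"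
        by (rule nsq_col_act_le)
      also have "\<dots> \<le> (C + 1 * C) * nsq (1, \<i>)"
        using bd[OF that, of x] s by (intro mult_right_mono add_mono mult_mono) (auto simp: power_le_one)
      finally show ?thesis by (simp add: nsq_def)
    qed
    also have "\<dots> = (2 * sqrt (2 * C))\<^sup>2" using C1 by (simp add: power_mult_distrib)
    finally show ?thesis by (rule power2_le_imp_le) (use C1 in simp)
  qed
  have a_cont: "continuous_on {\<alpha>..\<beta>} a"
    by (rule continuous_on_vector_derivative[OF da])
  have a'_cont: "continuous_on {\<alpha>..\<beta>} a'"
    unfolding a'_def cdot_def row_act_def by (auto intro!: continuous_intros coeff_continuous c2)
  have "(\<lambda>\<theta>. Im (a' \<theta> / a \<theta>)) integrable_on {\<alpha>..\<beta>}"
    using a_ge by (intro integrable_continuous_interval continuous_intros a_cont a'_cont) force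
  then obtain I' where I': "((\<lambda>\<theta>. Im (a' \<theta> / a \<theta>)) has_integral I') {\<alpha>..\<beta>}" by blast
  have I'_le: "\<bar>I'\<bar> \<le> 2 * sqrt (2 * C) * (\<beta> - \<alpha>)"
  proof -
    have "norm (Im (a' \<theta> / a \<theta>)) \<le> 2 * sqrt (2 * C)" if "\<theta> \<in> {\<alpha>..\<beta>}" for \<theta>
    proof -
      have "\<bar>Im (a' \<theta> / a \<theta>)\<bar> \<le> cmod (a' \<theta>) / cmod (a \<theta>)"
        by (rule order_trans[OF abs_Im_le_cmod]) (simp add: norm_divide)
      also have "\<dots> \<le> 2 * sqrt (2 * C) / 1"
        using a_ge[OF that] a'_le[OF that] C1 by (intro frac_le) auto
      finally show ?thesis by simp
    qed
    then show ?thesis using has_integral_bound_real[OF _ _ I', of "2 * sqrt (2 * C)" "{}"] C1 less by simp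
  qed
  \<comment> \<open>The quotient of successive amplitudes by \<open>a\<close>, multiplied by a positive number to avoid derivatives of quotients.\<close>
  define D where "D \<theta> = amp n \<theta> s (f x) * a \<theta>" for \<theta>
  define N where "N \<theta> = amp (Suc n) \<theta> s x * cnj (D \<theta>)" for \<theta>
  define F1' where "F1' \<theta> = cdot (row_dtheta (Suc n) \<theta> s x) (1, \<i>)" for \<theta>
  define F0' where "F0' \<theta> = cdot (row_dtheta n \<theta> s (f x)) (1, \<i>)" for \<theta>
  define N' where "N' \<theta> = amp (Suc n) \<theta> s x * cnj (amp n \<theta> s (f x) * a' \<theta> + F0' \<theta> * a \<theta>)
       + F1' \<theta> * cnj (D \<theta>)" for \<theta>
  have N_pos: "0 < Re (N \<theta>)" if \<theta>: "\<theta> \<in> {\<alpha>..\<beta>}" for \<theta>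
  proof -
    define c where "c = row n \<theta> s (f x)"
    define b where "b = cdot (1, \<i>) (u \<theta>)"
    define p where "p = cdot c (1, - \<i>)"
    have D: "D \<theta> = cdot c (1, \<i>) * a \<theta>" by (simp add: D_def amp_def c_def)
    have comm: "cdot y z = cdot z y" for y z by (simp add: cdot_def mult.commute)
    \<comment> \<open>Expand \<open>u\<close> in the basis \<open>(1, \<i>)\<close>, \<open>(1, -\<i>)\<close>; the first component dominates since \<open>herm u > 0\<close>, and likewise for the row.\<close>
    have "2 * amp (Suc n) \<theta> s x = D \<theta> + b * p"
      unfolding D a_u b_def p_def by (simp add: amp_def cdot_row_act c_def u_def) (simp add: cdot_def algebra_simps)
    then have eq: "2 * N \<theta> = D \<theta> * cnj (D \<theta>) + b * p * cnj (D \<theta>)"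
      unfolding N_def by (metis distrib_right mult.assoc)
    have "(cmod b)\<^sup>2 < (cmod (a \<theta>))\<^sup>2"
      unfolding b_def a_u comm[of "(1, _)"] cdot_plus cdot_minus using hu[OF \<theta>] by linarith
    then have 1: "cmod b < cmod (a \<theta>)" by (rule power2_less_imp_less) simp
    have "(cmod p)\<^sup>2 \<le> (cmod (cdot c (1, \<i>)))\<^sup>2"
      unfolding p_def cdot_plus cdot_minus using herm_row(1)[OF \<theta> s, of n "f x"] by (simp add: c_def)
    then have 2: "cmod p \<le> cmod (cdot c (1, \<i>))" by (rule power2_le_imp_le) simp
    have 3: "0 < cmod (cdot c (1, \<i>))" using amp_nonzero[OF \<theta> s, of n "f x"] by (simp add: amp_def c_def)
    have "cmod (b * p) < cmod (D \<theta>)"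
    proof -
      have "cmod b * cmod p \<le> cmod b * cmod (cdot c (1, \<i>))" using 2 by (intro mult_left_mono) auto
      also have "\<dots> < cmod (a \<theta>) * cmod (cdot c (1, \<i>))" using 1 3 by (intro mult_strict_right_mono) auto
      finally show ?thesis by (simp add: D norm_mult mult.commute)
    qed
    moreover from this have "0 < cmod (D \<theta>)" by (meson norm_ge_zero le_less_trans)
    ultimately have "cmod (b * p) * cmod (D \<theta>) < cmod (D \<theta>) * cmod (D \<theta>)" by (intro mult_strict_right_mono) auto
    moreover have "- (cmod (b * p) * cmod (D \<theta>)) \<le> Re (b * p * cnj (D \<theta>))"
      using abs_Re_le_cmod[of "b * p * cnj (D \<theta>)"] by (simp add: norm_mult)
    moreover have "Re (D \<theta> * cnj (D \<theta>)) = cmod (D \<theta>) * cmod (D \<theta>)"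
      by (simp add: complex_norm_square[symmetric] power2_eq_square[symmetric])
    ultimately have "0 < Re (2 * N \<theta>)" unfolding eq plus_complex.sel by linarith
    then show ?thesis by simp
  qed
  have N_der: "(N has_vector_derivative N' \<theta>) (at \<theta> within {\<alpha>..\<beta>})" if \<theta>: "\<theta> \<in> {\<alpha>..\<beta>}" for \<theta>
  proof -
    have "(D has_vector_derivative (amp n \<theta> s (f x) * a' \<theta> + F0' \<theta> * a \<theta>)) (at \<theta> within {\<alpha>..\<beta>})"
      unfolding D_def F0'_def by (intro has_vector_derivative_mult amp_derivative_theta da \<theta>)
    then show ?thesis
      unfolding N_def N'_def F1'_def
      by (intro has_vector_derivative_mult amp_derivative_theta has_vector_derivative_cnj \<theta>)
  qed
  have "((Ln \<circ> N) has_vector_derivative (N' \<theta> * inverse (N \<theta>))) (at \<theta> within {\<alpha>..\<beta>})" if \<theta>: "\<theta> \<in> {\<alpha>..\<beta>}" for \<theta>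
  proof (rule field_vector_diff_chain_within[OF N_der[OF \<theta>]])
    have "N \<theta> \<notin> \<real>\<^sub>\<le>\<^sub>0" using N_pos[OF \<theta>] by (auto simp: complex_nonpos_Reals_iff)
    then show "(Ln has_field_derivative inverse (N \<theta>)) (at (N \<theta>) within N ` {\<alpha>..\<beta>})"
      by (rule has_field_derivative_at_within[OF has_field_derivative_Ln])
  qed
  from fundamental_theorem_of_calculus[OF less_imp_le[OF less] this]
  have "((\<lambda>\<theta>. N' \<theta> * inverse (N \<theta>)) has_integral (Ln \<circ> N) \<beta> - (Ln \<circ> N) \<alpha>) {\<alpha>..\<beta>}" .
  from has_integral_linear[OF this bounded_linear_Im]
  have LN: "((\<lambda>\<theta>. Im (N' \<theta> / N \<theta>)) has_integral Im (Ln (N \<beta>)) - Im (Ln (N \<alpha>))) {\<alpha>..\<beta>}"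
    by (simp add: o_def divide_inverse)
  have "\<bar>Im (Ln (N \<theta>))\<bar> < pi / 2" if \<theta>: "\<theta> \<in> {\<alpha>..\<beta>}" for \<theta>
    using N_pos[OF \<theta>] Re_Ln_pos_lt[of "N \<theta>"] by fastforce
  from this[of \<alpha>] this[of \<beta>] have LN_le: "\<bar>Im (Ln (N \<beta>)) - Im (Ln (N \<alpha>))\<bar> \<le> pi" using less by simp
  have eq: "Im (N' \<theta> / N \<theta>) + Im (F0' \<theta> / amp n \<theta> s (f x)) + Im (a' \<theta> / a \<theta>) = Im (F1' \<theta> / amp (Suc n) \<theta> s x)"
    if \<theta>: "\<theta> \<in> {\<alpha>..\<beta>}" for \<theta>
  proof -
    have nz: "amp n \<theta> s (f x) \<noteq> 0" "a \<theta> \<noteq> 0" "amp (Suc n) \<theta> s x \<noteq> 0"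
      using amp_nonzero[OF \<theta> s] a_ge[OF \<theta>] by auto
    have "N' \<theta> / N \<theta> = F1' \<theta> / amp (Suc n) \<theta> s x + cnj (F0' \<theta> / amp n \<theta> s (f x) + a' \<theta> / a \<theta>)"
      unfolding N'_def N_def D_def using nz by (simp add: field_simps)
    then have "Im (N' \<theta> / N \<theta>) = Im (F1' \<theta> / amp (Suc n) \<theta> s x)
        + - (Im (F0' \<theta> / amp n \<theta> s (f x)) + Im (a' \<theta> / a \<theta>))"
      by (simp only: plus_complex.sel cnj.sel)
    then show ?thesis by linarith
  qed
  have "((\<lambda>\<theta>. Im (F1' \<theta> / amp (Suc n) \<theta> s x)) has_integral Im (Ln (N \<beta>)) - Im (Ln (N \<alpha>)) + I + I') {\<alpha>..\<beta>}"
    by (rule has_integral_eq[OF eq has_integral_add[OF has_integral_add[OF LN I[folded F0'_def]] I']])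
  moreover have "\<bar>Im (Ln (N \<beta>)) - Im (Ln (N \<alpha>)) + I + I'\<bar> \<le> real (Suc n) * K1"
    using LN_le I_le I'_le by (simp add: K1_def algebra_simps)
  ultimately show ?case unfolding F1'_def by blast
qed

definition K2 :: real where "K2 = K1 + E0 * (\<beta> - \<alpha>)"

lemma K2_nonneg: "0 \<le> K2"
  unfolding K2_def K1_def using less E0_nonneg C1 by simp

lemma ln_amp_integrable: "s \<in> {0..1} \<Longrightarrow> (\<lambda>\<theta>. ln (cmod (amp n \<theta> s x))) integrable_on {\<alpha>..\<beta>}"
  using amp_nonzero by (intro integrable_continuous_interval continuous_intros amp_continuous_theta) auto

text \<open>
  The derivative in \<open>s\<close> of the integral of \<open>ln |amp|\<close> is, by the approximate Cauchy-Riemann equation, minus the total change of the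
  argument, up to \<open>O(n)\<close>.
\<close>

lemma integral_ln_amp_increment:
  assumes s: "s \<in> {0..1}"
  shows "integral {\<alpha>..\<beta>} (\<lambda>\<theta>. ln (cmod (amp n \<theta> s x)) - ln (cmod (amp n \<theta> 0 x))) \<le> K2 * real n * s"
proof -
  define d where "d r \<theta> = Re (cdot (row_ds n \<theta> r x) (1, \<i>) / amp n \<theta> r x)" for r \<theta>
  define \<Phi> where "\<Phi> r = integral {\<alpha>..\<beta>} (\<lambda>\<theta>. ln (cmod (amp n \<theta> r x)))" for r
  have d_le: "integral {\<alpha>..\<beta>} (d r) \<le> K2 * real n" if r: "r \<in> {0..s}" for r
  proof -
    have r1: "r \<in> {0..1}" using r s by auto
    obtain I where I: "((\<lambda>\<theta>. Im (cdot (row_dtheta n \<theta> r x) (1, \<i>) / amp n \<theta> r x)) has_integral I) {\<alpha>..\<beta>}"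
      and I_le: "\<bar>I\<bar> \<le> real n * K1" using argument_variation[OF r1] by blast
    have J: "((\<lambda>\<theta>. - Im (cdot (row_dtheta n \<theta> r x) (1, \<i>) / amp n \<theta> r x) + real n * E0) has_integral - I + real n * E0 * (\<beta> - \<alpha>)) {\<alpha>..\<beta>}"
      using has_integral_add[OF has_integral_neg[OF I] has_integral_const_real[of "real n * E0" \<alpha> \<beta>]] less
      by (simp add: mult.commute)
    have le: "d r \<theta> \<le> - Im (cdot (row_dtheta n \<theta> r x) (1, \<i>) / amp n \<theta> r x) + real n * E0" if \<theta>: "\<theta> \<in> {\<alpha>..\<beta>}" for \<theta>
    proof -
      let ?e = "(cdot (row_ds n \<theta> r x) (1, \<i>) - \<i> * cdot (row_dtheta n \<theta> r x) (1, \<i>)) / amp n \<theta> r x"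
      have "Re ?e \<le> real n * E0"
        using cauchy_riemann_defect[OF \<theta> r1, of "(1, \<i>)" n x] complex_Re_le_cmod[of ?e]
        by (simp add: herm_v0 amp_def)
      moreover have "?e = cdot (row_ds n \<theta> r x) (1, \<i>) / amp n \<theta> r x - \<i> * (cdot (row_dtheta n \<theta> r x) (1, \<i>) / amp n \<theta> r x)"
        by (simp add: diff_divide_distrib)
      ultimately show ?thesis unfolding d_def by (simp only: minus_complex.sel Re_i_times)
    qed
    have "continuous_on {\<alpha>..\<beta>} (d r)"
    proof -
      have "continuous_on {\<alpha>..\<beta>} (\<lambda>\<theta>. fst (row_ds n \<theta> r x))" "continuous_on {\<alpha>..\<beta>} (\<lambda>\<theta>. snd (row_ds n \<theta> r x))"
        using row_ds_continuous[of "{r}" n x] continuous_on_section[of r "{\<alpha>..\<beta>}" "\<lambda>\<theta> r. fst (row_ds n \<theta> r x)"]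
          continuous_on_section[of r "{\<alpha>..\<beta>}" "\<lambda>\<theta> r. snd (row_ds n \<theta> r x)"] by blast+
      then show ?thesis unfolding d_def cdot_def using amp_nonzero r1
        by (auto intro!: continuous_intros amp_continuous_theta)
    qed
    then have "d r integrable_on {\<alpha>..\<beta>}" by (rule integrable_continuous_interval)
    then have "integral {\<alpha>..\<beta>} (d r) \<le> - I + real n * E0 * (\<beta> - \<alpha>)"
      using has_integral_le[OF integrable_integral J le] by blast
    also have "\<dots> \<le> K2 * real n" using I_le by (simp add: K2_def algebra_simps)
    finally show ?thesis .
  qed
  have der: "(\<Phi> has_vector_derivative integral {\<alpha>..\<beta>} (d r)) (at r within {0..s})" if r: "r \<in> {0..s}" for r
  proof -
    have "continuous_on ({0..s} \<times> {\<alpha>..\<beta>}) (\<lambda>(r, \<theta>). d r \<theta>)"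
      unfolding d_def split_beta cdot_def using row_ds_continuous[of "{0..s}" n x] amp_nonzero s
      by (auto intro!: continuous_intros amp_continuous)
    moreover have "((\<lambda>r. ln (cmod (amp n \<theta> r x))) has_vector_derivative d r' \<theta>) (at r' within {0..s})"
      if "r' \<in> {0..s}" "\<theta> \<in> cbox \<alpha> \<beta>" for r' \<theta>
      unfolding d_def has_real_derivative_iff_has_vector_derivative[symmetric]
      by (rule has_real_derivative_ln_cmod[OF amp_derivative_s amp_nonzero]) (use that s in auto)
    moreover have "(\<lambda>\<theta>. ln (cmod (amp n \<theta> r' x))) integrable_on cbox \<alpha> \<beta>" if "r' \<in> {0..s}" for r'
      using ln_amp_integrable[of r'] that s by simp
    ultimately show ?thesis
      using leibniz_rule_vector_derivative[of "{0..s}" \<alpha> \<beta> "\<lambda>r \<theta>. ln (cmod (amp n \<theta> r x))" d r] r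
      unfolding \<Phi>_def by simp
  qed
  obtain r where r: "r \<in> {0..s}" "\<Phi> s - \<Phi> 0 = (s - 0) * integral {\<alpha>..\<beta>} (d r)"
    using mvt_very_simple[of 0 s \<Phi> "\<lambda>r h. h * integral {\<alpha>..\<beta>} (d r)"] der s
    by (auto simp: has_vector_derivative_def)
  have "\<Phi> s - \<Phi> 0 \<le> s * (K2 * real n)"
    using r d_le[OF r(1)] s by (auto intro: mult_left_mono)
  moreover have "integral {\<alpha>..\<beta>} (\<lambda>\<theta>. ln (cmod (amp n \<theta> s x)) - ln (cmod (amp n \<theta> 0 x))) = \<Phi> s - \<Phi> 0"
    unfolding \<Phi>_def using s by (intro integral_diff ln_amp_integrable) auto
  ultimately show ?thesis by (simp add: mult_ac)
qed

end

section \<open>Almost everywhere convergence of convex combinations\<close>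

definition convex_weights :: "nat \<Rightarrow> (nat \<Rightarrow> real) \<Rightarrow> bool" where
  "convex_weights n c \<longleftrightarrow> (\<forall>j. 0 \<le> c j) \<and> (\<forall>j<n. c j = 0) \<and> finite {j. c j \<noteq> 0} \<and> (\<Sum>j | c j \<noteq> 0. c j) = 1"

text \<open>
  The mean of the sequence \<open>g\<close> with weights \<open>c\<close>. Weights vanish outside a finite set and, for \<open>convex_weights n\<close>, before index
  \<open>n\<close>; so these are the finite convex combinations of a tail of the sequence.
\<close>

definition mix :: "(nat \<Rightarrow> real) \<Rightarrow> (nat \<Rightarrow> 'b::real_vector) \<Rightarrow> 'b" where
  "mix c g = (\<Sum>j | c j \<noteq> 0. c j *\<^sub>R g j)"

lemma mix_superset:
  assumes "finite S" "{j. c j \<noteq> 0} \<subseteq> S"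
  shows "mix c g = (\<Sum>j\<in>S. c j *\<^sub>R g j)"
  unfolding mix_def by (rule sum.mono_neutral_left) (use assms in auto)

lemma sum_weights_superset:
  fixes c :: "nat \<Rightarrow> real"
  assumes "finite S" "{j. c j \<noteq> 0} \<subseteq> S"
  shows "(\<Sum>j | c j \<noteq> 0. c j) = sum c S"
  by (rule sum.mono_neutral_left) (use assms in auto)

lemma convex_weights_antimono: "convex_weights n c \<Longrightarrow> m \<le> n \<Longrightarrow> convex_weights m c"
  by (auto simp: convex_weights_def)

lemma convex_weights_single: "convex_weights n (\<lambda>j. if j = n then 1 else 0)"
  by (auto simp: convex_weights_def)

lemma convex_weights_midpoint:
  assumes "convex_weights n c" "convex_weights n d"
  shows "convex_weights n (\<lambda>j. (c j + d j) / 2)"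
    and "mix (\<lambda>j. (c j + d j) / 2) g = (1/2) *\<^sub>R (mix c g + mix d g)"
proof -
  define S where "S = {j. c j \<noteq> 0} \<union> {j. d j \<noteq> 0}"
  have S: "finite S" "{j. c j \<noteq> 0} \<subseteq> S" "{j. d j \<noteq> 0} \<subseteq> S" "{j. (c j + d j) / 2 \<noteq> 0} \<subseteq> S"
    using assms by (auto simp: S_def convex_weights_def)
  have "(\<Sum>j | (c j + d j) / 2 \<noteq> 0. (c j + d j) / 2) = 1"
    unfolding sum_weights_superset[OF S(1,4)]
    using assms sum_weights_superset[OF S(1,2)] sum_weights_superset[OF S(1,3)]
    by (simp add: sum_divide_distrib[symmetric] sum.distrib convex_weights_def)
  then show "convex_weights n (\<lambda>j. (c j + d j) / 2)"
    using assms finite_subset[OF S(4,1)] by (simp add: convex_weights_def)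
  show "mix (\<lambda>j. (c j + d j) / 2) g = (1/2) *\<^sub>R (mix c g + mix d g)"
    unfolding mix_superset[OF S(1,2)] mix_superset[OF S(1,3)] mix_superset[OF S(1,4)]
    by (simp add: sum.distrib[symmetric] scaleR_sum_right scaleR_add_left[symmetric] scaleR_add_right[symmetric] add_divide_distrib)
qed

lemma mix_const: "convex_weights n c \<Longrightarrow> mix c (\<lambda>_. a) = a"
  by (simp add: mix_def convex_weights_def scaleR_sum_left[symmetric])

lemma mix_mono:
  fixes g h :: "nat \<Rightarrow> real"
  assumes "convex_weights n c" "\<And>j. n \<le> j \<Longrightarrow> g j \<le> h j"
  shows "mix c g \<le> mix c h"
  unfolding mix_def using assms
  by (intro sum_mono) (auto simp: convex_weights_def not_le[symmetric] intro!: mult_left_mono)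

lemma mix_add: "mix c (\<lambda>j. g j + h j) = mix c g + mix c h"
  by (simp add: mix_def scaleR_add_right sum.distrib)

lemma mix_linear:
  assumes "linear T"
  shows "mix c (\<lambda>j. T (g j)) = T (mix c g)"
  using assms by (simp add: mix_def linear_sum linear_cmul)

lemma integral_mix_le:
  fixes r :: "nat \<Rightarrow> 'a \<Rightarrow> real^'n"
  assumes "convex_weights n c" "\<And>j i. integrable M (\<lambda>x. r j x $ i)" "\<And>j i. (\<integral>x. r j x $ i \<partial>M) \<le> C"
  shows "integrable M (\<lambda>x. mix c (\<lambda>j. r j x) $ i)" "(\<integral>x. mix c (\<lambda>j. r j x) $ i \<partial>M) \<le> C"
proof -
  have eq: "mix c (\<lambda>j. r j x) $ i = (\<Sum>j | c j \<noteq> 0. c j * r j x $ i)" for x by (simp add: mix_def)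
  show "integrable M (\<lambda>x. mix c (\<lambda>j. r j x) $ i)" unfolding eq using assms(2) by auto
  have "(\<integral>x. mix c (\<lambda>j. r j x) $ i \<partial>M) = mix c (\<lambda>j. \<integral>x. r j x $ i \<partial>M)"
    unfolding eq mix_def using assms(2) by (simp add: Bochner_Integration.integral_sum)
  also have "\<dots> \<le> mix c (\<lambda>_. C)" by (rule mix_mono[OF assms(1,3)])
  finally show "(\<integral>x. mix c (\<lambda>j. r j x) $ i \<partial>M) \<le> C" by (simp add: mix_const[OF assms(1)])
qed

lemma mix_tendsto_zero:
  fixes e :: "nat \<Rightarrow> real"
  assumes "e \<longlonglongrightarrow> 0" "\<And>k. convex_weights k (c k)"
  shows "(\<lambda>k. mix (c k) e) \<longlonglongrightarrow> 0"
proof (rule LIMSEQ_I)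
  fix r :: real assume "0 < r"
  then obtain N where N: "\<And>n. N \<le> n \<Longrightarrow> \<bar>e n\<bar> < r/2"
    using LIMSEQ_D[OF assms(1), of "r/2"] by auto
  have "norm (mix (c k) e - 0) < r" if "N \<le> k" for k
  proof -
    have e: "e j \<le> r/2" "- (r/2) \<le> e j" if "k \<le> j" for j using N[of j] that \<open>N \<le> k\<close> by linarith+
    have "mix (c k) e \<le> mix (c k) (\<lambda>_. r/2)"
      by (rule mix_mono[OF assms(2)]) (rule e)
    moreover have "mix (c k) (\<lambda>_. - (r/2)) \<le> mix (c k) e"
      by (rule mix_mono[OF assms(2)]) (rule e)
    ultimately show ?thesis using \<open>0 < r\<close> by (simp add: mix_const[OF assms(2)])
  qed
  then show "\<exists>no. \<forall>n\<ge>no. norm (mix (c n) e - 0) < r" by blast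
qed

lemma borel_measurable_vecI:
  fixes g :: "'a \<Rightarrow> 'b::euclidean_space^'n"
  assumes [measurable]: "\<And>i. (\<lambda>x. g x $ i) \<in> borel_measurable M"
  shows "g \<in> borel_measurable M"
  by (rule borel_measurable_euclidean_space[THEN iffD2])
     (auto simp: Basis_vec_def inner_axis)

lemma borel_measurable_vec_nth [measurable (raw)]:
  fixes g :: "'a \<Rightarrow> 'b::euclidean_space^'n"
  assumes "g \<in> borel_measurable M"
  shows "(\<lambda>x. g x $ i) \<in> borel_measurable M"
  using measurable_compose[OF assms borel_measurable_continuous_onI[of "\<lambda>v. v $ i"]]
  by (simp add: continuous_on_component)

text \<open>
  For each tail choose a convex combination \<open>g\<close> that almost minimises the expectation of \<open>exp (- g)\<close>, summed over the
  coordinates. The infima increase with the tail and converge. Since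
  \<open>exp (- g) + exp (- g') - 2 exp (- (g + g')/2) = (exp (- g/2) - exp (- g'/2))\<^sup>2\<close> and the midpoint is again admissible, the functions
  \<open>exp (- g/2)\<close> form a Cauchy sequence in mean square. The bound on the integrals excludes the limit zero, that is, an infinite limit
  of \<open>g\<close>.
\<close>

theorem convex_combinations_converge_AE:
  fixes r :: "nat \<Rightarrow> 'a \<Rightarrow> real^'n"
  assumes "prob_space M" and meas[measurable]: "\<And>j. r j \<in> borel_measurable M"
    and nonneg: "\<And>j x i. 0 \<le> r j x $ i"
    and int: "\<And>j i. integrable M (\<lambda>x. r j x $ i)" and bound: "\<And>j i. (\<integral>x. r j x $ i \<partial>M) \<le> C"
  obtains c where "\<And>k. convex_weights k (c k)"
    and "AE x in M. convergent (\<lambda>k. mix (c k) (\<lambda>j. r j x))"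
proof -
  interpret prob_space M by fact
  \<comment> \<open>This \<open>h\<close> is \<open>exp (- g/2)\<close> for the combination \<open>g\<close> with weights \<open>c\<close>.\<close>
  define h where "h c x = (\<chi> i. exp (- (mix c (\<lambda>j. r j x) $ i) / 2))" for c x
  define \<Phi> where "\<Phi> c = (\<Sum>i\<in>UNIV. \<integral>x. (h c x $ i)\<^sup>2 \<partial>M)" for c
  have mixm[measurable]: "(\<lambda>x. mix c (\<lambda>j. r j x)) \<in> borel_measurable M" for c unfolding mix_def by measurable
  have hm[measurable]: "h c \<in> borel_measurable M" for c
    unfolding h_def by (rule borel_measurable_vecI) simp
  have mix0: "0 \<le> mix c (\<lambda>j. r j x) $ i" if "convex_weights n c" for n c x i
    using that nonneg by (auto simp: mix_def convex_weights_def intro!: sum_nonneg)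
  have h01: "0 < h c x $ i" "h c x $ i \<le> 1" if "convex_weights n c" for n c x i
    using mix0[OF that, of x i] by (auto simp: h_def)
  have hprod: "h c x $ i * h d x $ i = (h (\<lambda>j. (c j + d j) / 2) x $ i)\<^sup>2" 
    if "convex_weights n c" "convex_weights n d" for n c d x i
    unfolding h_def using convex_weights_midpoint(2)[OF that, of "\<lambda>j. r j x"]
    by (simp add: exp_add[symmetric] power2_eq_square field_simps)
  have integ: "integrable M (\<lambda>x. h c x $ i * h d x $ i)" if "convex_weights n c" "convex_weights n d" for n c d i
    by (rule integrable_const_bound[where B = 1])
       (use h01[OF that(1)] h01[OF that(2)] in \<open>auto intro!: AE_I2 mult_le_one simp: abs_mult less_imp_le\<close>)
  have integ1: "integrable M (\<lambda>x. h c x)" if "convex_weights n c" for n c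
  proof (rule integrable_const_bound[where B = "real CARD('n)"])
    have "norm (h c x) \<le> (\<Sum>i\<in>UNIV. \<bar>h c x $ i\<bar>)" for x by (rule norm_le_l1_cart)
    also have "(\<Sum>i\<in>UNIV. \<bar>h c x $ i\<bar>) \<le> (\<Sum>i\<in>(UNIV::'n set). 1)" for x
      by (rule sum_mono) (use h01[OF that] in \<open>simp add: less_imp_le\<close>)
    finally have "norm (h c x) \<le> (\<Sum>i\<in>(UNIV::'n set). 1)" for x .
    then show "AE x in M. norm (h c x) \<le> real CARD('n)" by simp
  qed simp
  define J where "J n = Inf (\<Phi> ` {c. convex_weights n c})" for n
  have ne: "{c. convex_weights n c} \<noteq> {}" for n using convex_weights_single by blast
  have Phi0: "0 \<le> \<Phi> c" for c unfolding \<Phi>_def by (intro sum_nonneg integral_nonneg_AE) auto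
  have bdd: "bdd_below (\<Phi> ` S)" for S using Phi0 by (intro bdd_belowI) auto
  have J_le: "J n \<le> \<Phi> c" if "convex_weights n c" for n c
    unfolding J_def by (rule cInf_lower[OF _ bdd]) (use that in auto)
  have Phi1: "\<Phi> c \<le> real CARD('n)" if "convex_weights n c" for n c
  proof -
    have "(\<integral>x. (h c x $ i)\<^sup>2 \<partial>M) \<le> (\<integral>x. 1 \<partial>M)" for i
      using integ[OF that that] h01[OF that]
      by (intro integral_mono) (auto simp: power2_eq_square less_imp_le intro!: mult_le_one)
    then have "\<Phi> c \<le> (\<Sum>i\<in>(UNIV::'n set). 1)" unfolding \<Phi>_def by (intro sum_mono) (simp add: prob_space)
    then show ?thesis by simp
  qed
  have "incseq J"
    unfolding J_def
  proof (rule incseq_SucI)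
    fix n
    show "Inf (\<Phi> ` {c. convex_weights n c}) \<le> Inf (\<Phi> ` {c. convex_weights (Suc n) c})"
      by (rule cInf_superset_mono[OF _ bdd image_mono]) (use ne convex_weights_antimono[of "Suc n"] in auto)
  qed
  moreover have "J n \<le> real CARD('n)" for n
    using order_trans[OF J_le Phi1] convex_weights_single by blast
  ultimately have "convergent J" by (meson incseq_convergent convergent_def)
  then have "Cauchy J" by (rule convergent_Cauchy)
  have "\<exists>c. convex_weights n c \<and> \<Phi> c < J n + 1 / real (Suc n)" for n
  proof -
    have "J n < J n + 1 / real (Suc n)" by simp
    then show ?thesis unfolding J_def using cInf_lessD[of "\<Phi> ` {c. convex_weights n c}"] ne by blast
  qed
  then obtain c where c: "\<And>n. convex_weights n (c n)" and c_le: "\<And>n. \<Phi> (c n) < J n + 1 / real (Suc n)"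
    by metis
  define dist2 where "dist2 n m = (\<Sum>i\<in>UNIV. \<integral>x. (h (c n) x $ i - h (c m) x $ i)\<^sup>2 \<partial>M)" for n m
  have intsq: "integrable M (\<lambda>x. (h (c n) x $ i - h (c m) x $ i)\<^sup>2)" for n m i
    using integ[OF convex_weights_antimono[OF c[of n]] convex_weights_antimono[OF c[of m]], of 0]
      integ[OF c[of n] c[of n]] integ[OF c[of m] c[of m]]
    by (simp add: power2_diff power2_eq_square[of "h _ _ $ _"] mult.assoc)
  have dist2_le: "dist2 n m \<le> 1 / real (Suc n) + 1 / real (Suc m) + (J m - J n)" if "n \<le> m" for n m
  proof -
    let ?mid = "\<lambda>j. (c n j + c m j) / 2"
    have cm: "convex_weights n (c m)" using convex_weights_antimono[OF c that] .
    have "dist2 n m = (\<Sum>i\<in>UNIV. (\<integral>x. (h (c n) x $ i)\<^sup>2 \<partial>M) + (\<integral>x. (h (c m) x $ i)\<^sup>2 \<partial>M) - 2 * (\<integral>x. (h ?mid x $ i)\<^sup>2 \<partial>M))"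
      unfolding dist2_def
    proof (rule sum.cong[OF refl])
      fix i
      show "(\<integral>x. (h (c n) x $ i - h (c m) x $ i)\<^sup>2 \<partial>M)
        = (\<integral>x. (h (c n) x $ i)\<^sup>2 \<partial>M) + (\<integral>x. (h (c m) x $ i)\<^sup>2 \<partial>M) - 2 * (\<integral>x. (h ?mid x $ i)\<^sup>2 \<partial>M)"
        unfolding hprod[OF c cm, symmetric] 
        using integ[OF c cm, of i] integ[OF c c, of n i] integ[OF cm cm, of i]
        by (simp add: power2_diff mult.assoc power2_eq_square[of "h _ _ $ _"])
    qed
    also have "\<dots> = \<Phi> (c n) + \<Phi> (c m) - 2 * \<Phi> ?mid"
      by (simp add: \<Phi>_def sum.distrib sum_subtractf sum_distrib_left)
    also have "\<dots> \<le> 1 / real (Suc n) + 1 / real (Suc m) + (J m - J n)"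
      using c_le[of n] c_le[of m] J_le[OF convex_weights_midpoint(1)[OF c cm]] by linarith
    finally show ?thesis .
  qed
  have "\<exists>N. \<forall>n\<ge>N. \<forall>m\<ge>N. (\<integral>x. norm (h (c n) x - h (c m) x) \<partial>M) < e" if "0 < e" for e
  proof -
    define K where "K = real CARD('n)"
    have K: "1 \<le> K" unfolding K_def by (simp add: Suc_leI)
    define d where "d = e / (4 * K)"
    have d: "0 < d" using \<open>0 < e\<close> K by (simp add: d_def)
    obtain N1 where N1: "\<And>n m. N1 \<le> n \<Longrightarrow> N1 \<le> m \<Longrightarrow> \<bar>J m - J n\<bar> < d * e / 4"
      using \<open>Cauchy J\<close> d \<open>0 < e\<close> unfolding Cauchy_def dist_real_def by (metis mult_pos_pos zero_less_divide_iff zero_less_numeral)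
    obtain N2 :: nat where N2: "1 / real (Suc N2) < d * e / 8"
      using reals_Archimedean[of "d * e / 8"] d \<open>0 < e\<close> by (auto simp: inverse_eq_divide)
    have small: "dist2 n m < d * e / 2" if "max N1 N2 \<le> n" "n \<le> m" for n m
    proof -
      have "1 / real (Suc n) \<le> 1 / real (Suc N2)" "1 / real (Suc m) \<le> 1 / real (Suc N2)"
        using that by (auto simp: field_simps)
      moreover have "\<bar>J m - J n\<bar> < d * e / 4" using N1[of n m] that by auto
      ultimately show ?thesis using dist2_le[OF that(2)] N2 by linarith
    qed
    have symd: "dist2 n m = dist2 m n" for n m
      unfolding dist2_def by (simp add: power2_commute)
    have "(\<integral>x. norm (h (c n) x - h (c m) x) \<partial>M) < e" if "max N1 N2 \<le> n" "max N1 N2 \<le> m" for n m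
    proof -
      have pt: "norm (h (c n) x - h (c m) x) \<le> K * d + (\<Sum>i\<in>UNIV. (h (c n) x $ i - h (c m) x $ i)\<^sup>2) / d" for x
      proof -
        have "\<bar>t\<bar> \<le> d + t\<^sup>2 / d" for t :: real
        proof -
          have "0 \<le> (\<bar>t\<bar> - d)\<^sup>2 + \<bar>t\<bar> * d" using d by simp
          then have "\<bar>t\<bar> * d \<le> d * d + t\<^sup>2" by (simp add: power2_eq_square algebra_simps)
          then show ?thesis using d by (simp add: field_simps)
        qed
        then have "norm (h (c n) x - h (c m) x) \<le> (\<Sum>i\<in>UNIV. d + (h (c n) x $ i - h (c m) x $ i)\<^sup>2 / d)"
          by (intro order_trans[OF norm_le_l1_cart] sum_mono) simp
        then show ?thesis by (simp add: sum.distrib sum_divide_distrib K_def)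
      qed
      have "(\<integral>x. norm (h (c n) x - h (c m) x) \<partial>M) \<le> (\<integral>x. K * d + (\<Sum>i\<in>UNIV. (h (c n) x $ i - h (c m) x $ i)\<^sup>2) / d \<partial>M)"
        using integ1[OF c] pt intsq by (intro integral_mono) auto
      also have "\<dots> = K * d + dist2 n m / d"
        using intsq by (simp add: dist2_def prob_space Bochner_Integration.integral_sum)
      also have "\<dots> < K * d + (d * e / 2) / d"
        using small[of n m] small[of m n] symd[of n m] that d
        by (intro add_strict_left_mono divide_strict_right_mono) (cases "n \<le> m"; simp)+
      also have "\<dots> \<le> e" using d \<open>0 < e\<close> K by (simp add: d_def)
      finally show ?thesis .
    qed
    then show ?thesis by blast
  qed
  from cauchy_L1_AE_cauchy_subseq[OF integ1[OF c] this]
  obtain q where q: "strict_mono q" and cau: "AE x in M. Cauchy (\<lambda>k. h (c (q k)) x)" by blast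
  have w: "convex_weights k (c (q k))" for k
    by (rule convex_weights_antimono[OF c]) (rule seq_suble[OF q])
  define g where "g k x = mix (c (q k)) (\<lambda>j. r j x)" for k x
  have g0: "0 \<le> g k x $ i" for k x i unfolding g_def by (rule mix0[OF c])
  have g_h: "g k x $ i = - 2 * ln (h (c (q k)) x $ i)" for k x i by (simp add: g_def h_def)
  have fin: "AE x in M. liminf (\<lambda>k. ennreal (g k x $ i)) < \<infinity>" for i
  proof -
    have gi: "(\<integral>\<^sup>+x. ennreal (g k x $ i) \<partial>M) \<le> ennreal C" for k
    proof -
      have I: "integrable M (\<lambda>x. g k x $ i)" and "(\<integral>x. g k x $ i \<partial>M) \<le> C"
        unfolding g_def by (rule integral_mix_le[OF w int bound])+
      then show ?thesis using nn_integral_eq_integral[OF I] g0 by (simp add: ennreal_leI)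
    qed
    have "(\<integral>\<^sup>+x. liminf (\<lambda>k. ennreal (g k x $ i)) \<partial>M) \<le> liminf (\<lambda>k. \<integral>\<^sup>+x. ennreal (g k x $ i) \<partial>M)"
      unfolding g_def by (rule nn_integral_liminf) measurable
    also have "\<dots> \<le> limsup (\<lambda>k. \<integral>\<^sup>+x. ennreal (g k x $ i) \<partial>M)" by (rule Liminf_le_Limsup) simp
    also have "\<dots> \<le> ennreal C" by (rule Limsup_bounded) (use gi in simp)
    finally have "(\<integral>\<^sup>+x. liminf (\<lambda>k. ennreal (g k x $ i)) \<partial>M) \<noteq> \<infinity>" by (auto simp: top_unique)
    from nn_integral_PInf_AE[OF _ this] show ?thesis 
      unfolding g_def by (auto simp: less_top[symmetric] elim!: AE_mp)
  qed
  then have fin': "AE x in M. \<forall>i. liminf (\<lambda>k. ennreal (g k x $ i)) < \<infinity>" by (simp add: AE_all_countable)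
  have "AE x in M. convergent (\<lambda>k. g k x)"
    using cau fin'
  proof eventually_elim
    case (elim x)
    from elim(1) obtain L where L: "(\<lambda>k. h (c (q k)) x) \<longlonglongrightarrow> L" by (meson Cauchy_convergent convergent_def)
    have Li: "(\<lambda>k. h (c (q k)) x $ i) \<longlonglongrightarrow> L $ i" for i using L by (rule tendsto_vec_nth)
    have pos: "0 < L $ i" for i
    proof (rule ccontr)
      assume "\<not> 0 < L $ i"
      moreover have "0 \<le> L $ i" by (rule LIMSEQ_le_const[OF Li]) (use h01[OF c] in \<open>auto simp: less_imp_le\<close>)
      ultimately have "(\<lambda>k. h (c (q k)) x $ i) \<longlonglongrightarrow> 0" using Li[of i] by simp
      moreover have "eventually (\<lambda>k. h (c (q k)) x $ i \<in> {0<..}) sequentially" using h01[OF c] by simp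
      ultimately have "filterlim (\<lambda>k. h (c (q k)) x $ i) (at_right 0) sequentially"
        unfolding filterlim_at by (auto elim: eventually_mono)
      from filterlim_compose[OF ln_at_0 this]
      have "filterlim (\<lambda>k. ln (h (c (q k)) x $ i)) at_bot sequentially" .
      then have "filterlim (\<lambda>k. g k x $ i) at_top sequentially"
        unfolding g_h
        using filterlim_tendsto_pos_mult_at_top[OF tendsto_const, of "2::real" "\<lambda>k. - ln (h (c (q k)) x $ i)"]
        by (simp add: filterlim_uminus_at_bot)
      then have "(\<lambda>k. ennreal (g k x $ i)) \<longlonglongrightarrow> \<infinity>"
        by (simp add: tendsto_PInfty_eq_at_top[symmetric] ennreal_tendsto_top_eq_at_top)
      then have "liminf (\<lambda>k. ennreal (g k x $ i)) = \<infinity>" by (intro lim_imp_Liminf) auto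
      then show False using elim(2)[rule_format, of i] by simp
    qed
    have "(\<lambda>k. g k x $ i) \<longlonglongrightarrow> - 2 * ln (L $ i)" for i
      unfolding g_h using pos[of i] by (intro tendsto_intros Li) auto
    then have "(\<lambda>k. g k x) \<longlonglongrightarrow> (\<chi> i. - 2 * ln (L $ i))" by (intro vec_tendstoI) simp
    then show ?case by (rule convergentI)
  qed
  then show thesis using that[of "\<lambda>k. c (q k)"] w unfolding g_def by blast
qed

section \<open>From almost invariant forms to a conjugacy\<close>

text \<open>
  A quadratic form is stored by its values at \<open>(1,0)\<close>, \<open>(0,1)\<close> and \<open>(1,1)\<close>. These are nonnegative when the form is, which the
  convergence theorem for convex combinations requires; the off-diagonal coefficient is \<open>(R$3 - R$1 - R$2) / 2\<close>.
\<close>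

definition quad :: "real^3 \<Rightarrow> real \<Rightarrow> real \<Rightarrow> real" where
  "quad R y z = R$1 * y\<^sup>2 + R$2 * z\<^sup>2 + (R$3 - R$1 - R$2) * (y * z)"

lemma quad_half: "quad R y z = R$1 * y\<^sup>2 + R$2 * z\<^sup>2 + 2 * ((R$3 - R$1 - R$2) / 2) * (y * z)"
  by (simp add: quad_def)

definition disc :: "real^3 \<Rightarrow> real" where
  "disc R = R$1 * R$2 - ((R$3 - R$1 - R$2) / 2)\<^sup>2"

text \<open>
  Positive definite of determinant at least one, that is \<open>R$2 \<ge> (1 + t\<^sup>2) / R$1\<close> with \<open>t\<close> the off-diagonal coefficient. The right-hand side is
  the supremum over \<open>a\<close> and \<open>b\<close> of \<open>2 a t + 2 b - (a\<^sup>2 + b\<^sup>2) R$1\<close>. Being a family of linear inequalities, the condition passes to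
  convex combinations and limits.
\<close>

definition fat :: "real^3 \<Rightarrow> bool" where
  "fat R \<longleftrightarrow> (\<forall>a b. 2 * b \<le> quad R (- a) 1 + b\<^sup>2 * R$1)"

lemma fatD:
  assumes "fat R"
  shows "0 < R$1" "1 \<le> disc R"
proof -
  define t where "t = (R$3 - R$1 - R$2) / 2"
  have f: "2 * b \<le> R$1 * a\<^sup>2 + R$2 - 2 * t * a + b\<^sup>2 * R$1" for a b
    using assms[unfolded fat_def, rule_format, of b a] by (simp add: quad_def t_def field_simps)
  show pos: "0 < R$1"
  proof (rule ccontr)
    assume "\<not> 0 < R$1"
    then have "(\<bar>R$2\<bar> + 1)\<^sup>2 * R$1 \<le> 0" by (intro mult_nonneg_nonpos) auto
    then show False using f[of "\<bar>R$2\<bar> + 1" 0] by simp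
  qed
  have "2 * (1 / R$1) \<le> R$1 * (t / R$1)\<^sup>2 + R$2 - 2 * t * (t / R$1) + (1 / R$1)\<^sup>2 * R$1" by (rule f)
  moreover have "R$1 * (t / R$1)\<^sup>2 = t\<^sup>2 / R$1" "(1 / R$1)\<^sup>2 * R$1 = 1 / R$1" "2 * t * (t / R$1) = 2 * (t\<^sup>2 / R$1)"
    using pos by (simp_all add: power2_eq_square)
  ultimately have "1 / R$1 + t\<^sup>2 / R$1 \<le> R$2" by linarith
  then have "(1 + t\<^sup>2) / R$1 \<le> R$2" by (simp add: add_divide_distrib)
  then have "1 + t\<^sup>2 \<le> R$2 * R$1" using pos by (simp add: pos_divide_le_eq)
  then show "1 \<le> disc R" by (simp add: disc_def t_def mult.commute)
qed

lemma linear_quad: "linear (\<lambda>R. quad R y z)"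
  by (rule linearI) (simp_all add: quad_def algebra_simps)

lemma quad_tendsto: "(R \<longlongrightarrow> L) F \<Longrightarrow> ((\<lambda>k. quad (R k) y z) \<longlongrightarrow> quad L y z) F"
  unfolding quad_def by (intro tendsto_intros)

lemma fat_mix:
  assumes "convex_weights n c" "\<And>j. fat (R j)"
  shows "fat (mix c R)"
  unfolding fat_def
proof (intro allI)
  fix a b
  have lin: "linear (\<lambda>R. quad R (- a) 1 + b\<^sup>2 * R$1)"
    by (rule linearI) (simp_all add: quad_def algebra_simps)
  have "2 * b = mix c (\<lambda>_. 2 * b)" by (simp add: mix_const[OF assms(1)])
  also have "\<dots> \<le> mix c (\<lambda>j. quad (R j) (- a) 1 + b\<^sup>2 * R j$1)"
    using assms(2) by (intro mix_mono[OF assms(1)]) (simp add: fat_def)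
  also have "\<dots> = quad (mix c R) (- a) 1 + b\<^sup>2 * mix c R$1" by (rule mix_linear[OF lin])
  finally show "2 * b \<le> quad (mix c R) (- a) 1 + b\<^sup>2 * mix c R$1" .
qed

lemma fat_limit:
  assumes "R \<longlonglongrightarrow> L" "\<And>k. fat (R k)"
  shows "fat L"
  unfolding fat_def
proof (intro allI)
  fix a b
  have "(\<lambda>k. quad (R k) (- a) 1 + b\<^sup>2 * R k$1) \<longlonglongrightarrow> quad L (- a) 1 + b\<^sup>2 * L$1"
    by (intro tendsto_intros quad_tendsto assms(1))
  then show "2 * b \<le> quad L (- a) 1 + b\<^sup>2 * L$1"
    by (rule LIMSEQ_le_const) (use assms(2) in \<open>auto simp: fat_def\<close>)
qed

text \<open>
  Write \<open>p = r + e\<close> with \<open>e\<close> nonnegative. The determinant of \<open>p\<close> exceeds that of \<open>r\<close> by the determinant of \<open>e\<close> plus a mixed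
  term \<open>w\<close>. Both are nonnegative, and both vanish only for \<open>e = 0\<close>.
\<close>

lemma ordered_forms_eq:
  fixes r1 r2 r3 p1 p2 p3 :: real
  assumes le: "\<And>y z. r1 * y\<^sup>2 + r2 * z\<^sup>2 + 2 * r3 * (y * z) \<le> p1 * y\<^sup>2 + p2 * z\<^sup>2 + 2 * p3 * (y * z)"
    and "0 < r1" "0 < r1 * r2 - r3\<^sup>2"
  shows "r1 * r2 - r3\<^sup>2 \<le> p1 * p2 - p3\<^sup>2"
    and "r1 * r2 - r3\<^sup>2 = p1 * p2 - p3\<^sup>2 \<Longrightarrow> p1 = r1 \<and> p2 = r2 \<and> p3 = r3"
proof -
  define e1 e2 e3 where "e1 = p1 - r1" and "e2 = p2 - r2" and "e3 = p3 - r3"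
  have e: "0 \<le> e1 * y\<^sup>2 + e2 * z\<^sup>2 + 2 * e3 * (y * z)" for y z
    using le[of y z] by (simp add: e1_def e2_def e3_def algebra_simps)
  have "0 \<le> e1" "0 \<le> e2" using e[of 1 0] e[of 0 1] by auto
  have dete: "0 \<le> e1 * e2 - e3\<^sup>2"
  proof (cases "e1 = 0")
    case False
    then have "0 < e1" using \<open>0 \<le> e1\<close> by simp
    have "0 \<le> e1 * (e1 * e2 - e3\<^sup>2)" using e[of "- e3" e1] by (simp add: power2_eq_square algebra_simps)
    then show ?thesis using \<open>0 < e1\<close> by (simp add: zero_le_mult_iff)
  next
    case True
    have "e3 = 0"
    proof (rule ccontr)
      assume "e3 \<noteq> 0"
      have "0 \<le> e2 + 2 * e3 * (- (e2 + 1) / (2 * e3))" using e[of "- (e2 + 1) / (2 * e3)" 1] True by simp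
      then show False using \<open>e3 \<noteq> 0\<close> by simp
    qed
    then show ?thesis using True by simp
  qed
  define w where "w = r1 * e2 + r2 * e1 - 2 * r3 * e3"
  have sum0: "p1 * p2 - p3\<^sup>2 = (r1 * r2 - r3\<^sup>2) + (e1 * e2 - e3\<^sup>2) + w"
    by (simp add: w_def e1_def e2_def e3_def power2_eq_square algebra_simps)
  have w: "r1 * w = (e1 * (- r3)\<^sup>2 + e2 * r1\<^sup>2 + 2 * e3 * (- r3 * r1)) + (r1 * r2 - r3\<^sup>2) * e1"
    by (simp add: w_def power2_eq_square algebra_simps)
  have a: "0 \<le> e1 * (- r3)\<^sup>2 + e2 * r1\<^sup>2 + 2 * e3 * (- r3 * r1)" by (rule e)
  have b: "0 \<le> (r1 * r2 - r3\<^sup>2) * e1" using assms(3) \<open>0 \<le> e1\<close> by simp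
  have "0 \<le> r1 * w" unfolding w using a b by simp
  then have "0 \<le> w" using assms(2) by (simp add: zero_le_mult_iff)
  then show "r1 * r2 - r3\<^sup>2 \<le> p1 * p2 - p3\<^sup>2" using sum0 dete by linarith
  assume "r1 * r2 - r3\<^sup>2 = p1 * p2 - p3\<^sup>2"
  then have "w = 0" using sum0 dete \<open>0 \<le> w\<close> by linarith
  then have "r1 * w \<le> 0" by simp
  then have "(r1 * r2 - r3\<^sup>2) * e1 = 0" "e1 * (- r3)\<^sup>2 + e2 * r1\<^sup>2 + 2 * e3 * (- r3 * r1) = 0"
    using a b w by linarith+
  moreover from this(1) have "e1 = 0" using assms(3) by simp
  moreover from this have "e3 = 0" using dete by simp
  ultimately have "e1 = 0" "e3 = 0" "e2 = 0" using assms(2) by auto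
  then show "p1 = r1 \<and> p2 = r2 \<and> p3 = r3" by (simp add: e1_def e2_def e3_def)
qed

text \<open>
  The upper triangular factor \<open>B\<close> with \<open>B\<^sup>T B\<close> equal to the form with diagonal \<open>q1\<close>, \<open>q2\<close> and off-diagonal coefficient \<open>q3\<close>,
  provided that its determinant is one.
\<close>

definition cholesky :: "real \<Rightarrow> real \<Rightarrow> real \<Rightarrow> real^2^2" where
  "cholesky q1 q2 q3 = (\<chi> i j. if i = 1 then (if j = 1 then sqrt q1 else q3 / sqrt q1)
                            else (if j = 1 then 0 else 1 / sqrt q1))"

lemma cholesky:
  assumes "0 < q1" "q1 * q2 - q3\<^sup>2 = 1"
  shows "det (cholesky q1 q2 q3) = 1"
    and "(norm (cholesky q1 q2 q3 *v v))\<^sup>2 = q1 * (v$1)\<^sup>2 + q2 * (v$2)\<^sup>2 + 2 * q3 * (v$1 * v$2)"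
    and "(opnorm (cholesky q1 q2 q3))\<^sup>2 \<le> q1 + q2"
proof -
  let ?B = "cholesky q1 q2 q3"
  show "det ?B = 1" using assms(1) by (simp add: det_2 cholesky_def)
  have n: "(norm u)\<^sup>2 = (u$1)\<^sup>2 + (u$2)\<^sup>2" for u :: "real^2"
    by (simp add: norm_vec_def L2_set_def sum_2)
  have q2: "q2 = (1 + q3\<^sup>2) / q1" using assms by (simp add: field_simps)
  have s: "sqrt q1 * sqrt q1 = q1" using assms(1) by simp
  show eq: "(norm (?B *v v))\<^sup>2 = q1 * (v$1)\<^sup>2 + q2 * (v$2)\<^sup>2 + 2 * q3 * (v$1 * v$2)" for v
  proof -
    have "(norm (?B *v v))\<^sup>2 = (sqrt q1 * v$1 + q3 / sqrt q1 * v$2)\<^sup>2 + (1 / sqrt q1 * v$2)\<^sup>2"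
      by (simp add: n matrix_vector_mult_def sum_2 cholesky_def)
    also have "\<dots> = (sqrt q1)\<^sup>2 * (v$1)\<^sup>2 + 2 * q3 * (v$1 * v$2) + (1 + q3\<^sup>2) / (sqrt q1)\<^sup>2 * (v$2)\<^sup>2"
    proof -
      have "(s * a + q3 / s * b)\<^sup>2 + (1 / s * b)\<^sup>2 = s\<^sup>2 * a\<^sup>2 + 2 * q3 * (a * b) + (1 + q3\<^sup>2) / s\<^sup>2 * b\<^sup>2"
        if "0 < s" for s a b :: real
        using that by (simp add: power2_eq_square field_simps)
      then show ?thesis using assms(1) by simp
    qed
    also have "\<dots> = q1 * (v$1)\<^sup>2 + q2 * (v$2)\<^sup>2 + 2 * q3 * (v$1 * v$2)"
      using assms(1) by (simp add: q2)
    finally show ?thesis .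
  qed
  have q2pos: "0 \<le> q2" unfolding q2 using assms(1) by simp
  have "norm (?B *v v) \<le> sqrt (q1 + q2) * norm v" for v
  proof (rule power2_le_imp_le)
    have "2 * (q3 * (v$1 * v$2)) \<le> q1 * (v$2)\<^sup>2 + q2 * (v$1)\<^sup>2"
    proof -
      define t where "t = v$1 * v$2"
      have "0 \<le> (q1 * v$2 - q3 * v$1)\<^sup>2 + (v$1)\<^sup>2" by simp
      also have "\<dots> = q1 * (q1 * (v$2)\<^sup>2 + q2 * (v$1)\<^sup>2 - 2 * (q3 * (v$1 * v$2)))"
        using assms(1) by (simp add: q2 power2_eq_square field_simps)
      finally show ?thesis using assms(1) by (simp add: zero_le_mult_iff)
    qed
    then have "(norm (?B *v v))\<^sup>2 \<le> (q1 + q2) * ((v$1)\<^sup>2 + (v$2)\<^sup>2)"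
      unfolding eq by (simp add: algebra_simps)
    also have "\<dots> = (sqrt (q1 + q2) * norm v)\<^sup>2"
      using assms(1) q2pos by (simp add: power_mult_distrib n)
    finally show "(norm (?B *v v))\<^sup>2 \<le> (sqrt (q1 + q2) * norm v)\<^sup>2" .
    show "0 \<le> sqrt (q1 + q2) * norm v" using assms(1) q2pos by simp
  qed
  then have "opnorm ?B \<le> sqrt (q1 + q2)" by (rule onorm_le)
  moreover have "0 \<le> opnorm ?B" by (rule onorm_pos_le) simp
  ultimately have "(opnorm ?B)\<^sup>2 \<le> (sqrt (q1 + q2))\<^sup>2" by (rule power_mono)
  then show "(opnorm ?B)\<^sup>2 \<le> q1 + q2" using assms(1) q2pos by simp
qed

lemma rotation_from_isometry:
  assumes "det B = 1" "det B' = 1" "det A = 1" and iso: "\<And>v. norm (B' *v (A *v v)) = norm (B *v v)"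
  shows "rotation_matrix (B' ** A ** matrix_inv (B :: real^2^2))"
proof -
  have inv: "B ** matrix_inv B = mat 1"
  proof -
    have "\<exists>B'. B ** B' = mat 1 \<and> B' ** B = mat 1"
      using assms(1) invertible_det_nz[of B] by (simp add: invertible_def)
    from someI_ex[OF this] show ?thesis unfolding matrix_inv_def by blast
  qed
  have "orthogonal_transformation (\<lambda>v. (B' ** A ** matrix_inv B) *v v)"
    unfolding orthogonal_transformation
  proof (intro conjI allI)
    fix v
    have "(B' ** A ** matrix_inv B) *v v = B' *v (A *v (matrix_inv B *v v))"
      by (simp add: matrix_vector_mul_assoc matrix_mul_assoc)
    then have "norm ((B' ** A ** matrix_inv B) *v v) = norm (B *v (matrix_inv B *v v))" by (simp add: iso)
    then show "norm ((B' ** A ** matrix_inv B) *v v) = norm v" by (simp add: matrix_vector_mul_assoc inv)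
  qed simp
  then have "orthogonal_matrix (B' ** A ** matrix_inv B)"
    by (simp add: orthogonal_transformation_matrix)
  moreover have "det (matrix_inv B) = 1"
    using arg_cong[OF inv, of det] assms(1) by (simp add: det_mul)
  ultimately show ?thesis using assms by (simp add: rotation_matrix_def det_mul)
qed


lemma quad_act:
  fixes A :: "real^2^2"
  defines "T \<equiv> \<lambda>S. vector [quad S (A$1$1) (A$2$1), quad S (A$1$2) (A$2$2), quad S (A$1$1 + A$1$2) (A$2$1 + A$2$2)] :: real^3"
  shows "quad (T S) y z = quad S (A$1$1 * y + A$1$2 * z) (A$2$1 * y + A$2$2 * z)"
    and "disc (T S) = (det A)\<^sup>2 * disc S"
  unfolding T_def quad_def disc_def det_2
  by (simp_all add: vector_3 power2_eq_square field_simps)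

lemma AE_shift:
  assumes "f \<in> measurable M M" "distr M M f = M" "AE x in M. P x"
  shows "AE x in M. P (f x)"
  using AE_distrD[OF assms(1), of P] assms(2,3) by (simp only:)

text \<open>
  The difference \<open>u \<circ> f - u\<close> is nonnegative and has integral zero.
\<close>

lemma subinvariant_AE_invariant:
  fixes u :: "'a \<Rightarrow> real"
  assumes "prob_space M" "f \<in> measurable M M" "distr M M f = M"
    and [measurable]: "u \<in> borel_measurable M" and le: "AE x in M. u x \<le> u (f x)"
    and bdd: "AE x in M. \<bar>u x\<bar> \<le> C"
  shows "AE x in M. u (f x) = u x"
proof -
  interpret prob_space M by fact
  note [measurable] = assms(2)
  have I: "integrable M u" by (rule integrable_const_bound[OF _ assms(4)]) (use bdd in simp)
  have If: "integrable M (\<lambda>x. u (f x))"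
    using AE_shift[OF assms(2,3) bdd] by (intro integrable_const_bound[where B = C]) auto
  have "(\<integral>x. u (f x) \<partial>M) = (\<integral>x. u x \<partial>M)"
    using integral_distr[OF assms(2,4)] assms(3) by simp
  then have "(\<integral>x. u (f x) - u x \<partial>M) = 0" using I If by simp
  then have "AE x in M. u (f x) - u x = 0"
    using integral_nonneg_eq_0_iff_AE[of M "\<lambda>x. u (f x) - u x"] I If le by simp
  then show ?thesis by simp
qed

text \<open>
  The errors \<open>e\<close> are summable in mean, hence tend to zero almost everywhere, and so do their convex combinations. The limit form
  \<open>l\<close> satisfies \<open>l(x) \<le> A(x)\<^sup>T l(f x) A(x)\<close>. Its determinant does not decrease along orbits, so it is invariant, and then equality
  holds. Integrability survives by the lemma of Fatou.
\<close>

theorem almost_invariant_forms_imp_conjugate: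
  fixes f :: "'a \<Rightarrow> 'a" and A :: "'a \<Rightarrow> real^2^2" and R :: "nat \<Rightarrow> 'a \<Rightarrow> real^3"
  assumes M: "prob_space M" and f: "f \<in> measurable M M" "distr M M f = M"
    and A: "\<And>x. det (A x) = 1"
    and meas[measurable]: "\<And>j. R j \<in> borel_measurable M" 
    and nonneg: "\<And>j x i. 0 \<le> R j x $ i" and fat: "\<And>j x. fat (R j x)"
    and int: "\<And>j i. integrable M (\<lambda>x. R j x $ i)" and bound: "\<And>j i. (\<integral>x. R j x $ i \<partial>M) \<le> C"
    and e: "\<And>j. integrable M (e j)" "\<And>j x. 0 \<le> e j x" "\<And>j. (\<integral>x. e j x \<partial>M) \<le> (1/2)^j"
    and inv: "\<And>j x y z. quad (R j x) y z
       \<le> quad (R j (f x)) (A x$1$1 * y + A x$1$2 * z) (A x$2$1 * y + A x$2$2 * z) + (y\<^sup>2 + z\<^sup>2) * e j x"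
  shows "L2_conjugate_to_rotations M f A"
proof -
  interpret prob_space M by fact
  note [measurable] = f(1)
  obtain c where c: "\<And>k. convex_weights k (c k)"
    and conv: "AE x in M. convergent (\<lambda>k. mix (c k) (\<lambda>j. R j x))"
    by (rule convex_combinations_converge_AE[where r = R, OF M meas nonneg int bound], rule that)
  define l where "l x = lim (\<lambda>k. mix (c k) (\<lambda>j. R j x))" for x
  have mixm[measurable]: "(\<lambda>x. mix (c k) (\<lambda>j. R j x)) \<in> borel_measurable M" for k unfolding mix_def by measurable
  have lm[measurable]: "l \<in> borel_measurable M" unfolding l_def by measurable
  have lim: "AE x in M. (\<lambda>k. mix (c k) (\<lambda>j. R j x)) \<longlonglongrightarrow> l x"
    using conv unfolding l_def by (auto simp: convergent_LIMSEQ_iff)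
  have fatl: "AE x in M. fat (l x)"
    using lim by eventually_elim (erule fat_limit, rule fat_mix[OF c fat])
  have e0: "AE x in M. (\<lambda>j. e j x) \<longlonglongrightarrow> 0"
  proof -
    have "(\<integral>\<^sup>+x. (\<Sum>j. ennreal (e j x)) \<partial>M) = (\<Sum>j. \<integral>\<^sup>+x. ennreal (e j x) \<partial>M)"
      using e(1) by (intro nn_integral_suminf) auto
    also have "\<dots> \<le> (\<Sum>j. ennreal ((1/2)^j))"
      using e by (intro suminf_le) (auto simp: nn_integral_eq_integral intro!: ennreal_leI)
    also have "\<dots> < \<infinity>" 
      using summable_geometric[of "1/2::real"] by (subst suminf_ennreal2) auto
    finally have "AE x in M. (\<Sum>j. ennreal (e j x)) \<noteq> \<infinity>"
      using e(1) by (intro nn_integral_PInf_AE) auto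
    then show ?thesis
      by eventually_elim (auto intro!: summable_LIMSEQ_zero summable_suminf_not_top e(2))
  qed
  define T where "T x S = (vector [quad S (A x$1$1) (A x$2$1), quad S (A x$1$2) (A x$2$2), quad S (A x$1$1 + A x$1$2) (A x$2$1 + A x$2$2)] :: real^3)" for x S
  have quadT: "quad (T x S) y z = quad S (A x$1$1 * y + A x$1$2 * z) (A x$2$1 * y + A x$2$2 * z)" for x S y z
    unfolding T_def by (rule quad_act)
  have discT: "disc (T x S) = disc S" for x S
    unfolding T_def quad_act A by simp
  have le: "AE x in M. \<forall>y z. quad (l x) y z \<le> quad (T x (l (f x))) y z"
    using lim AE_shift[OF f lim] e0
  proof eventually_elim
    case (elim x)
    show ?case
    proof (intro allI)
      fix y z
      let ?y = "A x$1$1 * y + A x$1$2 * z" and ?z = "A x$2$1 * y + A x$2$2 * z"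
      have "quad (mix (c k) (\<lambda>j. R j x)) y z
          \<le> quad (mix (c k) (\<lambda>j. R j (f x))) ?y ?z + (y\<^sup>2 + z\<^sup>2) * mix (c k) (\<lambda>j. e j x)" for k
      proof -
        have "mix (c k) (\<lambda>j. quad (R j x) y z) \<le> mix (c k) (\<lambda>j. quad (R j (f x)) ?y ?z + (y\<^sup>2 + z\<^sup>2) * e j x)"
          by (rule mix_mono[OF c]) (rule inv)
        also have "\<dots> = mix (c k) (\<lambda>j. quad (R j (f x)) ?y ?z) + mix (c k) (\<lambda>j. (y\<^sup>2 + z\<^sup>2) * e j x)"
          by (rule mix_add)
        also have "mix (c k) (\<lambda>j. (y\<^sup>2 + z\<^sup>2) * e j x) = (y\<^sup>2 + z\<^sup>2) * mix (c k) (\<lambda>j. e j x)"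
          by (rule mix_linear) (simp add: linear_iff algebra_simps)
        finally show ?thesis unfolding mix_linear[OF linear_quad] .
      qed
      moreover have "(\<lambda>k. quad (mix (c k) (\<lambda>j. R j x)) y z) \<longlonglongrightarrow> quad (l x) y z"
        by (rule quad_tendsto[OF elim(1)])
      moreover have "(\<lambda>k. quad (mix (c k) (\<lambda>j. R j (f x))) ?y ?z + (y\<^sup>2 + z\<^sup>2) * mix (c k) (\<lambda>j. e j x))
          \<longlonglongrightarrow> quad (l (f x)) ?y ?z + (y\<^sup>2 + z\<^sup>2) * 0"
        by (intro tendsto_intros quad_tendsto[OF elim(2)] mix_tendsto_zero[OF elim(3) c])
      ultimately show "quad (l x) y z \<le> quad (T x (l (f x))) y z"
        unfolding quadT using LIMSEQ_le by fastforce
    qed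
  qed
  have disc_le: "AE x in M. disc (l x) \<le> disc (l (f x))"
    using le fatl AE_shift[OF f fatl]
  proof eventually_elim
    case (elim x)
    define P where "P = T x (l (f x))"
    have "l x $ 1 * l x $ 2 - ((l x $ 3 - l x $ 1 - l x $ 2) / 2)\<^sup>2 \<le> P $ 1 * P $ 2 - ((P $ 3 - P $ 1 - P $ 2) / 2)\<^sup>2"
    proof (rule ordered_forms_eq(1))
      show "0 < l x $ 1" by (rule fatD(1)[OF elim(2)])
      show "0 < l x $ 1 * l x $ 2 - ((l x $ 3 - l x $ 1 - l x $ 2) / 2)\<^sup>2"
        using fatD(2)[OF elim(2)] by (simp add: disc_def)
      show "l x $ 1 * y\<^sup>2 + l x $ 2 * z\<^sup>2 + 2 * ((l x $ 3 - l x $ 1 - l x $ 2) / 2) * (y * z)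
          \<le> P $ 1 * y\<^sup>2 + P $ 2 * z\<^sup>2 + 2 * ((P $ 3 - P $ 1 - P $ 2) / 2) * (y * z)" for y z
        using elim(1)[rule_format, of y z] unfolding quad_half P_def .
    qed
    then show ?case using discT[of x "l (f x)"] by (simp add: disc_def P_def)
  qed
  have discm[measurable]: "(\<lambda>x. disc (l x)) \<in> borel_measurable M" unfolding disc_def by measurable
  \<comment> \<open>The determinant itself need not be integrable; a bounded increasing function of it is.\<close>
  have "AE x in M. - 1 / disc (l (f x)) = - 1 / disc (l x)"
  proof (rule subinvariant_AE_invariant[OF M f, where C = 1 and u = "\<lambda>x. - 1 / disc (l x)"])
    show "AE x in M. - 1 / disc (l x) \<le> - 1 / disc (l (f x))"
      using disc_le fatl by eventually_elim (use fatD(2) in \<open>fastforce simp: field_simps\<close>)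
    show "AE x in M. \<bar>- 1 / disc (l x)\<bar> \<le> 1"
      using fatl by eventually_elim (use fatD(2) in \<open>fastforce simp: field_simps\<close>)
  qed measurable
  then have disc_eq: "AE x in M. disc (l (f x)) = disc (l x)"
    by eventually_elim simp
  have T_eq: "AE x in M. \<forall>y z. quad (T x (l (f x))) y z = quad (l x) y z"
    using le disc_eq fatl
  proof eventually_elim
    case (elim x)
    define P where "P = T x (l (f x))"
    have eq: "P$1 = l x$1 \<and> P$2 = l x$2 \<and> (P$3 - P$1 - P$2) / 2 = (l x$3 - l x$1 - l x$2) / 2"
    proof (rule ordered_forms_eq(2))
      show "0 < l x $ 1" by (rule fatD(1)[OF elim(3)])
      show "0 < l x $ 1 * l x $ 2 - ((l x $ 3 - l x $ 1 - l x $ 2) / 2)\<^sup>2"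
        using fatD(2)[OF elim(3)] by (simp add: disc_def)
      show "l x $ 1 * l x $ 2 - ((l x $ 3 - l x $ 1 - l x $ 2) / 2)\<^sup>2 = P $ 1 * P $ 2 - ((P $ 3 - P $ 1 - P $ 2) / 2)\<^sup>2"
        using elim(2) discT[of x "l (f x)"] by (simp add: disc_def P_def)
      show "l x $ 1 * y\<^sup>2 + l x $ 2 * z\<^sup>2 + 2 * ((l x $ 3 - l x $ 1 - l x $ 2) / 2) * (y * z)
          \<le> P $ 1 * y\<^sup>2 + P $ 2 * z\<^sup>2 + 2 * ((P $ 3 - P $ 1 - P $ 2) / 2) * (y * z)" for y z
        using elim(1)[rule_format, of y z] unfolding quad_half P_def .
    qed
    then have "quad P y z = quad (l x) y z" for y z unfolding quad_def by simp
    then show ?case by (simp add: P_def)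
  qed
  define D where "D x = sqrt (disc (l x))" for x
  \<comment> \<open>The exceptional null set, where the conjugacy is set to the identity, has to be measurable.\<close>
  define ok where "ok x \<longleftrightarrow> 0 < l x $ 1 \<and> 1 \<le> disc (l x)" for x
  define B where "B x = (if ok x then cholesky (l x$1 / D x) (l x$2 / D x) ((l x$3 - l x$1 - l x$2) / 2 / D x) else mat 1)" for x
  have AE_ok: "AE x in M. ok x" using fatl by eventually_elim (simp add: ok_def fatD)
  have D1: "1 \<le> D x" "(D x)\<^sup>2 = disc (l x)" if "ok x" for x using that by (auto simp: D_def ok_def)
  have pos: "0 < l x$1 / D x" if "ok x" for x using D1[OF that] that by (simp add: ok_def)
  have one: "l x$1 / D x * (l x$2 / D x) - ((l x$3 - l x$1 - l x$2) / 2 / D x)\<^sup>2 = 1" if "ok x" for x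
  proof -
    have "l x$1 / D x * (l x$2 / D x) - ((l x$3 - l x$1 - l x$2) / 2 / D x)\<^sup>2 = disc (l x) / (D x)\<^sup>2"
    proof -
      have "a / d * (b / d) - (t / d)\<^sup>2 = (a * b - t\<^sup>2) / d\<^sup>2" for a b t d :: real
        by (simp add: power2_eq_square diff_divide_distrib)
      then show ?thesis unfolding disc_def .
    qed
    moreover have "disc (l x) \<noteq> 0" using that by (auto simp: ok_def)
    ultimately show ?thesis using D1(2)[OF that] by simp
  qed
  have normB: "(norm (B x *v v))\<^sup>2 = quad (l x) (v$1) (v$2) / D x" if "ok x" for x v
  proof -
    have B: "B x = cholesky (l x$1 / D x) (l x$2 / D x) ((l x$3 - l x$1 - l x$2) / 2 / D x)"
      using that by (simp add: B_def)
    have "a / d * y + b / d * z + 2 * (t / d) * w = (a * y + b * z + 2 * t * w) / d" for a b t d y z w :: real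
      by (simp add: add_divide_distrib)
    then show ?thesis unfolding B cholesky(2)[OF pos[OF that] one[OF that]] quad_half .
  qed
  have detB: "det (B x) = 1" for x
    using cholesky(1)[OF pos one] by (simp add: B_def)
  have okm[measurable]: "Measurable.pred M ok" unfolding ok_def by measurable
  have Dm[measurable]: "D \<in> borel_measurable M" unfolding D_def by measurable
  have [measurable]: "B \<in> borel_measurable M"
  proof (intro borel_measurable_vecI)
    fix i j
    have "B x $ i $ j = (if ok x then cholesky (l x$1 / D x) (l x$2 / D x) ((l x$3 - l x$1 - l x$2) / 2 / D x) $ i $ j
        else (mat 1 :: real^2^2) $ i $ j)" for x by (simp add: B_def)
    then show "(\<lambda>x. B x $ i $ j) \<in> borel_measurable M"
      unfolding cholesky_def by (simp only: vec_lambda_beta) measurable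
  qed
  have "(\<integral>\<^sup>+x. ennreal ((opnorm (B x))\<^sup>2) \<partial>M) \<le> (\<integral>\<^sup>+x. ennreal (l x$1 + l x$2) \<partial>M)"
  proof (rule nn_integral_mono_AE)
    show "AE x in M. ennreal ((opnorm (B x))\<^sup>2) \<le> ennreal (l x$1 + l x$2)"
      using AE_ok
    proof eventually_elim
      case (elim x)
      have "(opnorm (B x))\<^sup>2 \<le> l x$1 / D x + l x$2 / D x"
        using cholesky(3)[OF pos[OF elim] one[OF elim]] elim by (simp add: B_def)
      also have "\<dots> = (l x$1 + l x$2) / D x" by (simp add: add_divide_distrib)
      also have "\<dots> \<le> (l x$1 + l x$2) / 1"
      proof (rule divide_left_mono)
        have "0 \<le> l x$1 * l x$2" using elim unfolding ok_def disc_def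
          by (smt (verit) zero_le_power2)
        then show "0 \<le> l x$1 + l x$2" using elim by (simp add: ok_def zero_le_mult_iff)
      qed (use D1[OF elim] in auto)
      finally show ?case by (simp add: ennreal_leI)
    qed
  qed
  also have "\<dots> \<le> (\<integral>\<^sup>+x. liminf (\<lambda>k. ennreal (mix (c k) (\<lambda>j. R j x) $ 1 + mix (c k) (\<lambda>j. R j x) $ 2)) \<partial>M)"
  proof (rule nn_integral_mono_AE)
    show "AE x in M. ennreal (l x$1 + l x$2) \<le> liminf (\<lambda>k. ennreal (mix (c k) (\<lambda>j. R j x) $ 1 + mix (c k) (\<lambda>j. R j x) $ 2))"
      using lim
    proof eventually_elim
      case (elim x)
      have "(\<lambda>k. ennreal (mix (c k) (\<lambda>j. R j x) $ 1 + mix (c k) (\<lambda>j. R j x) $ 2)) \<longlonglongrightarrow> ennreal (l x$1 + l x$2)"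
        by (intro tendsto_ennrealI tendsto_intros elim)
      then show ?case by (simp add: lim_imp_Liminf)
    qed
  qed
  also have "\<dots> \<le> liminf (\<lambda>k. \<integral>\<^sup>+x. ennreal (mix (c k) (\<lambda>j. R j x) $ 1 + mix (c k) (\<lambda>j. R j x) $ 2) \<partial>M)"
    by (rule nn_integral_liminf) measurable
  also have "\<dots> \<le> limsup (\<lambda>k. \<integral>\<^sup>+x. ennreal (mix (c k) (\<lambda>j. R j x) $ 1 + mix (c k) (\<lambda>j. R j x) $ 2) \<partial>M)"
    by (rule Liminf_le_Limsup) simp
  also have "\<dots> \<le> ennreal (C + C)"
  proof (rule Limsup_bounded, rule always_eventually, rule allI)
    fix k
    have I: "integrable M (\<lambda>x. mix (c k) (\<lambda>j. R j x) $ i)"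
      and le: "(\<integral>x. mix (c k) (\<lambda>j. R j x) $ i \<partial>M) \<le> C" for i
      by (rule integral_mix_le[OF c int bound])+
    have nn: "0 \<le> mix (c k) (\<lambda>j. R j x) $ i" for x i
      using c[of k] nonneg by (auto simp: mix_def convex_weights_def intro!: sum_nonneg)
    have "(\<integral>\<^sup>+x. ennreal (mix (c k) (\<lambda>j. R j x) $ 1 + mix (c k) (\<lambda>j. R j x) $ 2) \<partial>M)
       = ennreal (\<integral>x. mix (c k) (\<lambda>j. R j x) $ 1 + mix (c k) (\<lambda>j. R j x) $ 2 \<partial>M)"
      using I nn by (intro nn_integral_eq_integral) auto
    also have "\<dots> \<le> ennreal (C + C)"
      using I add_mono[OF le[of 1] le[of 2]] by (intro ennreal_leI) simp
    finally show "(\<integral>\<^sup>+x. ennreal (mix (c k) (\<lambda>j. R j x) $ 1 + mix (c k) (\<lambda>j. R j x) $ 2) \<partial>M) \<le> ennreal (C + C)" .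
  qed
  also have "\<dots> < \<infinity>" by simp
  finally have fin: "(\<integral>\<^sup>+x. ennreal ((opnorm (B x))\<^sup>2) \<partial>M) < \<infinity>" .
  have "AE x in M. rotation_matrix (B (f x) ** A x ** matrix_inv (B x))"
    using T_eq disc_eq AE_ok AE_shift[OF f AE_ok]
  proof eventually_elim
    case (elim x)
    show ?case
    proof (rule rotation_from_isometry[OF detB detB A])
      fix v
      have "(norm (B (f x) *v (A x *v v)))\<^sup>2 = (norm (B x *v v))\<^sup>2"
        unfolding normB[OF elim(4)] normB[OF elim(3)]
        using elim(1)[rule_format, of "v$1" "v$2"] elim(2)
        by (simp add: quadT D_def matrix_vector_mult_def sum_2)
      then show "norm (B (f x) *v (A x *v v)) = norm (B x *v v)" by (simp add: power2_eq_iff_nonneg)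
    qed
  qed
  then show ?thesis
    unfolding L2_conjugate_to_rotations_def using fin detB by (intro exI[of _ B]) (auto simp: SL2_def)
qed

section \<open>From slow growth to almost invariant forms\<close>

lemma herm_twice_ge:
  "- 2 * b * herm (c1, c2) * 1 \<le> (cmod (c2 - of_real a * c1))\<^sup>2 + b\<^sup>2 * (cmod c1)\<^sup>2"
proof -
  define u where "u = c2 - of_real a * c1"
  have "herm (c1, c2) = Im (cnj c1 * u)"
    by (simp add: herm_def u_def algebra_simps)
  then have "\<bar>herm (c1, c2)\<bar> \<le> cmod c1 * cmod u"
    using abs_Im_le_cmod[of "cnj c1 * u"] by (simp add: norm_mult)
  then have "\<bar>b\<bar> * \<bar>herm (c1, c2)\<bar> \<le> \<bar>b\<bar> * (cmod c1 * cmod u)" by (intro mult_left_mono) auto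
  moreover have "- b * herm (c1, c2) \<le> \<bar>b\<bar> * \<bar>herm (c1, c2)\<bar>" 
    using abs_ge_minus_self[of "b * herm (c1, c2)"] by (simp add: abs_mult)
  moreover have "2 * (\<bar>b\<bar> * (cmod c1 * cmod u)) \<le> (cmod u)\<^sup>2 + b\<^sup>2 * (cmod c1)\<^sup>2"
  proof -
    have "0 \<le> (cmod u - \<bar>b\<bar> * cmod c1)\<^sup>2" by simp
    then show ?thesis by (simp add: power2_diff power_mult_distrib algebra_simps)
  qed
  ultimately show ?thesis unfolding u_def[symmetric] by linarith
qed

text \<open>
  The form \<open>\<xi> \<mapsto> |c \<xi>|\<^sup>2 / |herm c|\<close>, whose determinant is one. It depends only on the complex line of \<open>c\<close> and is the
  point of the hyperbolic plane given by the slope of \<open>c\<close>.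
\<close>

definition form_of :: "complex \<times> complex \<Rightarrow> real^3" where
  "form_of c = vector [(cmod (fst c))\<^sup>2 / (- herm c), (cmod (snd c))\<^sup>2 / (- herm c), (cmod (fst c + snd c))\<^sup>2 / (- herm c)]"

lemma quad_form_of: "quad (form_of c) y z = (cmod (cdot c (of_real y, of_real z)))\<^sup>2 / (- herm c)"
proof -
  have "(cmod (cdot c (of_real y, of_real z)))\<^sup>2
     = (cmod (fst c))\<^sup>2 * y\<^sup>2 + (cmod (snd c))\<^sup>2 * z\<^sup>2
       + ((cmod (fst c + snd c))\<^sup>2 - (cmod (fst c))\<^sup>2 - (cmod (snd c))\<^sup>2) * (y * z)"
    by (simp only: cmod_power2 cdot_def) (simp add: power2_eq_square algebra_simps)
  moreover have "p / w * y\<^sup>2 + q / w * z\<^sup>2 + (r / w - p / w - q / w) * (y * z)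
     = (p * y\<^sup>2 + q * z\<^sup>2 + (r - p - q) * (y * z)) / w" for p q r w :: real
    by (simp add: add_divide_distrib diff_divide_distrib algebra_simps)
  ultimately show ?thesis unfolding quad_def form_of_def vector_3 by metis
qed

lemma fat_form_of:
  assumes "herm c < 0"
  shows "fat (form_of c)"
  unfolding fat_def
proof (intro allI)
  fix a b :: real
  have "cdot c (of_real (- a), of_real 1) = snd c - of_real a * fst c" by (simp add: cdot_def)
  then have "quad (form_of c) (- a) 1 + b\<^sup>2 * form_of c$1 = ((cmod (snd c - of_real a * fst c))\<^sup>2 + b\<^sup>2 * (cmod (fst c))\<^sup>2) / (- herm c)"
    unfolding quad_form_of by (simp add: form_of_def vector_3 add_divide_distrib)
  also have "2 * b \<le> \<dots>"
    using herm_twice_ge[of b "fst c" "snd c" a] assms by (subst pos_le_divide_eq) (simp_all add: algebra_simps)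
  finally show "2 * b \<le> quad (form_of c) (- a) 1 + b\<^sup>2 * form_of c$1" .
qed

lemma form_of_bounds:
  assumes "herm c < 0"
  shows "0 \<le> form_of c $ i" "form_of c $ i \<le> 2 * (nsq c / (- herm c))"
proof -
  have le: "(cmod (fst c + snd c))\<^sup>2 \<le> 2 * nsq c"
  proof -
    have "(cmod (fst c + snd c))\<^sup>2 \<le> (cmod (fst c) + cmod (snd c))\<^sup>2"
      by (intro power_mono norm_triangle_ineq) simp
    also have "\<dots> \<le> 2 * nsq c"
      using sum_squares_bound[of "cmod (fst c)" "cmod (snd c)"] by (simp add: nsq_def power2_sum)
    finally show ?thesis .
  qed
  have "i = 1 \<or> i = 2 \<or> i = 3" using exhaust_3 by blast
  then show "0 \<le> form_of c $ i" using assms by (auto simp: form_of_def vector_3 divide_nonneg_neg)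
  have "form_of c $ i \<le> 2 * nsq c / (- herm c)"
    using \<open>i = 1 \<or> i = 2 \<or> i = 3\<close>
  proof (elim disjE)
    assume "i = 1" then show ?thesis using assms
      by (simp add: form_of_def vector_3 divide_right_mono_neg nsq_def)
  next
    assume "i = 2" then show ?thesis using assms
      by (simp add: form_of_def vector_3 divide_right_mono_neg nsq_def)
  next
    assume "i = 3" then show ?thesis using assms le
      by (simp add: form_of_def vector_3 divide_right_mono_neg)
  qed
  then show "form_of c $ i \<le> 2 * (nsq c / (- herm c))" by simp
qed

text \<open>
  Only an upper bound holds with an error linear in the trace: the numerator changes by \<open>O(s |c|\<^sup>2)\<close>, while the denominator grows and may
  be replaced by its old value. A two-sided bound would contain the square of the trace, which is not controlled.
\<close>

lemma form_step:
  assumes "tangent \<kappa> P Q" "0 < \<kappa>" "frob P \<le> C" "frob Q \<le> C" "0 < C" "herm c < 0" "0 \<le> s" "s \<le> 1"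
  shows "quad (form_of (row_act c P Q s)) y z
    \<le> quad (form_of c) (P$1$1 * y + P$1$2 * z) (P$2$1 * y + P$2$2 * z)
      + (y\<^sup>2 + z\<^sup>2) * (3 * C * s * (nsq c / (- herm c)))"
proof -
  define v where "v = (complex_of_real y, complex_of_real z)"
  have v: "nsq v = y\<^sup>2 + z\<^sup>2" by (simp add: v_def nsq_def)
  define X Y where "X = cdot c (col_act P 0 0 v)" and "Y = cdot c (col_act Q 0 0 v)"
  have XY: "cdot (row_act c P Q s) v = X + \<i> * s * Y"
    unfolding cdot_row_act X_def Y_def by (simp add: cdot_def col_act_def complex_eq_iff algebra_simps)
  have X: "X = cdot c (of_real (P$1$1 * y + P$1$2 * z), of_real (P$2$1 * y + P$2$2 * z))"
    unfolding X_def v_def col_act_def cdot_def by (simp add: complex_eq_iff algebra_simps)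
  have bnd: "(cmod (cdot c (col_act U 0 0 v)))\<^sup>2 \<le> C * nsq c * nsq v" if "frob U \<le> C" for U
  proof -
    have "(cmod (cdot c (col_act U 0 0 v)))\<^sup>2 \<le> nsq c * nsq (col_act U 0 0 v)" by (rule cmod_cdot_le)
    also have "\<dots> \<le> nsq c * (C * nsq v)"
      using nsq_col_act_le[of U 0 0 v] mult_right_mono[OF that nsq_nonneg[of v]] by (intro mult_left_mono) auto
    finally show ?thesis by (simp add: mult_ac)
  qed
  have "(cmod (X + \<i> * s * Y))\<^sup>2 \<le> (cmod X + s * cmod Y)\<^sup>2"
    using assms(7) norm_triangle_ineq[of X "\<i> * s * Y"] by (intro power_mono) (simp_all add: norm_mult)
  also have "\<dots> = (cmod X)\<^sup>2 + s * (2 * (cmod X * cmod Y)) + s\<^sup>2 * (cmod Y)\<^sup>2"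
    by (simp add: power2_sum power_mult_distrib algebra_simps)
  also have "\<dots> \<le> (cmod X)\<^sup>2 + s * ((cmod X)\<^sup>2 + (cmod Y)\<^sup>2) + s * (cmod Y)\<^sup>2"
    using sum_squares_bound[of "cmod X" "cmod Y"] assms(7,8)
    by (intro add_mono mult_left_mono mult_right_mono) (auto simp: power2_eq_square mult_left_le)
  also have "\<dots> \<le> (cmod X)\<^sup>2 + s * (3 * C * nsq c * nsq v)"
    using mult_left_mono[OF bnd[OF assms(3)] assms(7)] mult_left_mono[OF bnd[OF assms(4)] assms(7)]
    by (simp add: X_def[symmetric] Y_def[symmetric] algebra_simps)
  finally have num: "(cmod (X + \<i> * s * Y))\<^sup>2 \<le> (cmod X)\<^sup>2 + s * (3 * C * nsq c * nsq v)" .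
  have "herm (row_act c P Q s) \<le> herm c - s * (\<kappa> / C) * nsq c"
    using herm_row_act_le[OF assms(1,2,3,5)] assms(6,7) by simp
  moreover have "0 \<le> s * (\<kappa> / C) * nsq c" using assms by simp
  ultimately have h: "herm (row_act c P Q s) \<le> herm c" by linarith
  have "quad (form_of (row_act c P Q s)) y z = (cmod (X + \<i> * s * Y))\<^sup>2 / (- herm (row_act c P Q s))"
    unfolding quad_form_of XY[unfolded v_def] ..
  also have "\<dots> \<le> ((cmod X)\<^sup>2 + s * (3 * C * nsq c * nsq v)) / (- herm c)"
    using num h assms(6) by (intro frac_le order_trans[OF zero_le_power2 num]) auto
  also have "\<dots> = quad (form_of c) (P$1$1 * y + P$1$2 * z) (P$2$1 * y + P$2$2 * z)
      + (y\<^sup>2 + z\<^sup>2) * (3 * C * s * (nsq c / (- herm c)))"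
    unfolding quad_form_of X[symmetric] v[symmetric] by (simp only: add_divide_distrib) (simp add: mult_ac)
  finally show ?thesis .
qed

locale twisting_cocycle = twisting_family f A A1 A2 \<alpha> \<beta> \<kappa> C
  for f :: "'a \<Rightarrow> 'a" and A A1 A2 :: "real \<Rightarrow> 'a \<Rightarrow> real^2^2" and \<alpha> \<beta> \<kappa> C +
  fixes M :: "'a measure"
  assumes prob: "prob_space M" and fm: "f \<in> measurable M M" and inv: "distr M M f = M"
    and Am: "\<And>\<theta>. \<theta> \<in> {\<alpha>..\<beta>} \<Longrightarrow> A \<theta> \<in> borel_measurable M"
    and A1m: "\<And>\<theta>. \<theta> \<in> {\<alpha>..\<beta>} \<Longrightarrow> A1 \<theta> \<in> borel_measurable M"
begin

lemma Complex_measurable: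
  assumes "g \<in> borel_measurable N" "h \<in> borel_measurable N"
  shows "(\<lambda>x. Complex (g x) (h x)) \<in> borel_measurable N"
  unfolding Complex_eq using assms by measurable

lemma row_measurable:
  assumes "\<theta> \<in> {\<alpha>..\<beta>}"
  shows "(\<lambda>x. fst (row n \<theta> s x)) \<in> borel_measurable M \<and> (\<lambda>x. snd (row n \<theta> s x)) \<in> borel_measurable M"
proof (induction n)
  case 0 show ?case by simp
next
  case (Suc n)
  note [measurable] = fm Am[OF assms] A1m[OF assms]
  have [measurable]: "(\<lambda>x. fst (row n \<theta> s (f x))) \<in> borel_measurable M" "(\<lambda>x. snd (row n \<theta> s (f x))) \<in> borel_measurable M"
    using Suc measurable_compose[OF fm] by blast+
  have [measurable]: "(\<lambda>x. Complex (A \<theta> x $ i $ j) (s * A1 \<theta> x $ i $ j)) \<in> borel_measurable M" for i j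
    by (rule Complex_measurable) measurable
  show ?case by (auto simp: row_act_def)
qed

lemma herm_measurable:
  assumes "\<theta> \<in> {\<alpha>..\<beta>}"
  shows "(\<lambda>x. herm (row n \<theta> s x)) \<in> borel_measurable M" "(\<lambda>x. nsq (row n \<theta> s x)) \<in> borel_measurable M"
    "(\<lambda>x. form_of (row n \<theta> s x)) \<in> borel_measurable M" "(\<lambda>x. amp n \<theta> s x) \<in> borel_measurable M"
proof -
  have [measurable]: "(\<lambda>x. fst (row n \<theta> s x)) \<in> borel_measurable M" "(\<lambda>x. snd (row n \<theta> s x)) \<in> borel_measurable M"
    using row_measurable[OF assms, of n s] by blast+
  have Re_Im: "(\<lambda>x. Re (g x)) \<in> borel_measurable M" "(\<lambda>x. Im (g x)) \<in> borel_measurable M" 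
    if "g \<in> borel_measurable M" for g
    using measurable_compose[OF that borel_measurable_continuous_onI[OF continuous_on_Re[OF continuous_on_id]]]
      measurable_compose[OF that borel_measurable_continuous_onI[OF continuous_on_Im[OF continuous_on_id]]] .
  have [measurable]: "(\<lambda>x. Re (fst (row n \<theta> s x))) \<in> borel_measurable M" "(\<lambda>x. Re (snd (row n \<theta> s x))) \<in> borel_measurable M"
    "(\<lambda>x. Im (fst (row n \<theta> s x))) \<in> borel_measurable M" "(\<lambda>x. Im (snd (row n \<theta> s x))) \<in> borel_measurable M"
    by (rule Re_Im; measurable)+
  have "herm (row n \<theta> s x) = Re (fst (row n \<theta> s x)) * Im (snd (row n \<theta> s x)) - Im (fst (row n \<theta> s x)) * Re (snd (row n \<theta> s x))" for x
    by (simp add: herm_def)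
  then show h[measurable]: "(\<lambda>x. herm (row n \<theta> s x)) \<in> borel_measurable M" by simp
  show "(\<lambda>x. nsq (row n \<theta> s x)) \<in> borel_measurable M" unfolding nsq_def by measurable
  show "(\<lambda>x. amp n \<theta> s x) \<in> borel_measurable M" unfolding amp_def cdot_def by measurable
  show "(\<lambda>x. form_of (row n \<theta> s x)) \<in> borel_measurable M"
  proof (rule borel_measurable_vecI)
    fix i :: 3
    have "i = 1 \<or> i = 2 \<or> i = 3" using exhaust_3 by blast
    then show "(\<lambda>x. form_of (row n \<theta> s x) $ i) \<in> borel_measurable M"
      by (elim disjE) (simp_all add: form_of_def vector_3)
  qed
qed

lemma nsq_row_le:
  assumes "\<theta> \<in> {\<alpha>..\<beta>}" "s \<in> {0..1}"
  shows "nsq (row n \<theta> s x) \<le> 2 * (2 * C)^n"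
proof (induction n arbitrary: x)
  case 0 show ?case by (simp add: nsq_def)
next
  case (Suc n)
  have "nsq (row (Suc n) \<theta> s x) \<le> 2 * C * nsq (row n \<theta> s (f x))"
    using nsq_step[OF assms, of "row n \<theta> s (f x)" x] by simp
  also have "\<dots> \<le> 2 * C * (2 * (2 * C)^n)" using Suc[of "f x"] C1 by (intro mult_left_mono) auto
  finally show ?case by (simp add: mult_ac)
qed

lemma integral_shift:
  fixes g :: "'a \<Rightarrow> real"
  assumes "g \<in> borel_measurable M"
  shows "(\<integral>x. g (f x) \<partial>M) = (\<integral>x. g x \<partial>M)"
  using integral_distr[OF fm assms] inv by simp

text \<open>
  The trace of \<open>form_of (row n \<theta> s x)\<close>.
\<close>

definition trace_density :: "nat \<Rightarrow> real \<Rightarrow> real \<Rightarrow> 'a \<Rightarrow> real" where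
  "trace_density n \<theta> s x = nsq (row n \<theta> s x) / (- herm (row n \<theta> s x))"

lemma trace_density_bounds:
  assumes "\<theta> \<in> {\<alpha>..\<beta>}" "s \<in> {0<..1}"
  shows "0 \<le> trace_density n \<theta> s x" "s * \<delta> * trace_density n \<theta> s x \<le> 1"
proof -
  have s: "s \<in> {0..1}" using assms by simp
  have neg: "herm (row n \<theta> s x) \<le> -1" by (rule herm_row[OF assms(1) s])
  show "0 \<le> trace_density n \<theta> s x" unfolding trace_density_def using neg by (intro divide_nonneg_nonneg) auto
  have "s * \<delta> * nsq (row n \<theta> s x) \<le> - herm (row n \<theta> s x)" using herm_row(2)[OF assms(1) s, of n x] by linarith
  then have "(s * \<delta> * nsq (row n \<theta> s x)) / (- herm (row n \<theta> s x)) \<le> 1"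
    using neg by (subst pos_divide_le_eq) linarith+
  then show "s * \<delta> * trace_density n \<theta> s x \<le> 1" by (simp add: trace_density_def)
qed

lemma trace_density_integrable:
  assumes "\<theta> \<in> {\<alpha>..\<beta>}" "s \<in> {0<..1}"
  shows "integrable M (trace_density n \<theta> s)"
proof -
  interpret prob_space M by (rule prob)
  show ?thesis
  proof (rule integrable_const_bound[where B = "1 / (s * \<delta>)"])
    have "trace_density n \<theta> s x \<le> 1 / (s * \<delta>)" for x
      using trace_density_bounds(2)[OF assms, of n x] assms(2) delta by (simp add: field_simps)
    then show "AE x in M. norm (trace_density n \<theta> s x) \<le> 1 / (s * \<delta>)"
      using trace_density_bounds(1)[OF assms] by simp
    show "trace_density n \<theta> s \<in> borel_measurable M"
      using herm_measurable[OF assms(1)] unfolding trace_density_def by measurable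
  qed
qed

lemma ln_herm_integrable:
  assumes "\<theta> \<in> {\<alpha>..\<beta>}" "s \<in> {0..1}"
  shows "integrable M (\<lambda>x. ln (- herm (row n \<theta> s x)))"
proof -
  interpret prob_space M by (rule prob)
  show ?thesis
  proof (rule integrable_const_bound[where B = "ln (2 * (2 * C)^n)"])
    have "ln (- herm (row n \<theta> s x)) \<le> ln (2 * (2 * C)^n)" for x
      using herm_row(1)[OF assms, of n x] herm_le_nsq[of "row n \<theta> s x"] nsq_row_le[OF assms, of n x]
      by (intro ln_mono) auto
    then show "AE x in M. norm (ln (- herm (row n \<theta> s x))) \<le> ln (2 * (2 * C)^n)"
      using herm_row(1)[OF assms] by (auto simp: ln_ge_zero_iff)
    show "(\<lambda>x. ln (- herm (row n \<theta> s x))) \<in> borel_measurable M"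
      using herm_measurable(1)[OF assms(1)] by measurable
  qed
qed

lemma ln_amp_bounds:
  assumes "\<theta> \<in> {\<alpha>..\<beta>}" "s \<in> {0..1}"
  shows "0 \<le> ln (cmod (amp n \<theta> s x))" "ln (cmod (amp n \<theta> s x)) \<le> ln (2 * (2 * C)^n)"
    "ln (- herm (row n \<theta> s x)) \<le> 2 * ln (cmod (amp n \<theta> s x))"
proof -
  have eq: "(cmod (amp n \<theta> s x))\<^sup>2 = nsq (row n \<theta> s x) - 2 * herm (row n \<theta> s x)"
    unfolding amp_def by (rule cdot_plus)
  have neg: "herm (row n \<theta> s x) \<le> -1" by (rule herm_row[OF assms])
  have nz: "0 < cmod (amp n \<theta> s x)" using amp_nonzero[OF assms] by simp
  have 1: "- herm (row n \<theta> s x) \<le> (cmod (amp n \<theta> s x))\<^sup>2"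
    unfolding eq using neg nsq_nonneg[of "row n \<theta> s x"] by linarith
  have "ln (- herm (row n \<theta> s x)) \<le> ln ((cmod (amp n \<theta> s x))\<^sup>2)" using 1 neg by (intro ln_mono) auto
  then show "ln (- herm (row n \<theta> s x)) \<le> 2 * ln (cmod (amp n \<theta> s x))" using nz by (simp add: ln_realpow)
  moreover have "0 \<le> ln (- herm (row n \<theta> s x))" using neg by (simp add: ln_ge_zero)
  ultimately show "0 \<le> ln (cmod (amp n \<theta> s x))" by linarith
  have one: "1 \<le> (2 * C)^n" by (rule one_le_power) (use C1 in simp)
  have "(cmod (amp n \<theta> s x))\<^sup>2 \<le> 4 * (2 * C)^n"
    unfolding eq using herm_le_nsq[of "row n \<theta> s x"] nsq_row_le[OF assms, of n x] by linarith
  also have "\<dots> \<le> 4 * ((2 * C)^n * (2 * C)^n)"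
    using mult_left_mono[OF one, of "(2 * C)^n"] one by linarith
  also have "\<dots> = (2 * (2 * C)^n)\<^sup>2" by (simp add: power2_eq_square)
  finally have "cmod (amp n \<theta> s x) \<le> 2 * (2 * C)^n" by (rule power2_le_imp_le) (use one in simp)
  then show "ln (cmod (amp n \<theta> s x)) \<le> ln (2 * (2 * C)^n)" using nz by (intro ln_mono) auto
qed

lemma ln_amp_integrable_M:
  assumes "\<theta> \<in> {\<alpha>..\<beta>}" "s \<in> {0..1}"
  shows "integrable M (\<lambda>x. ln (cmod (amp n \<theta> s x)))"
proof -
  interpret prob_space M by (rule prob)
  note [measurable] = herm_measurable(4)[OF assms(1)]
  show ?thesis
    by (rule integrable_const_bound[where B = "ln (2 * (2 * C)^n)"]) (use ln_amp_bounds[OF assms] in auto)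
qed

definition \<eta> :: real where "\<eta> = \<kappa> / (C * (1 + 2 * C))"

lemma eta_pos: "0 < \<eta>" using kap C1 by (simp add: \<eta>_def)

text \<open>
  Each step multiplies \<open>|herm|\<close> by at least \<open>1 + y\<close> with \<open>y\<close> proportional to \<open>s\<close> times the trace. The a priori bound \<open>y \<le> 2 C\<close> from
  \<open>herm_row\<close> makes \<open>ln (1 + y)\<close> comparable to \<open>y\<close>.
\<close>

lemma trace_sum_le:
  assumes "\<theta> \<in> {\<alpha>..\<beta>}" "s \<in> {0<..1}"
  shows "\<eta> * s * (\<Sum>k<n. \<integral>x. trace_density k \<theta> s x \<partial>M) \<le> (\<integral>x. ln (- herm (row n \<theta> s x)) \<partial>M)"
proof (induction n)
  case 0 show ?case by (simp add: herm_def)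
next
  case (Suc n)
  have s: "s \<in> {0..1}" using assms by simp
  note I = trace_density_integrable[OF assms, of n] and L = ln_herm_integrable[OF assms(1) s]
  have "ln (- herm (row n \<theta> s (f x))) + \<eta> * s * trace_density n \<theta> s (f x) \<le> ln (- herm (row (Suc n) \<theta> s x))" for x
  proof -
    let ?c = "row n \<theta> s (f x)"
    define W where "W = - herm ?c"
    have W: "1 \<le> W" using herm_row(1)[OF assms(1) s, of n "f x"] by (simp add: W_def)
    define y where "y = s * (\<kappa> / C) * trace_density n \<theta> s (f x)"
    have y0: "0 \<le> y" using trace_density_bounds(1)[OF assms, of n "f x"] kap C1 s by (simp add: y_def)
    have "y = 2 * C * (s * \<delta> * trace_density n \<theta> s (f x))"
      using C1 by (simp add: y_def \<delta>_def power2_eq_square)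
    also have "\<dots> \<le> 2 * C * 1" using trace_density_bounds(2)[OF assms, of n "f x"] C1 by (intro mult_left_mono) auto
    finally have y1: "y \<le> 2 * C" by simp
    have Wy: "W * y = s * (\<kappa> / C) * nsq ?c"
      using W unfolding y_def trace_density_def W_def[symmetric] by simp
    have "W * (1 + y) \<le> - herm (row (Suc n) \<theta> s x)"
      using herm_row_act_le[OF tan[OF assms(1), of x] kap(1) bd(1)[OF assms(1), of x], of ?c s] C1 W s Wy
      by (simp add: W_def algebra_simps)
    then have "ln (W * (1 + y)) \<le> ln (- herm (row (Suc n) \<theta> s x))" using W y0 by (intro ln_mono) auto
    moreover have "ln (W * (1 + y)) = ln W + ln (1 + y)" using W y0 by (intro ln_mult_pos) auto
    moreover have "y / (1 + 2 * C) \<le> ln (1 + y)"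
    proof -
      have "y / (1 + 2 * C) \<le> y / (1 + y)" using y0 y1 by (intro divide_left_mono) auto
      also have "\<dots> \<le> ln (1 + y)"
      proof -
        have "ln (inverse (1 + y)) \<le> inverse (1 + y) - 1" using y0 by (intro ln_le_minus_one) auto
        moreover have "y / (1 + y) = 1 - inverse (1 + y)" using y0 by (simp add: field_simps)
        ultimately show ?thesis using y0 by (simp add: ln_inverse)
      qed
      finally show ?thesis .
    qed
    moreover have "y / (1 + 2 * C) = \<eta> * s * trace_density n \<theta> s (f x)"
      by (simp add: y_def \<eta>_def)
    ultimately show ?thesis unfolding W_def by linarith
  qed
  moreover have If: "integrable M (\<lambda>x. trace_density n \<theta> s (f x))" "integrable M (\<lambda>x. ln (- herm (row n \<theta> s (f x))))"
    using integrable_distr[OF fm, of "trace_density n \<theta> s"] integrable_distr[OF fm, of "\<lambda>x. ln (- herm (row n \<theta> s x))"] I L[of n] inv by simp_all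
  ultimately have "(\<integral>x. ln (- herm (row n \<theta> s (f x))) + \<eta> * s * trace_density n \<theta> s (f x) \<partial>M) \<le> (\<integral>x. ln (- herm (row (Suc n) \<theta> s x)) \<partial>M)"
    using L[of "Suc n"] by (intro integral_mono) auto
  also have "(\<integral>x. ln (- herm (row n \<theta> s (f x))) + \<eta> * s * trace_density n \<theta> s (f x) \<partial>M)
     = (\<integral>x. ln (- herm (row n \<theta> s (f x))) \<partial>M) + \<eta> * s * (\<integral>x. trace_density n \<theta> s (f x) \<partial>M)"
    using If by simp
  also have "\<dots> = (\<integral>x. ln (- herm (row n \<theta> s x)) \<partial>M) + \<eta> * s * (\<integral>x. trace_density n \<theta> s x \<partial>M)"
    using integral_shift[OF borel_measurable_integrable[OF I]] integral_shift[OF borel_measurable_integrable[OF L[of n]]] by simp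
  finally show ?case using Suc by (simp add: algebra_simps)
qed


lemma trace_average_le:
  assumes "\<theta> \<in> {\<alpha>..\<beta>}" "s \<in> {0<..1}" "0 < n" and le: "(\<integral>x. ln (cmod (amp n \<theta> s x)) \<partial>M) \<le> B * real n * s"
  shows "(\<Sum>k<n. \<integral>x. trace_density k \<theta> s x \<partial>M) / real n \<le> 2 * B / \<eta>"
proof -
  have s: "s \<in> {0..1}" using assms by simp
  have "\<eta> * s * (\<Sum>k<n. \<integral>x. trace_density k \<theta> s x \<partial>M) \<le> (\<integral>x. ln (- herm (row n \<theta> s x)) \<partial>M)"
    by (rule trace_sum_le[OF assms(1,2)])
  also have "\<dots> \<le> (\<integral>x. 2 * ln (cmod (amp n \<theta> s x)) \<partial>M)"
    using ln_herm_integrable[OF assms(1) s] ln_amp_integrable_M[OF assms(1) s] ln_amp_bounds(3)[OF assms(1) s]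
    by (intro integral_mono) auto
  also have "\<dots> \<le> 2 * (B * real n * s)" using le by simp
  finally have "(\<Sum>k<n. \<integral>x. trace_density k \<theta> s x \<partial>M) * (\<eta> * s) \<le> (2 * B * real n / \<eta>) * (\<eta> * s)"
    using eta_pos by (simp add: mult_ac)
  then have "(\<Sum>k<n. \<integral>x. trace_density k \<theta> s x \<partial>M) \<le> 2 * B * real n / \<eta>"
    using eta_pos assms(2) by (simp only: mult_le_cancel_right) auto
  then show ?thesis using assms(3) by (simp add: field_simps)
qed

definition mean_form :: "nat \<Rightarrow> real \<Rightarrow> real \<Rightarrow> 'a \<Rightarrow> real^3" where
  "mean_form n \<theta> s x = (1 / real n) *\<^sub>R (\<Sum>k<n. form_of (row k \<theta> s x))"

lemma quad_mean_form:
  "quad (mean_form n \<theta> s x) y z = (\<Sum>k<n. quad (form_of (row k \<theta> s x)) y z) / real n"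
  unfolding mean_form_def by (simp add: linear_cmul[OF linear_quad] linear_sum[OF linear_quad])

text \<open>
  Summing \<open>form_step\<close> over the times shifts the index by one. The initial form is the Euclidean one and accounts for the term
  \<open>1 / n\<close>; the final form is nonnegative and is dropped.
\<close>

lemma mean_form_almost_invariant:
  assumes "\<theta> \<in> {\<alpha>..\<beta>}" "s \<in> {0<..1}" "0 < n"
  shows "quad (mean_form n \<theta> s x) y z
     \<le> quad (mean_form n \<theta> s (f x)) (A \<theta> x$1$1 * y + A \<theta> x$1$2 * z) (A \<theta> x$2$1 * y + A \<theta> x$2$2 * z)
       + (y\<^sup>2 + z\<^sup>2) * (1 / real n + 3 * C * s * ((\<Sum>k<n. trace_density k \<theta> s (f x)) / real n))"
proof -
  have s: "s \<in> {0..1}" using assms by simp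
  define y' z' where "y' = A \<theta> x$1$1 * y + A \<theta> x$1$2 * z" and "z' = A \<theta> x$2$1 * y + A \<theta> x$2$2 * z"
  define q where "q k = quad (form_of (row k \<theta> s x)) y z" for k
  have neg: "herm (row k \<theta> s x) < 0" for k x using herm_row(1)[OF assms(1) s, of k x] by linarith
  have q0: "q 0 = y\<^sup>2 + z\<^sup>2"
    unfolding q_def quad_form_of by (simp add: herm_def cdot_def cmod_def)
  have qn: "0 \<le> q k" for k
    unfolding q_def quad_form_of using neg[of k x] by (simp add: divide_nonneg_neg)
  have "q (Suc k) \<le> quad (form_of (row k \<theta> s (f x))) y' z' + (y\<^sup>2 + z\<^sup>2) * (3 * C * s * trace_density k \<theta> s (f x))" for k
    unfolding q_def row.simps y'_def z'_def trace_density_def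
    using bd[OF assms(1), of x] C1 s neg by (intro form_step[OF tan[OF assms(1)] kap(1)]) auto
  then have "(\<Sum>k<n. q (Suc k)) \<le> (\<Sum>k<n. quad (form_of (row k \<theta> s (f x))) y' z' + (y\<^sup>2 + z\<^sup>2) * (3 * C * s * trace_density k \<theta> s (f x)))"
    by (rule sum_mono)
  moreover have "(\<Sum>k<n. q k) + q n = q 0 + (\<Sum>k<n. q (Suc k))"
    by (metis sum.lessThan_Suc sum.lessThan_Suc_shift)
  ultimately have "(\<Sum>k<n. q k) \<le> (y\<^sup>2 + z\<^sup>2) + (\<Sum>k<n. quad (form_of (row k \<theta> s (f x))) y' z')
      + (y\<^sup>2 + z\<^sup>2) * (3 * C * s * (\<Sum>k<n. trace_density k \<theta> s (f x)))"
    using q0 qn[of n] by (simp add: sum.distrib sum_distrib_left)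
  then have "(\<Sum>k<n. q k) / real n \<le> ((y\<^sup>2 + z\<^sup>2) + (\<Sum>k<n. quad (form_of (row k \<theta> s (f x))) y' z')
      + (y\<^sup>2 + z\<^sup>2) * (3 * C * s * (\<Sum>k<n. trace_density k \<theta> s (f x)))) / real n"
    by (rule divide_right_mono) simp
  then show ?thesis
    unfolding quad_mean_form q_def[symmetric] y'_def[symmetric] z'_def[symmetric]
    by (simp add: add_divide_distrib distrib_left)
qed

text \<open>
  The error in \<open>mean_form_almost_invariant\<close> has mean at most \<open>1 / n\<close> plus a constant times \<open>s\<close>, since the trace average is bounded
  independently of \<open>s\<close> and \<open>n\<close>. So sequences with \<open>s \<rightarrow> 0\<close> and \<open>n \<rightarrow> \<infinity>\<close> have errors as small as desired.
\<close>

theorem bounded_growth_imp_conjugate: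
  assumes "\<theta> \<in> {\<alpha>..\<beta>}"
    and growth: "\<And>i::nat. \<exists>s n. 0 < s \<and> s \<le> 1 / real (Suc i) \<and> i < n \<and> (\<integral>x. ln (cmod (amp n \<theta> s x)) \<partial>M) \<le> B * real n * s"
  shows "L2_conjugate_to_rotations M f (A \<theta>)"
proof -
  interpret prob_space M by (rule prob)
  define B' where "B' = 2 * B / \<eta>"
  define mean where "mean n s x = (\<Sum>k<n. trace_density k \<theta> s x) / real n" for n s x
  have "\<exists>s n. s \<in> {0<..1} \<and> 0 < n \<and> (\<integral>x. ln (cmod (amp n \<theta> s x)) \<partial>M) \<le> B * real n * s
      \<and> 1 / real n + 3 * C * s * \<bar>B'\<bar> \<le> (1/2)^i" for i
  proof -
    define K where "K = 1 + 3 * C * \<bar>B'\<bar>"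
    have K: "1 \<le> K" using C1 by (simp add: K_def)
    obtain m :: nat where m: "K * 2^i < real m" using reals_Archimedean2 by blast
    obtain s n where sn: "0 < s" "s \<le> 1 / real (Suc m)" "m < n" "(\<integral>x. ln (cmod (amp n \<theta> s x)) \<partial>M) \<le> B * real n * s"
      using growth[of m] by blast
    have m0: "0 < real m" using m K by (meson less_trans mult_pos_pos zero_less_numeral zero_less_power less_le_trans zero_less_one)
    have "1 / real n \<le> 1 / real m" using sn m0 by (intro divide_left_mono) auto
    moreover have "3 * C * \<bar>B'\<bar> * s \<le> 3 * C * \<bar>B'\<bar> * (1 / real m)"
    proof (rule mult_left_mono)
      have "1 / real (Suc m) \<le> 1 / real m" using m0 by (intro divide_left_mono) auto
      then show "s \<le> 1 / real m" using sn by linarith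
    qed (use C1 in auto)
    ultimately have "1 / real n + 3 * C * s * \<bar>B'\<bar> \<le> K / real m" by (simp add: K_def add_divide_distrib mult_ac)
    also have "\<dots> \<le> (1/2)^i" using m m0 by (simp add: power_one_over field_simps)
    finally have "1 / real n + 3 * C * s * \<bar>B'\<bar> \<le> (1/2)^i" .
    moreover have "s \<le> 1" using sn(2) by (rule order_trans) simp
    ultimately show ?thesis using sn by (intro exI[of _ s] exI[of _ n]) simp
  qed
  then obtain s n where s: "\<And>i. s i \<in> {0<..1}" and n: "\<And>i. 0 < n i"
    and g: "\<And>i. (\<integral>x. ln (cmod (amp (n i) \<theta> (s i) x)) \<partial>M) \<le> B * real (n i) * s i"
    and small: "\<And>i. 1 / real (n i) + 3 * C * s i * \<bar>B'\<bar> \<le> (1/2)^i"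
    by metis
  have s': "s i \<in> {0..1}" for i using s[of i] by simp
  have neg: "herm (row k \<theta> (s i) x) < 0" for i k x using herm_row(1)[OF assms(1) s'[of i], of k x] by linarith
  have mean_int: "integrable M (mean (n i) (s i))" for i
    unfolding mean_def using trace_density_integrable[OF assms(1) s] by auto
  have mean_le: "(\<integral>x. mean (n i) (s i) x \<partial>M) \<le> B'" for i
    using trace_average_le[OF assms(1) s n g] trace_density_integrable[OF assms(1) s]
    by (simp add: mean_def B'_def)
  have mean0: "0 \<le> mean (n i) (s i) x" for i x
    unfolding mean_def using trace_density_bounds(1)[OF assms(1) s] by (intro divide_nonneg_nonneg sum_nonneg) auto
  have comp: "mean_form (n i) \<theta> (s i) x $ j = (\<Sum>k<n i. form_of (row k \<theta> (s i) x) $ j) / real (n i)" for i j x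
    by (simp add: mean_form_def)
  have R0: "0 \<le> mean_form (n i) \<theta> (s i) x $ j" for i j x
    unfolding comp by (intro divide_nonneg_nonneg sum_nonneg form_of_bounds neg) auto
  have R1: "mean_form (n i) \<theta> (s i) x $ j \<le> 2 * mean (n i) (s i) x" for i j x
  proof -
    have "(\<Sum>k<n i. form_of (row k \<theta> (s i) x) $ j) \<le> (\<Sum>k<n i. 2 * trace_density k \<theta> (s i) x)"
      unfolding trace_density_def by (intro sum_mono form_of_bounds neg)
    then show ?thesis unfolding comp mean_def by (simp add: divide_right_mono sum_distrib_left[symmetric])
  qed
  have Rm: "(\<lambda>x. mean_form (n i) \<theta> (s i) x) \<in> borel_measurable M" for i
    using herm_measurable(3)[OF assms(1)] unfolding mean_form_def by measurable
  note [measurable] = Rm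
  have Rint: "integrable M (\<lambda>x. mean_form (n i) \<theta> (s i) x $ j)" for i j
    by (rule Bochner_Integration.integrable_bound[of M "\<lambda>x. 2 * mean (n i) (s i) x"])
       (use mean_int R0 R1 mean0 in \<open>auto simp: abs_of_nonneg\<close>)
  have shift_int: "integrable M (\<lambda>x. mean (n i) (s i) (f x))" for i
    using integrable_distr[OF fm, of "mean (n i) (s i)"] mean_int[of i] inv by simp
  show ?thesis
  proof (rule almost_invariant_forms_imp_conjugate[where R = "\<lambda>i. mean_form (n i) \<theta> (s i)" and C = "2 * B'"
        and e = "\<lambda>i x. 1 / real (n i) + 3 * C * s i * mean (n i) (s i) (f x)"])
    show "det (A \<theta> x) = 1" for x using tan[OF assms(1), of x] by (simp add: det_2 tangent_def)
    show "fat (mean_form (n i) \<theta> (s i) x)" for i x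
      unfolding fat_def
    proof (intro allI)
      fix a b :: real
      let ?r = "\<lambda>k. form_of (row k \<theta> (s i) x)"
      have "(\<Sum>k<n i. 2 * b) \<le> (\<Sum>k<n i. quad (?r k) (- a) 1 + b\<^sup>2 * ?r k $ 1)"
        using fat_form_of[OF neg] by (intro sum_mono) (auto simp: fat_def)
      then have "(2 * b * real (n i)) / real (n i) \<le> (\<Sum>k<n i. quad (?r k) (- a) 1 + b\<^sup>2 * ?r k $ 1) / real (n i)"
        by (intro divide_right_mono) (auto simp: mult_ac)
      then show "2 * b \<le> quad (mean_form (n i) \<theta> (s i) x) (- a) 1 + b\<^sup>2 * mean_form (n i) \<theta> (s i) x $ 1"
        unfolding quad_mean_form comp using n[of i] by (simp add: sum.distrib sum_distrib_left[symmetric] add_divide_distrib)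
    qed
    show "(\<integral>x. mean_form (n i) \<theta> (s i) x $ j \<partial>M) \<le> 2 * B'" for i j
    proof -
      have "(\<integral>x. mean_form (n i) \<theta> (s i) x $ j \<partial>M) \<le> (\<integral>x. 2 * mean (n i) (s i) x \<partial>M)"
        using Rint R1 mean_int by (intro integral_mono) auto
      then show ?thesis using mean_le[of i] by simp
    qed
    show "integrable M (\<lambda>x. 1 / real (n i) + 3 * C * s i * mean (n i) (s i) (f x))" for i
      using shift_int by auto
    show "0 \<le> 1 / real (n i) + 3 * C * s i * mean (n i) (s i) (f x)" for i x
      using mean0 s'[of i] C1 by auto
    show "(\<integral>x. 1 / real (n i) + 3 * C * s i * mean (n i) (s i) (f x) \<partial>M) \<le> (1/2)^i" for i
    proof -
      have "(\<integral>x. 1 / real (n i) + 3 * C * s i * mean (n i) (s i) (f x) \<partial>M) = 1 / real (n i) + 3 * C * s i * (\<integral>x. mean (n i) (s i) x \<partial>M)"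
        using shift_int[of i] integral_shift[OF borel_measurable_integrable[OF mean_int[of i]]] by (simp add: prob_space)
      also have "\<dots> \<le> 1 / real (n i) + 3 * C * s i * \<bar>B'\<bar>"
        using mean_le[of i] s'[of i] C1 by (intro add_left_mono mult_left_mono) auto
      finally show ?thesis using small[of i] by linarith
    qed
    show "quad (mean_form (n i) \<theta> (s i) x) y z
       \<le> quad (mean_form (n i) \<theta> (s i) (f x)) (A \<theta> x$1$1 * y + A \<theta> x$1$2 * z) (A \<theta> x$2$1 * y + A \<theta> x$2$2 * z)
         + (y\<^sup>2 + z\<^sup>2) * (1 / real (n i) + 3 * C * s i * mean (n i) (s i) (f x))" for i x y z
      unfolding mean_def by (rule mean_form_almost_invariant[OF assms(1) s n])
  qed (rule prob fm inv Rm R0 Rint)+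
qed

end

section \<open>Growth at almost every parameter\<close>

text \<open>
  The limit is the infimum of the averages, as in the lemma of Fekete.
\<close>

lemma subadditive_average_converges:
  fixes a :: "nat \<Rightarrow> real"
  assumes sub: "\<And>m n. a (m + n) \<le> a m + a n" and nonneg: "\<And>n. 0 \<le> a n"
  shows "convergent (\<lambda>n. a n / real n)"
proof -
  define L where "L = Inf ((\<lambda>n. a n / real n) ` {0<..})"
  have bdd: "bdd_below ((\<lambda>n. a n / real n) ` {0<..})" using nonneg by (intro bdd_belowI[of _ 0]) auto
  have low: "L \<le> a n / real n" if "0 < n" for n
    unfolding L_def by (rule cInf_lower[OF _ bdd]) (use that in auto)
  have mult: "a (q * m + r) \<le> real q * a m + a r" for q m r
  proof (induction q)
    case (Suc q)
    then show ?case using sub[of m "q * m + r"] by (simp add: algebra_simps)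
  qed simp
  have "(\<lambda>n. a n / real n) \<longlonglongrightarrow> L"
  proof (rule LIMSEQ_I)
    fix e :: real assume "0 < e"
    then have "Inf ((\<lambda>n. a n / real n) ` {0<..}) < L + e / 2" unfolding L_def[symmetric] by simp
    then obtain m where m: "0 < m" "a m / real m < L + e / 2"
      using cInf_lessD[of "(\<lambda>n. a n / real n) ` {0<..}"] by auto
    define D where "D = (\<Sum>r<m. a r)"
    have D: "a r \<le> D" if "r < m" for r
      unfolding D_def by (rule member_le_sum) (use that nonneg in auto)
    obtain N :: nat where N: "2 * D / e < real N" using reals_Archimedean2 by blast
    have "norm (a n / real n - L) < e" if n: "max 1 N \<le> n" for n
    proof -
      have n0: "0 < real n" using n by simp
      have "a n = a (n div m * m + n mod m)" by simp
      also have "\<dots> \<le> real (n div m) * a m + a (n mod m)" by (rule mult)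
      also have "\<dots> \<le> real (n div m) * a m + D" using D[of "n mod m"] m by simp
      also have "real (n div m) * a m \<le> real n / real m * a m"
        using nonneg[of m] of_nat_div_le_of_nat[of n m, where 'a = real] by (intro mult_right_mono) auto
      finally have "a n \<le> real n * (a m / real m) + D" by simp
      then have "a n / real n \<le> (real n * (a m / real m) + D) / real n" using n0 by (intro divide_right_mono) auto
      also have "\<dots> = a m / real m + D / real n" using n0 by (simp add: add_divide_distrib)
      also have "D / real n < e / 2"
      proof -
        have "2 * D / e < real n" using N n by simp
        then show ?thesis using \<open>0 < e\<close> n0 by (simp add: field_simps)
      qed
      finally show ?thesis using low[of n] n m by auto
    qed
    then show "\<exists>no. \<forall>n\<ge>no. norm (a n / real n - L) < e" by blast
  qed
  then show ?thesis by (rule convergentI)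
qed

lemma frob_eq_norm: "frob P = (norm P)\<^sup>2"
  by (simp add: frob_def norm_vec_def L2_set_def sum_2)

lemma norm_vec2: "(norm (v :: real^2))\<^sup>2 = (v$1)\<^sup>2 + (v$2)\<^sup>2"
  by (simp add: norm_vec_def L2_set_def sum_2)

lemma opnorm_le_norm: "opnorm P \<le> norm P"
proof (rule onorm_le)
  fix v :: "real^2"
  have row: "(p * v$1 + q * v$2)\<^sup>2 \<le> (p\<^sup>2 + q\<^sup>2) * ((v$1)\<^sup>2 + (v$2)\<^sup>2)" for p q :: real
  proof -
    have "0 \<le> (p * v$2 - q * v$1)\<^sup>2" by simp
    then show ?thesis by (simp add: power2_eq_square algebra_simps)
  qed
  have "(norm (P *v v))\<^sup>2 \<le> frob P * (norm v)\<^sup>2"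
    using row[of "P$1$1" "P$1$2"] row[of "P$2$1" "P$2$2"]
    by (simp add: norm_vec2 matrix_vector_mult_def sum_2 frob_def algebra_simps)
  also have "\<dots> = (norm P * norm v)\<^sup>2" by (simp add: frob_eq_norm power_mult_distrib)
  finally show "norm (P *v v) \<le> norm P * norm v" by (rule power2_le_imp_le) simp
qed

lemma opnorm_nonneg: "0 \<le> opnorm P" by (rule onorm_pos_le) simp

lemma frob_le_opnorm: "frob P \<le> 2 * (opnorm P)\<^sup>2"
proof -
  have "norm (P *v axis j 1) \<le> opnorm P" for j
    using onorm[of "\<lambda>v. P *v v" "axis j 1"] by (simp add: norm_axis_1)
  then have "(norm (P *v axis j 1))\<^sup>2 \<le> (opnorm P)\<^sup>2" for j by (rule power_mono) simp
  from this[of 1] this[of 2] show ?thesis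
    by (simp add: norm_vec2 matrix_vector_mult_basis column_def frob_def)
qed

lemma opnorm_ge_1:
  assumes "det P = 1"
  shows "1 \<le> opnorm P"
proof -
  have "2 * (P$1$1 * P$2$2 - P$1$2 * P$2$1) \<le> frob P"
  proof -
    have "0 \<le> (P$1$1 - P$2$2)\<^sup>2 + (P$1$2 + P$2$1)\<^sup>2" by simp
    then show ?thesis by (simp add: frob_def power2_eq_square algebra_simps)
  qed
  then have "(1::real)\<^sup>2 \<le> (opnorm P)\<^sup>2" using assms frob_le_opnorm[of P] by (simp add: det_2)
  then show ?thesis by (rule power2_le_imp_le) (rule opnorm_nonneg)
qed

lemma opnorm_mult: "opnorm (P ** Q) \<le> opnorm P * opnorm Q"
  using onorm_compose[of "\<lambda>v. P *v v" "\<lambda>v. Q *v v"] by (simp add: o_def matrix_vector_mul_assoc)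

lemma opnorm_diff: "\<bar>opnorm P - opnorm Q\<bar> \<le> norm (P - Q)"
proof -
  have "opnorm P \<le> opnorm Q + norm (P - Q)" for P Q
  proof -
    have "(\<lambda>w. Q *v w + (P - Q) *v w) = (\<lambda>w. P *v w)" by (simp add: matrix_vector_mult_diff_rdistrib)
    then have "opnorm P \<le> opnorm Q + opnorm (P - Q)"
      using onorm_triangle[OF matrix_vector_mul_bounded_linear matrix_vector_mul_bounded_linear, of Q "P - Q"]
      by (simp only:)
    then show ?thesis using opnorm_le_norm[of "P - Q"] by linarith
  qed
  from this[of P Q] this[of Q P] show ?thesis by (simp add: norm_minus_commute)
qed

lemma opnorm_continuous: "continuous_on UNIV opnorm"
proof (rule continuous_at_imp_continuous_on, rule ballI)
  fix P :: "real^2^2"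
  show "isCont opnorm P"
    unfolding continuous_at_eps_delta dist_norm real_norm_def using opnorm_diff by (meson le_less_trans)
qed

lemma cocycle_iter_add: "cocycle_iter f A (m + n) x = cocycle_iter f A n ((f ^^ m) x) ** cocycle_iter f A m x"
proof (induction n)
  case 0 show ?case by simp
next
  case (Suc n)
  have "(f ^^ (m + n)) x = (f ^^ n) ((f ^^ m) x)" by (metis add.commute comp_apply funpow_add)
  then show ?case using Suc by (simp add: matrix_mul_assoc)
qed

lemma det_cocycle_iter: "(\<And>x. det (A x) = 1) \<Longrightarrow> det (cocycle_iter f A n x) = 1"
  by (induction n) (simp_all add: det_mul)

lemma col_act_mult: "col_act (P ** Q) 0 0 v = col_act P 0 0 (col_act Q 0 0 v)"
  by (simp add: col_act_def matrix_matrix_mult_def sum_2 complex_eq_iff algebra_simps)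

text \<open>
  Functions continuous in one variable and measurable in the other are jointly measurable: discretise the first variable.
\<close>

lemma borel_measurable_caratheodory:
  fixes h :: "real \<Rightarrow> 'a \<Rightarrow> real"
  assumes cont: "\<And>x. x \<in> space M \<Longrightarrow> continuous_on UNIV (\<lambda>t. h t x)"
    and meas: "\<And>t. h t \<in> borel_measurable M"
  shows "(\<lambda>p. h (fst p) (snd p)) \<in> borel_measurable (lborel \<Otimes>\<^sub>M M)"
proof (rule borel_measurable_LIMSEQ_real)
  fix p :: "real \<times> 'a" assume p: "p \<in> space (lborel \<Otimes>\<^sub>M M)"
  have "(\<lambda>k. real_of_int \<lfloor>fst p * real (Suc k)\<rfloor> / real (Suc k)) \<longlonglongrightarrow> fst p"
  proof (rule LIMSEQ_I)
    fix e :: real assume "0 < e"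
    then obtain N :: nat where N: "1 / real (Suc N) < e" using reals_Archimedean[of e] by (auto simp: inverse_eq_divide)
    have "norm (real_of_int \<lfloor>fst p * real (Suc k)\<rfloor> / real (Suc k) - fst p) < e" if "N \<le> k" for k
    proof -
      have "\<bar>real_of_int \<lfloor>fst p * real (Suc k)\<rfloor> - fst p * real (Suc k)\<bar> \<le> 1" by linarith
      then have "\<bar>real_of_int \<lfloor>fst p * real (Suc k)\<rfloor> - fst p * real (Suc k)\<bar> / real (Suc k) \<le> 1 / real (Suc k)"
        by (rule divide_right_mono) simp
      moreover have "\<bar>real_of_int \<lfloor>fst p * real (Suc k)\<rfloor> - fst p * real (Suc k)\<bar> / real (Suc k)
         = \<bar>real_of_int \<lfloor>fst p * real (Suc k)\<rfloor> / real (Suc k) - fst p\<bar>"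
      proof -
        have eq: "\<bar>u - v * w\<bar> / w = \<bar>u / w - v\<bar>" if "0 < w" for u v w :: real
        proof -
          have "u / w - v = (u - v * w) / w" using that by (simp add: field_simps)
          then show ?thesis using that by (simp add: abs_divide)
        qed
        show ?thesis by (rule eq) simp
      qed
      moreover have "1 / real (Suc k) \<le> 1 / real (Suc N)" using that by (intro divide_left_mono) auto
      ultimately show ?thesis using N by (simp only: real_norm_def)
    qed
    then show "\<exists>no. \<forall>k\<ge>no. norm (real_of_int \<lfloor>fst p * real (Suc k)\<rfloor> / real (Suc k) - fst p) < e" by blast
  qed
  moreover have "isCont (\<lambda>t. h t (snd p)) (fst p)"
    using cont[of "snd p"] p by (simp add: continuous_on_eq_continuous_at space_pair_measure mem_Times_iff)
  ultimately show "(\<lambda>k. h (real_of_int \<lfloor>fst p * real (Suc k)\<rfloor> / real (Suc k)) (snd p)) \<longlonglongrightarrow> h (fst p) (snd p)"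
    by (rule isCont_tendsto_compose[rotated])
next
  fix k :: nat
  note [measurable] = meas
  have "(\<lambda>p. h (real_of_int i / real (Suc k)) (snd p)) \<in> borel_measurable (lborel \<Otimes>\<^sub>M M)" for i :: int
    by measurable
  moreover have "(\<lambda>p. \<lfloor>fst p * real (Suc k)\<rfloor>) \<in> measurable (lborel \<Otimes>\<^sub>M M) (count_space UNIV)" by measurable
  ultimately show "(\<lambda>p. h (real_of_int \<lfloor>fst p * real (Suc k)\<rfloor> / real (Suc k)) (snd p)) \<in> borel_measurable (lborel \<Otimes>\<^sub>M M)"
    by (rule measurable_compose_countable[where f = "\<lambda>i p. h (real_of_int i / real (Suc k)) (snd p)"])
qed

lemma liminf_less_imp_frequently:
  fixes u :: "nat \<Rightarrow> ennreal"
  assumes "liminf u < c"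
  shows "\<exists>j\<ge>i. u j < c"
proof (rule ccontr)
  assume "\<not> (\<exists>j\<ge>i. u j < c)"
  then have "eventually (\<lambda>j. c \<le> u j) sequentially" unfolding eventually_sequentially by (auto simp: not_less)
  then have "c \<le> liminf u" by (rule Liminf_bounded)
  then show False using assms by simp
qed

context twisting_cocycle
begin

definition increment :: "nat \<Rightarrow> real \<Rightarrow> real \<Rightarrow> 'a \<Rightarrow> real" where
  "increment n s \<theta> x = ln (cmod (amp n \<theta> s x)) - ln (cmod (amp n \<theta> 0 x))"

text \<open>
  The cocycle is controlled only for parameters in the interval. Composition with the retraction onto it gives functions that are continuous on
  the whole line.
\<close>

definition clamp :: "real \<Rightarrow> real" where
  "clamp \<theta> = max \<alpha> (min \<beta> \<theta>)"

lemma clamp: "clamp \<theta> \<in> {\<alpha>..\<beta>}" "\<theta> \<in> {\<alpha>..\<beta>} \<Longrightarrow> clamp \<theta> = \<theta>"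
  using less by (auto simp: clamp_def)

lemma increment_nonneg: "\<theta> \<in> {\<alpha>..\<beta>} \<Longrightarrow> s \<in> {0..1} \<Longrightarrow> 0 \<le> increment n s \<theta> x"
  using ln_amp_mono[of \<theta> s n x] by (simp add: increment_def)

lemma increment_measurable:
  assumes "s \<in> {0..1}"
  shows "(\<lambda>p. increment n s (clamp (fst p)) (snd p)) \<in> borel_measurable (lborel \<Otimes>\<^sub>M M)"
proof (rule borel_measurable_caratheodory)
  show "(\<lambda>x. increment n s (clamp t) x) \<in> borel_measurable M" for t
  proof -
    note [measurable] = herm_measurable(4)[OF clamp(1)]
    show ?thesis unfolding increment_def by measurable
  qed
  fix x
  have "continuous_on {\<alpha>..\<beta>} (\<lambda>t. increment n s t x)"
    unfolding increment_def using amp_nonzero[OF _ assms] amp_nonzero[of _ 0]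
    by (intro continuous_intros amp_continuous_theta) auto
  moreover have "continuous_on UNIV clamp" unfolding clamp_def by (intro continuous_intros)
  ultimately show "continuous_on UNIV (\<lambda>t. increment n s (clamp t) x)"
    by (rule continuous_on_compose2) (use clamp in auto)
qed

lemma nn_integral_increment_le:
  assumes s: "s \<in> {0..1}"
  shows "(\<integral>\<^sup>+\<theta>. indicator {\<alpha>..\<beta>} \<theta> * (\<integral>\<^sup>+x. ennreal (increment n s (clamp \<theta>) x) \<partial>M) \<partial>lborel) \<le> ennreal (K2 * real n * s)"
proof -
  interpret prob_space M by (rule prob)
  interpret pair_sigma_finite lborel M
    by (intro pair_sigma_finite.intro lborel.sigma_finite_measure_axioms sigma_finite_measure_axioms)
  let ?g = "\<lambda>\<theta> x. indicator {\<alpha>..\<beta>} \<theta> * ennreal (increment n s (clamp \<theta>) x)"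
  have gm: "(\<lambda>(\<theta>, x). ?g \<theta> x) \<in> borel_measurable (lborel \<Otimes>\<^sub>M M)"
    using increment_measurable[OF s, of n] unfolding split_beta' by measurable
  have m1: "(\<lambda>x. increment n s (clamp \<theta>) x) \<in> borel_measurable M" for \<theta>
    using measurable_compose[OF measurable_Pair1'[of \<theta> lborel M] increment_measurable[OF s, of n]] by simp
  have m2: "(\<lambda>\<theta>. increment n s (clamp \<theta>) x) \<in> borel_measurable lborel" if "x \<in> space M" for x
    using measurable_compose[OF measurable_Pair2'[OF that, of lborel] increment_measurable[OF s, of n]] by simp
  have "(\<integral>\<^sup>+\<theta>. indicator {\<alpha>..\<beta>} \<theta> * (\<integral>\<^sup>+x. ennreal (increment n s (clamp \<theta>) x) \<partial>M) \<partial>lborel)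
      = (\<integral>\<^sup>+\<theta>. \<integral>\<^sup>+x. ?g \<theta> x \<partial>M \<partial>lborel)"
    using m1 by (intro nn_integral_cong nn_integral_cmult[symmetric]) auto
  also have "\<dots> = (\<integral>\<^sup>+x. \<integral>\<^sup>+\<theta>. ?g \<theta> x \<partial>lborel \<partial>M)" by (rule Fubini'[OF gm, symmetric])
  also have "\<dots> \<le> (\<integral>\<^sup>+x. ennreal (K2 * real n * s) \<partial>M)"
  proof (rule nn_integral_mono)
    fix x assume x: "x \<in> space M"
    have "(\<lambda>\<theta>. increment n s \<theta> x) integrable_on {\<alpha>..\<beta>}"
      unfolding increment_def using ln_amp_integrable[OF s] ln_amp_integrable[of 0] by (intro integrable_diff) auto
    then have "((\<lambda>\<theta>. increment n s (clamp \<theta>) x) has_integral integral {\<alpha>..\<beta>} (\<lambda>\<theta>. increment n s \<theta> x)) {\<alpha>..\<beta>}"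
      by (intro has_integral_eq[OF _ integrable_integral]) (simp_all add: clamp)
    then have "(\<integral>\<^sup>+\<theta>. ennreal (increment n s (clamp \<theta>) x) * indicator {\<alpha>..\<beta>} \<theta> \<partial>lborel) = ennreal (integral {\<alpha>..\<beta>} (\<lambda>\<theta>. increment n s \<theta> x))"
      using increment_nonneg[OF clamp(1) s] m2[OF x] by (intro nn_integral_has_integral_lebesgue') auto
    then have "(\<integral>\<^sup>+\<theta>. ?g \<theta> x \<partial>lborel) = ennreal (integral {\<alpha>..\<beta>} (\<lambda>\<theta>. increment n s \<theta> x))"
      by (simp add: mult.commute)
    also have "\<dots> \<le> ennreal (K2 * real n * s)"
      unfolding increment_def by (rule ennreal_leI[OF integral_ln_amp_increment[OF s]])
    finally show "(\<integral>\<^sup>+\<theta>. ?g \<theta> x \<partial>lborel) \<le> ennreal (K2 * real n * s)" .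
  qed
  also have "\<dots> = ennreal (K2 * real n * s)" by (simp add: emeasure_space_1)
  finally show ?thesis .
qed

text \<open>
  The lemma of Fatou is applied for \<open>n \<rightarrow> \<infinity>\<close> with \<open>s\<close> fixed and then for \<open>s \<rightarrow> 0\<close>. The order of the limits
  matters: \<open>n\<close> may be taken as large as desired once \<open>s\<close> is chosen, so that the convergence to the Lyapunov exponent at
  \<open>s = 0\<close> can be used at scale \<open>s\<close>.
\<close>

lemma AE_increment_bounded:
  "AE \<theta> in lborel. \<theta> \<in> {\<alpha>..\<beta>} \<longrightarrow>
    (\<exists>B. \<forall>i. \<exists>j\<ge>i. \<forall>N. \<exists>n\<ge>N. (\<integral>x. increment (Suc n) (1 / real (Suc j)) \<theta> x \<partial>M) \<le> B * real (Suc n) * (1 / real (Suc j)))"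
proof -
  interpret prob_space M by (rule prob)
  have s01: "1 / real (Suc j) \<in> {0..1}" for j by simp
  define g where "g n j \<theta> = ennreal (real (Suc j) / real (Suc n)) *
     (indicator {\<alpha>..\<beta>} \<theta> * (\<integral>\<^sup>+x. ennreal (increment (Suc n) (1 / real (Suc j)) (clamp \<theta>) x) \<partial>M))" for n j \<theta>
  have [measurable]: "(\<lambda>\<theta>. \<integral>\<^sup>+x. ennreal (increment (Suc n) (1 / real (Suc j)) (clamp \<theta>) x) \<partial>M) \<in> borel_measurable lborel" for n j
  proof -
    have "(\<lambda>(\<theta>, x). ennreal (increment (Suc n) (1 / real (Suc j)) (clamp \<theta>) x)) \<in> borel_measurable (lborel \<Otimes>\<^sub>M M)"
      using increment_measurable[OF s01, of "Suc n" j] unfolding split_beta' by measurable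
    then show ?thesis by (rule borel_measurable_nn_integral)
  qed
  have gm[measurable]: "g n j \<in> borel_measurable lborel" for n j unfolding g_def by measurable
  have gint: "(\<integral>\<^sup>+\<theta>. g n j \<theta> \<partial>lborel) \<le> ennreal K2" for n j
  proof -
    have "(\<integral>\<^sup>+\<theta>. g n j \<theta> \<partial>lborel) = ennreal (real (Suc j) / real (Suc n)) * 
       (\<integral>\<^sup>+\<theta>. indicator {\<alpha>..\<beta>} \<theta> * (\<integral>\<^sup>+x. ennreal (increment (Suc n) (1 / real (Suc j)) (clamp \<theta>) x) \<partial>M) \<partial>lborel)"
      unfolding g_def by (intro nn_integral_cmult) measurable
    also have "\<dots> \<le> ennreal (real (Suc j) / real (Suc n)) * ennreal (K2 * real (Suc n) * (1 / real (Suc j)))"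
      by (intro mult_left_mono nn_integral_increment_le s01) simp
    also have "\<dots> = ennreal (real (Suc j) / real (Suc n) * (K2 * real (Suc n) * (1 / real (Suc j))))"
      using K2_nonneg by (intro ennreal_mult[symmetric]) auto
    also have "real (Suc j) / real (Suc n) * (K2 * real (Suc n) * (1 / real (Suc j))) = K2" by (simp del: of_nat_Suc)
    finally show ?thesis .
  qed
  have fatou: "(\<integral>\<^sup>+\<theta>. liminf (\<lambda>n. u n \<theta>) \<partial>lborel) \<le> ennreal K2"
    if [measurable]: "\<And>n. u n \<in> borel_measurable lborel" and "\<And>n. (\<integral>\<^sup>+\<theta>. u n \<theta> \<partial>lborel) \<le> ennreal K2"
    for u :: "nat \<Rightarrow> real \<Rightarrow> ennreal"
  proof -
    have "(\<integral>\<^sup>+\<theta>. liminf (\<lambda>n. u n \<theta>) \<partial>lborel) \<le> liminf (\<lambda>n. \<integral>\<^sup>+\<theta>. u n \<theta> \<partial>lborel)"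
      by (rule nn_integral_liminf) measurable
    also have "\<dots> \<le> limsup (\<lambda>n. \<integral>\<^sup>+\<theta>. u n \<theta> \<partial>lborel)" by (rule Liminf_le_Limsup) simp
    also have "\<dots> \<le> ennreal K2" by (rule Limsup_bounded) (use that in simp)
    finally show ?thesis .
  qed
  have "(\<integral>\<^sup>+\<theta>. liminf (\<lambda>j. liminf (\<lambda>n. g n j \<theta>)) \<partial>lborel) \<le> ennreal K2"
    by (intro fatou gint) measurable
  then have "(\<integral>\<^sup>+\<theta>. liminf (\<lambda>j. liminf (\<lambda>n. g n j \<theta>)) \<partial>lborel) \<noteq> \<infinity>" by (auto simp: top_unique)
  then have "AE \<theta> in lborel. liminf (\<lambda>j. liminf (\<lambda>n. g n j \<theta>)) \<noteq> \<infinity>"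
    by (intro nn_integral_PInf_AE) measurable
  then show ?thesis
  proof eventually_elim
    case (elim \<theta>)
    show ?case
    proof (intro impI)
      assume \<theta>: "\<theta> \<in> {\<alpha>..\<beta>}"
      define B where "B = enn2real (liminf (\<lambda>j. liminf (\<lambda>n. g n j \<theta>))) + 1"
      have "liminf (\<lambda>j. liminf (\<lambda>n. g n j \<theta>)) < ennreal B"
        using elim unfolding B_def
        by (metis enn2real_nonneg ennreal_enn2real ennreal_less_iff infinity_ennreal_def less_add_one less_top)
      note lt = liminf_less_imp_frequently[OF this]
      have "\<exists>j\<ge>i. \<forall>N. \<exists>n\<ge>N. (\<integral>x. increment (Suc n) (1 / real (Suc j)) \<theta> x \<partial>M) \<le> B * real (Suc n) * (1 / real (Suc j))" for i
      proof -
        obtain j where j: "i \<le> j" "liminf (\<lambda>n. g n j \<theta>) < ennreal B" using lt[of i] by blast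
        have "\<exists>n\<ge>N. (\<integral>x. increment (Suc n) (1 / real (Suc j)) \<theta> x \<partial>M) \<le> B * real (Suc n) * (1 / real (Suc j))" for N
        proof -
          obtain n where n: "N \<le> n" "g n j \<theta> < ennreal B" using liminf_less_imp_frequently[OF j(2), of N] by blast
          let ?I = "\<integral>x. increment (Suc n) (1 / real (Suc j)) \<theta> x \<partial>M"
          have "integrable M (\<lambda>x. increment (Suc n) (1 / real (Suc j)) \<theta> x)"
            unfolding increment_def using ln_amp_integrable_M[OF \<theta> s01] ln_amp_integrable_M[OF \<theta>, of 0] by auto
          then have "(\<integral>\<^sup>+x. ennreal (increment (Suc n) (1 / real (Suc j)) \<theta> x) \<partial>M) = ennreal ?I"
            using increment_nonneg[OF \<theta> s01] by (intro nn_integral_eq_integral) auto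
          then have "g n j \<theta> = ennreal (real (Suc j) / real (Suc n)) * ennreal ?I"
            unfolding g_def using \<theta> by (simp add: clamp)
          also have "\<dots> = ennreal (real (Suc j) / real (Suc n) * ?I)"
            using increment_nonneg[OF \<theta> s01] by (intro ennreal_mult[symmetric]) auto
          finally have "ennreal (real (Suc j) / real (Suc n) * ?I) < ennreal B" using n by simp
          then have "real (Suc j) / real (Suc n) * ?I < B"
            using increment_nonneg[OF \<theta> s01] by (subst (asm) ennreal_less_iff) (auto intro!: mult_nonneg_nonneg)
          then have "?I \<le> B * real (Suc n) * (1 / real (Suc j))" by (simp add: field_simps del: of_nat_Suc)
          then show ?thesis using n(1) by blast
        qed
        then show ?thesis using j(1) by blast
      qed
      then show "\<exists>B. \<forall>i. \<exists>j\<ge>i. \<forall>N. \<exists>n\<ge>N. (\<integral>x. increment (Suc n) (1 / real (Suc j)) \<theta> x \<partial>M) \<le> B * real (Suc n) * (1 / real (Suc j))"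
        by blast
    qed
  qed
qed

lemma row_zero: 
  "cdot (row n \<theta> 0 x) v = cdot (1, -\<i>) (col_act (cocycle_iter f (A \<theta>) n x) 0 0 v)"
proof (induction n arbitrary: x v)
  case 0 show ?case by (simp add: cdot_def col_act_def mat_def complex_eq_iff)
next
  case (Suc n)
  have "col_act (A \<theta> x) (A1 \<theta> x) 0 v = col_act (A \<theta> x) 0 0 v" by (simp add: col_act_def)
  then show ?case
    using Suc[of "f x"] cocycle_iter_add[of f "A \<theta>" 1 n x] by (simp add: cdot_row_act col_act_mult)
qed

lemma ln_amp_zero_le:
  assumes "\<theta> \<in> {\<alpha>..\<beta>}"
  shows "ln (cmod (amp n \<theta> 0 x)) \<le> ln 2 + ln (opnorm (cocycle_iter f (A \<theta>) n x))"
proof -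
  let ?P = "cocycle_iter f (A \<theta>) n x"
  have "det (A \<theta> x) = 1" for x using tan[OF assms, of x] by (simp add: det_2 tangent_def)
  then have one: "1 \<le> opnorm ?P" by (intro opnorm_ge_1 det_cocycle_iter)
  have "(cmod (amp n \<theta> 0 x))\<^sup>2 \<le> nsq (1, -\<i>) * nsq (col_act ?P 0 0 (1, \<i>))"
    unfolding amp_def row_zero by (rule cmod_cdot_le)
  also have "nsq (col_act ?P 0 0 (1, \<i>)) = frob ?P"
    by (simp add: nsq_def col_act_def frob_def cmod_power2)
  also have "nsq (1, -\<i>) * frob ?P \<le> 2 * (2 * (opnorm ?P)\<^sup>2)"
    using frob_le_opnorm[of ?P] by (simp add: nsq_def)
  also have "\<dots> = (2 * opnorm ?P)\<^sup>2" by (simp add: power_mult_distrib)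
  finally have "cmod (amp n \<theta> 0 x) \<le> 2 * opnorm ?P" by (rule power2_le_imp_le) (use one in simp)
  moreover have "0 < cmod (amp n \<theta> 0 x)" using amp_nonzero[OF assms, of 0] by simp
  ultimately have "ln (cmod (amp n \<theta> 0 x)) \<le> ln (2 * opnorm ?P)" by (intro ln_mono) auto
  then show ?thesis using one by (simp add: ln_mult_pos)
qed

lemma ln_opnorm_cocycle:
  assumes \<theta>: "\<theta> \<in> {\<alpha>..\<beta>}"
  shows "integrable M (\<lambda>x. ln (opnorm (cocycle_iter f (A \<theta>) n x)))"
    and "0 \<le> ln (opnorm (cocycle_iter f (A \<theta>) n x))"
proof -
  interpret prob_space M by (rule prob)
  have detA: "det (A \<theta> x) = 1" for x using tan[OF \<theta>, of x] by (simp add: det_2 tangent_def)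
  have one: "1 \<le> opnorm (cocycle_iter f (A \<theta>) n x)" for n x by (intro opnorm_ge_1 det_cocycle_iter detA)
  then show "0 \<le> ln (opnorm (cocycle_iter f (A \<theta>) n x))" by (simp add: ln_ge_zero)
  have bound: "opnorm (cocycle_iter f (A \<theta>) n x) \<le> C ^ n" for x
  proof (induction n)
    case 0 show ?case by (simp add: onorm_id)
  next
    case (Suc n)
    have "opnorm (A \<theta> y) \<le> C" for y
    proof -
      have "(norm (A \<theta> y))\<^sup>2 \<le> C * C"
        using bd(1)[OF \<theta>, of y] C1 mult_left_mono[of 1 C C] unfolding frob_eq_norm by linarith
      then have "(norm (A \<theta> y))\<^sup>2 \<le> C\<^sup>2" by (simp add: power2_eq_square)
      then have "norm (A \<theta> y) \<le> C" by (rule power2_le_imp_le) (use C1 in simp)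
      then show ?thesis using opnorm_le_norm[of "A \<theta> y"] by linarith
    qed
    then have "opnorm (cocycle_iter f (A \<theta>) (Suc n) x) \<le> C * C ^ n"
      using Suc C1 by (auto intro!: order_trans[OF opnorm_mult] mult_mono opnorm_nonneg)
    then show ?case by simp
  qed
  have "(\<lambda>x. cocycle_iter f (A \<theta>) n x) \<in> borel_measurable M"
  proof (induction n)
    case 0 show ?case by simp
  next
    case (Suc n)
    have "(\<lambda>x. (f ^^ n) x) \<in> measurable M M" by (rule measurable_compose_n[OF fm])
    note [measurable] = Suc measurable_compose[OF this Am[OF \<theta>]]
    show ?case
      by (intro borel_measurable_vecI) (simp add: matrix_matrix_mult_def)
  qed
  note [measurable] = measurable_compose[OF this borel_measurable_continuous_onI[OF opnorm_continuous]]
  show "integrable M (\<lambda>x. ln (opnorm (cocycle_iter f (A \<theta>) n x)))"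
  proof (rule integrable_const_bound[where B = "ln (C ^ n)"])
    have "\<bar>ln (opnorm (cocycle_iter f (A \<theta>) n x))\<bar> \<le> ln (C ^ n)" for x
      using one[of n x] bound[of x] by (simp add: ln_mono)
    then show "AE x in M. norm (ln (opnorm (cocycle_iter f (A \<theta>) n x))) \<le> ln (C ^ n)" by simp
  qed measurable
qed

text \<open>
  The exponent is defined by a limit operator, so its value carries information only because the sequence converges, by subadditivity.
\<close>

lemma lyapunov_tendsto:
  assumes \<theta>: "\<theta> \<in> {\<alpha>..\<beta>}"
  shows "(\<lambda>n. (\<integral>x. ln (opnorm (cocycle_iter f (A \<theta>) n x)) \<partial>M) / real n) \<longlonglongrightarrow> lyapunov M f (A \<theta>)"
proof -
  define a where "a n = (\<integral>x. ln (opnorm (cocycle_iter f (A \<theta>) n x)) \<partial>M)" for n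
  note I = ln_opnorm_cocycle(1)[OF \<theta>]
  have shift: "integrable M (\<lambda>x. g ((f ^^ m) x)) \<and> (\<integral>x. g ((f ^^ m) x) \<partial>M) = (\<integral>x. g x \<partial>M)"
    if "integrable M g" for g :: "'a \<Rightarrow> real" and m
  proof (induction m)
    case 0 show ?case using that by simp
  next
    case (Suc m)
    then have "integrable (distr M M f) (\<lambda>x. g ((f ^^ m) x))" using inv by simp
    then have "integrable M (\<lambda>x. g ((f ^^ m) (f x)))" by (rule integrable_distr[OF fm])
    moreover have "(\<integral>x. g ((f ^^ m) (f x)) \<partial>M) = (\<integral>x. g ((f ^^ m) x) \<partial>M)"
      using Suc by (intro integral_shift) auto
    ultimately show ?case using Suc by (simp add: funpow_swap1)
  qed
  have detA: "det (A \<theta> x) = 1" for x using tan[OF \<theta>, of x] by (simp add: det_2 tangent_def)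
  have one: "1 \<le> opnorm (cocycle_iter f (A \<theta>) n x)" for n x by (intro opnorm_ge_1 det_cocycle_iter detA)
  have "a (m + n) \<le> a m + a n" for m n
  proof -
    have pt: "ln (opnorm (cocycle_iter f (A \<theta>) (m + n) x))
       \<le> ln (opnorm (cocycle_iter f (A \<theta>) n ((f ^^ m) x))) + ln (opnorm (cocycle_iter f (A \<theta>) m x))" for x
    proof -
      have "ln (opnorm (cocycle_iter f (A \<theta>) (m + n) x))
         \<le> ln (opnorm (cocycle_iter f (A \<theta>) n ((f ^^ m) x)) * opnorm (cocycle_iter f (A \<theta>) m x))"
        using one[of "m + n" x] opnorm_mult by (intro ln_mono) (auto simp: cocycle_iter_add)
      also have "\<dots> = ln (opnorm (cocycle_iter f (A \<theta>) n ((f ^^ m) x))) + ln (opnorm (cocycle_iter f (A \<theta>) m x))"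
        using one[of n "(f ^^ m) x"] one[of m x] by (intro ln_mult_pos) auto
      finally show ?thesis .
    qed
    have "a (m + n) \<le> (\<integral>x. ln (opnorm (cocycle_iter f (A \<theta>) n ((f ^^ m) x))) + ln (opnorm (cocycle_iter f (A \<theta>) m x)) \<partial>M)"
      unfolding a_def using shift[OF I] I pt by (intro integral_mono) auto
    also have "\<dots> = a n + a m" unfolding a_def using shift[OF I] I by simp
    finally show ?thesis by simp
  qed
  moreover have "0 \<le> a n" for n
    unfolding a_def by (rule integral_nonneg_AE) (use ln_opnorm_cocycle(2)[OF \<theta>] in simp)
  ultimately have "convergent (\<lambda>n. a n / real n)" by (rule subadditive_average_converges)
  then show ?thesis
    unfolding lyapunov_def a_def by (simp add: convergent_LIMSEQ_iff)
qed

text \<open>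
  At a parameter with zero exponent, the average of \<open>ln |amp|\<close> at \<open>s = 0\<close> is eventually below \<open>n s\<close> for each fixed
  \<open>s\<close>; adding the increment gives the hypothesis of \<open>bounded_growth_imp_conjugate\<close>.
\<close>

theorem AE_conjugate:
  "AE \<theta> in lborel. \<theta> \<in> {\<alpha>..\<beta>} \<longrightarrow> lyapunov M f (A \<theta>) = 0 \<longrightarrow> L2_conjugate_to_rotations M f (A \<theta>)"
  using AE_increment_bounded
proof eventually_elim
  case (elim \<theta>)
  interpret prob_space M by (rule prob)
  show ?case
  proof (intro impI)
    assume \<theta>: "\<theta> \<in> {\<alpha>..\<beta>}" and L0: "lyapunov M f (A \<theta>) = 0"
    from elim \<theta> obtain B where B: "\<And>i. \<exists>j\<ge>i. \<forall>N. \<exists>n\<ge>N.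
        (\<integral>x. increment (Suc n) (1 / real (Suc j)) \<theta> x \<partial>M) \<le> B * real (Suc n) * (1 / real (Suc j))" by blast
    define a where "a n = (\<integral>x. ln (opnorm (cocycle_iter f (A \<theta>) n x)) \<partial>M)" for n
    have lim: "(\<lambda>n. (ln 2 + a n) / real n) \<longlonglongrightarrow> 0"
    proof -
      have "(\<lambda>n. ln 2 / real n + a n / real n) \<longlonglongrightarrow> 0 + 0"
        using lyapunov_tendsto[OF \<theta>] L0 unfolding a_def by (intro tendsto_add lim_const_over_n) simp
      then show ?thesis by (simp add: add_divide_distrib)
    qed
    show "L2_conjugate_to_rotations M f (A \<theta>)"
    proof (rule bounded_growth_imp_conjugate[OF \<theta>, of "B + 1"])
      fix i :: nat
      obtain j where j: "i \<le> j" and Bj: "\<And>N. \<exists>n\<ge>N. (\<integral>x. increment (Suc n) (1 / real (Suc j)) \<theta> x \<partial>M) \<le> B * real (Suc n) * (1 / real (Suc j))"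
        using B[of i] by blast
      define s where "s = 1 / real (Suc j)"
      have s: "0 < s" "s \<in> {0..1}" "s \<le> 1 / real (Suc i)" using j by (auto simp: s_def frac_le)
      obtain N where N0: "\<forall>n\<ge>N. norm ((ln 2 + a n) / real n - 0) < s"
        using LIMSEQ_D[OF lim s(1)] by blast
      have N: "(ln 2 + a n) / real n < s" if "N \<le> n" for n
        using N0[rule_format, OF that] by (simp only: real_norm_def diff_0_right abs_less_iff)
      obtain n where n: "max N i \<le> n" "(\<integral>x. increment (Suc n) s \<theta> x \<partial>M) \<le> B * real (Suc n) * s"
        using Bj[of "max N i"] unfolding s_def by blast
      have "(\<integral>x. ln (cmod (amp (Suc n) \<theta> s x)) \<partial>M) = (\<integral>x. increment (Suc n) s \<theta> x \<partial>M) + (\<integral>x. ln (cmod (amp (Suc n) \<theta> 0 x)) \<partial>M)"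
        unfolding increment_def using ln_amp_integrable_M[OF \<theta> s(2)] ln_amp_integrable_M[OF \<theta>, of 0] by simp
      also have "(\<integral>x. ln (cmod (amp (Suc n) \<theta> 0 x)) \<partial>M) \<le> (\<integral>x. ln 2 + ln (opnorm (cocycle_iter f (A \<theta>) (Suc n) x)) \<partial>M)"
        using ln_amp_integrable_M[OF \<theta>, of 0] ln_opnorm_cocycle(1)[OF \<theta>] ln_amp_zero_le[OF \<theta>]
        by (intro integral_mono) (auto simp del: cocycle_iter.simps)
      also have "\<dots> = ln 2 + a (Suc n)"
        unfolding a_def using ln_opnorm_cocycle(1)[OF \<theta>, of "Suc n"] by (simp add: prob_space del: cocycle_iter.simps)
      also have "ln 2 + a (Suc n) \<le> s * real (Suc n)"
        using N[of "Suc n"] n(1) by (simp add: pos_divide_less_eq del: of_nat_Suc)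
      finally have "(\<integral>x. ln (cmod (amp (Suc n) \<theta> s x)) \<partial>M) \<le> (B + 1) * real (Suc n) * s"
        using n(2) by (simp add: algebra_simps del: of_nat_Suc)
      then show "\<exists>s n. 0 < s \<and> s \<le> 1 / real (Suc i) \<and> i < n \<and> (\<integral>x. ln (cmod (amp n \<theta> s x)) \<partial>M) \<le> (B + 1) * real n * s"
        using s n(1) by (intro exI[of _ s] exI[of _ "Suc n"]) auto
    qed
  qed
qed

end

section \<open>Uniform regularity and monotonicity of the family\<close>

lemma vderiv_0 [simp]: "vderiv 0 g = g" by (simp add: vderiv_def)

lemma vderiv_Suc: "vderiv (Suc j) g t = vector_derivative (vderiv j g) (at t)"
  by (simp add: vderiv_def)

lemma Cr_space_has_derivative:
  assumes "g \<in> Cr_space r J S" "j < nat \<lfloor>r\<rfloor>" "t \<in> J"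
  shows "(vderiv j g has_vector_derivative vderiv (Suc j) g t) (at t)"
  using assms unfolding Cr_space_def by (simp add: vderiv_Suc vector_derivative_works[symmetric])

lemma Cr_space_continuous:
  assumes "g \<in> Cr_space r J S" "j \<le> nat \<lfloor>r\<rfloor>"
  shows "continuous_on J (vderiv j g)"
proof (cases "j = nat \<lfloor>r\<rfloor>")
  case True then show ?thesis using assms by (simp add: Cr_space_def)
next
  case False
  then have "vderiv j g differentiable (at t)" if "t \<in> J" for t using assms that by (simp add: Cr_space_def)
  then show ?thesis by (intro continuous_at_imp_continuous_on ballI differentiable_imp_continuous_within)
qed

lemma vderiv_diff:
  assumes "open J" "g \<in> Cr_space r J S" "h \<in> Cr_space r J S" "j \<le> nat \<lfloor>r\<rfloor>" "t \<in> J"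
  shows "vderiv j (\<lambda>t. h t - g t) t = vderiv j h t - vderiv j g t"
  using assms(4,5)
proof (induction j arbitrary: t)
  case 0 show ?case by simp
next
  case (Suc j)
  have "((\<lambda>t. vderiv j h t - vderiv j g t) has_vector_derivative (vderiv (Suc j) h t - vderiv (Suc j) g t)) (at t)"
    using Suc.prems assms by (intro has_vector_derivative_diff Cr_space_has_derivative) auto
  then have "(vderiv j (\<lambda>t. h t - g t) has_vector_derivative (vderiv (Suc j) h t - vderiv (Suc j) g t)) (at t)"
    by (rule has_vector_derivative_transform_within_open[OF _ assms(1) Suc.prems(2)]) (use Suc in simp)
  then show ?case unfolding vderiv_Suc[of j "\<lambda>t. h t - g t"] by (rule vector_derivative_at)
qed

text \<open>
  A supremum of an unbounded set of reals has an unspecified value. So each of the summands of the norm, including the Hoelder term, has to be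
  shown to be a supremum of a bounded set before it can be known to be nonnegative.
\<close>

lemma Cr_norm_controls:
  assumes J: "open J" "{a..b} \<subseteq> J" "a < b" and g: "g \<in> Cr_space r J S" and h: "h \<in> Cr_space r J S"
    and j: "j \<le> nat \<lfloor>r\<rfloor>" and t: "t \<in> {a..b}"
  shows "norm (vderiv j h t - vderiv j g t) \<le> Cr_norm r a b (\<lambda>t. h t - g t)"
proof -
  let ?d = "\<lambda>t. h t - g t"
  define T where "T i = (SUP t\<in>{a..b}. norm (vderiv i ?d t))" for i
  have bdd: "bdd_above ((\<lambda>t. norm (vderiv i ?d t)) ` {a..b})" if "i \<le> nat \<lfloor>r\<rfloor>" for i
  proof -
    have "continuous_on {a..b} (\<lambda>t. norm (vderiv i h t - vderiv i g t))"
      using Cr_space_continuous[OF g that] Cr_space_continuous[OF h that] J(2)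
      by (intro continuous_intros) (auto intro: continuous_on_subset)
    then have "continuous_on {a..b} (\<lambda>t. norm (vderiv i ?d t))"
      by (rule continuous_on_eq) (use vderiv_diff[OF J(1) g h that] J(2) in auto)
    then show ?thesis by (intro bounded_imp_bdd_above compact_imp_bounded compact_continuous_image) auto
  qed
  have up: "norm (vderiv i ?d u) \<le> T i" if "i \<le> nat \<lfloor>r\<rfloor>" "u \<in> {a..b}" for i u
    unfolding T_def by (rule cSUP_upper[OF that(2) bdd[OF that(1)]])
  have T0: "0 \<le> T i" if "i \<le> nat \<lfloor>r\<rfloor>" for i
    using up[OF that t] norm_ge_zero order_trans by blast
  define H where "H u = holder_quotients (frac r) a b u" for u :: "real \<Rightarrow> 'a"
  have "0 \<le> Sup (H (vderiv (nat \<lfloor>r\<rfloor>) ?d))"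
  proof -
    define k where "k = nat \<lfloor>r\<rfloor>"
    have vd: "vderiv k ?d u = vderiv k h u - vderiv k g u" if "u \<in> {a..b}" for u
      using vderiv_diff[OF J(1) g h, of k u] that J(2) by (auto simp: k_def)
    have mem: "norm (vderiv k ?d a - vderiv k ?d b) / \<bar>a - b\<bar> powr frac r \<in> H (vderiv k ?d)"
      unfolding H_def holder_quotients_def using J(3) by (intro CollectI exI[of _ a] exI[of _ b]) auto
    have "bdd_above (H (vderiv k u))" if "u \<in> Cr_space r J S" for u
      using that J(2) by (simp add: Cr_space_def H_def k_def)
    from this[OF h] this[OF g] obtain Bh Bg
      where B: "\<And>z. z \<in> H (vderiv k h) \<Longrightarrow> z \<le> Bh" "\<And>z. z \<in> H (vderiv k g) \<Longrightarrow> z \<le> Bg"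
      unfolding bdd_above_def by metis
    have "z \<le> Bh + Bg" if "z \<in> H (vderiv k ?d)" for z
    proof -
      obtain u v where uv: "u \<in> {a..b}" "v \<in> {a..b}" "u \<noteq> v" "z = norm (vderiv k ?d u - vderiv k ?d v) / \<bar>u - v\<bar> powr frac r"
        using \<open>z \<in> H _\<close> unfolding H_def holder_quotients_def by blast
      have "norm (vderiv k ?d u - vderiv k ?d v) \<le> norm (vderiv k h u - vderiv k h v) + norm (vderiv k g u - vderiv k g v)"
        unfolding vd[OF uv(1)] vd[OF uv(2)]
        using norm_triangle_ineq4[of "vderiv k h u - vderiv k h v" "vderiv k g u - vderiv k g v"]
        by (simp add: algebra_simps)
      then have "z \<le> (norm (vderiv k h u - vderiv k h v) + norm (vderiv k g u - vderiv k g v)) / \<bar>u - v\<bar> powr frac r"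
        unfolding uv(4) by (rule divide_right_mono) simp
      also have "\<dots> \<le> Bh + Bg"
        unfolding add_divide_distrib using uv
        by (intro add_mono B) (auto simp: H_def holder_quotients_def)
      finally show ?thesis .
    qed
    then have "bdd_above (H (vderiv k ?d))" by (meson bdd_above.I)
    from cSup_upper[OF mem this] show ?thesis unfolding k_def by (rule order_trans[rotated]) simp
  qed
  moreover have "norm (vderiv j ?d t) \<le> (\<Sum>i\<le>nat \<lfloor>r\<rfloor>. T i)"
    using up[OF j t] member_le_sum[of j "{..nat \<lfloor>r\<rfloor>}" T] T0 j by fastforce
  ultimately show ?thesis
    using vderiv_diff[OF J(1) g h j, of t] t J(2) unfolding Cr_norm_def T_def H_def by fastforce
qed

lemma Cr_norm_zero:
  assumes "a < b"
  shows "Cr_norm r a b (\<lambda>t. 0 :: 'b::real_normed_vector) = 0"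
proof -
  have v: "vderiv j (\<lambda>t. 0 :: 'b) = (\<lambda>t. 0)" for j
  proof (induction j)
    case (Suc j)
    show ?case by (rule ext) (simp add: vderiv_Suc Suc)
  qed simp
  have "holder_quotients (frac r) a b (\<lambda>t. 0 :: 'b) = {0}"
  proof
    show "holder_quotients (frac r) a b (\<lambda>t. 0 :: 'b) \<subseteq> {0}" by (auto simp: holder_quotients_def)
    have "0 \<in> holder_quotients (frac r) a b (\<lambda>t. 0 :: 'b)"
      unfolding holder_quotients_def using assms by (intro CollectI exI[of _ a] exI[of _ b]) auto
    then show "{0} \<subseteq> holder_quotients (frac r) a b (\<lambda>t. 0 :: 'b)" by simp
  qed
  then show ?thesis unfolding Cr_norm_def v using assms by simp
qed

text \<open>
  Finitely many unit balls centred in \<open>K\<close> cover it.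
\<close>

lemma compactin_Cr_bounded:
  fixes K :: "(real \<Rightarrow> 'b::real_normed_vector) set"
  assumes K: "compactin (Cr_topology r J S) K" and J: "open J" "{a..b} \<subseteq> J" "a < b"
  shows "K \<subseteq> Cr_space r J S"
    and "j \<le> nat \<lfloor>r\<rfloor> \<Longrightarrow> \<exists>B. \<forall>h\<in>K. \<forall>t\<in>{a..b}. norm (vderiv j h t) \<le> B"
proof -
  define V where "V g = {h \<in> Cr_space r J S. Cr_norm r a b (\<lambda>t. h t - g t) < 1}" for g
  define Basis0 where "Basis0 = {{h \<in> Cr_space r J S. Cr_norm r a b (\<lambda>t. h t - g t) < e} | a b g e.
        a < b \<and> {a..b} \<subseteq> J \<and> g \<in> Cr_space r J S \<and> 0 < e}"
  have top: "Cr_topology r J S = topology_generated_by Basis0"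
    unfolding Cr_topology_def Basis0_def ..
  have "K \<subseteq> topspace (Cr_topology r J S)" using K by (rule compactin_subset_topspace)
  also have "\<dots> \<subseteq> Cr_space r J S" unfolding top topology_generated_by_topspace Basis0_def by blast
  finally show sub: "K \<subseteq> Cr_space r J S" .
  assume j: "j \<le> nat \<lfloor>r\<rfloor>"
  have op: "openin (Cr_topology r J S) (V g)" if "g \<in> K" for g
    unfolding top
  proof (rule topology_generated_by_Basis)
    show "V g \<in> Basis0" unfolding Basis0_def V_def using J that sub
      by (intro CollectI exI[of _ a] exI[of _ b] exI[of _ g] exI[of _ 1]) auto
  qed
  have self: "g \<in> V g" if "g \<in> K" for g
    using that sub Cr_norm_zero[OF J(3), of r, where ?'b = 'b] by (auto simp: V_def)
  obtain \<F> where F: "finite \<F>" "\<F> \<subseteq> V ` K" "K \<subseteq> \<Union>\<F>"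
    using compactinD[OF K, of "V ` K"] op self by blast
  obtain G where G: "G \<subseteq> K" "finite G" "\<F> = V ` G" using finite_subset_image[OF F(1,2)] by blast
  have "\<exists>b0. \<forall>t\<in>{a..b}. norm (vderiv j g t) \<le> b0" if "g \<in> K" for g
  proof -
    have "continuous_on {a..b} (vderiv j g)"
      using Cr_space_continuous[OF _ j] that sub J(2) continuous_on_subset by blast
    then have "bounded (vderiv j g ` {a..b})" by (intro compact_imp_bounded compact_continuous_image) auto
    then show ?thesis by (auto simp: bounded_iff)
  qed
  then obtain b0 where b0: "\<And>g t. g \<in> K \<Longrightarrow> t \<in> {a..b} \<Longrightarrow> norm (vderiv j g t) \<le> b0 g" by metis
  have "norm (vderiv j h t) \<le> 1 + (\<Sum>g\<in>G. \<bar>b0 g\<bar>)" if hK: "h \<in> K" and tab: "t \<in> {a..b}" for h t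
  proof -
    obtain g where g: "g \<in> G" "h \<in> V g" using F(3) G(3) hK by blast
    have "norm (vderiv j h t - vderiv j g t) \<le> Cr_norm r a b (\<lambda>t. h t - g t)"
      using g G sub hK tab by (intro Cr_norm_controls[OF J _ _ j]) auto
    then have "norm (vderiv j h t - vderiv j g t) \<le> 1" using g by (simp add: V_def)
    moreover have "norm (vderiv j g t) \<le> b0 g" using b0 g G tab by blast
    moreover have "\<bar>b0 g\<bar> \<le> (\<Sum>g\<in>G. \<bar>b0 g\<bar>)" using G g by (intro member_le_sum) auto
    ultimately show ?thesis using norm_triangle_sub[of "vderiv j h t" "vderiv j g t"] by linarith
  qed
  then show "\<exists>B. \<forall>h\<in>K. \<forall>t\<in>{a..b}. norm (vderiv j h t) \<le> B" by blast
qed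

lemma has_vector_derivative_bound:
  fixes g :: "real \<Rightarrow> 'b::euclidean_space"
  assumes "\<And>t. t \<in> {a..b} \<Longrightarrow> (g has_vector_derivative g' t) (at t)" "\<And>t. t \<in> {a..b} \<Longrightarrow> norm (g' t) \<le> B"
    and "s \<in> {a..b}" "t \<in> {a..b}"
  shows "norm (g s - g t) \<le> B * \<bar>s - t\<bar>"
proof -
  have "norm (g v - g u) \<le> B * (v - u)" if uv: "u \<in> {a..b}" "v \<in> {a..b}" "u < v" for u v
  proof -
    have "\<exists>x\<in>{u<..<v}. norm (g v - g u) \<le> norm ((v - u) *\<^sub>R g' x)"
    proof (rule mvt_general[OF uv(3)])
      show "continuous_on {u..v} g"
        by (intro continuous_at_imp_continuous_on ballI)
           (rule has_vector_derivative_continuous[OF assms(1)], use uv in auto)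
      show "(g has_derivative (\<lambda>h. h *\<^sub>R g' x)) (at x)" if "u < x" "x < v" for x
        using assms(1)[of x] uv that by (auto simp: has_vector_derivative_def)
    qed
    then obtain x where x: "x \<in> {u<..<v}" "norm (g v - g u) \<le> norm ((v - u) *\<^sub>R g' x)" by blast
    have "norm ((v - u) *\<^sub>R g' x) = (v - u) * norm (g' x)" using uv by simp
    also have "\<dots> \<le> (v - u) * B" using assms(2)[of x] x uv by (intro mult_left_mono) auto
    finally have "norm ((v - u) *\<^sub>R g' x) \<le> B * (v - u)" by (simp only: mult.commute)
    then show ?thesis using x(2) by linarith
  qed
  from this[of s t] this[of t s] assms(3,4) show ?thesis
    by (cases s t rule: linorder_cases) (auto simp: norm_minus_commute)
qed

lemma jointly_continuous:
  fixes u :: "real \<Rightarrow> 'a::metric_space \<Rightarrow> 'b::real_normed_vector"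
  assumes cont: "\<And>t. t \<in> I \<Longrightarrow> continuous_on UNIV (u t)"
    and lip: "\<And>s t x. s \<in> I \<Longrightarrow> t \<in> I \<Longrightarrow> norm (u s x - u t x) \<le> B * \<bar>s - t\<bar>"
  shows "continuous_on (I \<times> UNIV) (\<lambda>p. u (fst p) (snd p))"
proof (clarsimp simp: continuous_on_def)
  fix t :: real and x :: 'a assume t: "t \<in> I"
  have 1: "((\<lambda>p. B * \<bar>fst p - t\<bar>) \<longlongrightarrow> B * \<bar>fst (t, x) - t\<bar>) (at (t, x) within I \<times> UNIV)"
    by (intro tendsto_intros)
  have "((\<lambda>p. u (fst p) (snd p) - u t (snd p)) \<longlongrightarrow> 0) (at (t, x) within I \<times> UNIV)"
  proof (rule Lim_null_comparison)
    show "((\<lambda>p. B * \<bar>fst p - t\<bar>) \<longlongrightarrow> 0) (at (t, x) within I \<times> UNIV)" using 1 by simp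
    show "\<forall>\<^sub>F p in at (t, x) within I \<times> UNIV. norm (u (fst p) (snd p) - u t (snd p)) \<le> B * \<bar>fst p - t\<bar>"
      unfolding eventually_at_filter using lip[OF _ t] by (auto intro!: always_eventually)
  qed
  moreover have "((\<lambda>p. u t (snd p)) \<longlongrightarrow> u t x) (at (t, x) within I \<times> UNIV)"
  proof -
    have "isCont (u t) x" using cont[OF t] by (simp add: continuous_on_eq_continuous_at)
    moreover have "((\<lambda>p. snd p) \<longlongrightarrow> snd (t, x)) (at (t, x) within I \<times> UNIV)" by (intro tendsto_intros)
    ultimately show ?thesis by (simp add: isCont_tendsto_compose)
  qed
  ultimately have "((\<lambda>p. (u (fst p) (snd p) - u t (snd p)) + u t (snd p)) \<longlongrightarrow> 0 + u t x) (at (t, x) within I \<times> UNIV)"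
    by (rule tendsto_add)
  then show "((\<lambda>p. u (fst p) (snd p)) \<longlongrightarrow> u t x) (at (t, x) within I \<times> UNIV)" by simp
qed

text \<open>
  The derivative is a limit of difference quotients, which are continuous in the base variable. The limit is uniform because the derivative
  is uniformly Lipschitz in the parameter.
\<close>

lemma derivative_continuous_in_parameter:
  fixes u u' :: "real \<Rightarrow> 'a::metric_space \<Rightarrow> 'b::euclidean_space"
  assumes der: "\<And>t x. t \<in> {a..b} \<Longrightarrow> ((\<lambda>t. u t x) has_vector_derivative u' t x) (at t)"
    and lip: "\<And>s t x. s \<in> {a..b} \<Longrightarrow> t \<in> {a..b} \<Longrightarrow> norm (u' s x - u' t x) \<le> B * \<bar>s - t\<bar>"
    and cont: "\<And>t. t \<in> {a..b} \<Longrightarrow> continuous_on UNIV (u t)"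
    and t: "a < t" "t < b"
  shows "continuous_on UNIV (u' t)"
proof -
  define h where "h k = (b - t) / real (Suc k)" for k
  have h: "0 < h k" "t + h k \<in> {a..b}" for k
  proof -
    show "0 < h k" using t by (simp add: h_def)
    have "(b - t) / real (Suc k) \<le> (b - t) / 1" using t by (intro divide_left_mono) auto
    then have "h k \<le> b - t" by (simp add: h_def)
    then show "t + h k \<in> {a..b}" using \<open>0 < h k\<close> t by simp
  qed
  have h0: "h \<longlonglongrightarrow> 0" unfolding h_def by (rule LIMSEQ_Suc[OF lim_const_over_n])
  have B0: "0 \<le> B" 
  proof -
    have "norm (u' a undefined - u' b undefined) \<le> B * \<bar>a - b\<bar>" using t by (intro lip) auto
    then have "0 \<le> B * \<bar>a - b\<bar>" by (meson norm_ge_zero order_trans)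
    then show ?thesis using t by (simp add: zero_le_mult_iff)
  qed
  have est: "norm ((1 / h k) *\<^sub>R (u (t + h k) x - u t x) - u' t x) \<le> B * h k" for k x
  proof -
    define g where "g s = u s x - s *\<^sub>R u' t x" for s
    have "norm (g (t + h k) - g t) \<le> (B * h k) * \<bar>(t + h k) - t\<bar>"
    proof (rule has_vector_derivative_bound[where a = t and b = "t + h k" and g' = "\<lambda>s. u' s x - u' t x"])
      fix s assume s: "s \<in> {t..t + h k}"
      then have s': "s \<in> {a..b}" using h(2)[of k] t by auto
      show "(g has_vector_derivative (u' s x - u' t x)) (at s)"
        unfolding g_def by (auto intro!: derivative_eq_intros der[OF s'])
      have "norm (u' s x - u' t x) \<le> B * \<bar>s - t\<bar>" using s' t by (intro lip) auto
      also have "\<dots> \<le> B * h k" using s B0 by (intro mult_left_mono) auto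
      finally show "norm (u' s x - u' t x) \<le> B * h k" .
    qed (use h(1)[of k] in auto)
    then have "norm (u (t + h k) x - u t x - h k *\<^sub>R u' t x) \<le> (B * h k) * h k"
      using h(1)[of k] by (simp add: g_def algebra_simps)
    then have "(1 / h k) * norm (u (t + h k) x - u t x - h k *\<^sub>R u' t x) \<le> (1 / h k) * ((B * h k) * h k)"
      using h(1)[of k] by (intro mult_left_mono) auto
    moreover have "(1 / h k) * norm (u (t + h k) x - u t x - h k *\<^sub>R u' t x) 
       = norm ((1 / h k) *\<^sub>R (u (t + h k) x - u t x - h k *\<^sub>R u' t x))"
      using h(1)[of k] by simp
    moreover have "(1 / h k) *\<^sub>R (u (t + h k) x - u t x - h k *\<^sub>R u' t x) = (1 / h k) *\<^sub>R (u (t + h k) x - u t x) - u' t x"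
      using h(1)[of k] by (simp add: scaleR_diff_right)
    ultimately show ?thesis using h(1)[of k] by simp
  qed
  have "uniform_limit UNIV (\<lambda>k x. (1 / h k) *\<^sub>R (u (t + h k) x - u t x)) (u' t) sequentially"
  proof (rule uniform_limitI)
    fix e :: real assume "0 < e"
    have "(\<lambda>k. B * h k) \<longlonglongrightarrow> B * 0" by (intro tendsto_intros h0)
    then have "\<forall>\<^sub>F k in sequentially. B * h k < e" using \<open>0 < e\<close> by (simp add: order_tendsto_iff)
    then show "\<forall>\<^sub>F k in sequentially. \<forall>x\<in>UNIV. dist ((1 / h k) *\<^sub>R (u (t + h k) x - u t x)) (u' t x) < e"
      by eventually_elim (use est le_less_trans in \<open>fastforce simp: dist_norm\<close>)
  qed
  then show ?thesis
    by (rule uniform_limit_theorem[rotated])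
       (use h t in \<open>auto intro!: always_eventually continuous_intros cont\<close>)
qed

text \<open>
  A continuous argument of \<open>t \<mapsto> A t x u\<close> exists on the whole interval by lifting through the exponential. Differentiating the
  relation between the vector and its argument shows that the wedge product of \<open>A u\<close> and \<open>A' u\<close> is the square of the norm times the
  derivative of the argument.
\<close>

lemma monotonic_imp_qform_pos:
  fixes A A1 :: "real \<Rightarrow> 'a \<Rightarrow> real^2^2"
  assumes mono: "monotonic_family J A" and J: "open J" "is_interval J"
    and det: "\<And>\<theta>. \<theta> \<in> J \<Longrightarrow> det (A \<theta> x) = 1"
    and der: "\<And>\<theta> i j. \<theta> \<in> J \<Longrightarrow> ((\<lambda>\<theta>. A \<theta> x $ i $ j) has_real_derivative A1 \<theta> x $ i $ j) (at \<theta>)"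
    and \<theta>: "\<theta> \<in> J" and yz: "(y, z) \<noteq> (0, 0)"
  shows "0 < qform (A \<theta> x) (A1 \<theta> x) y z"
proof -
  define v1 v2 where "v1 t = A t x$1$1 * y + A t x$1$2 * z" and "v2 t = A t x$2$1 * y + A t x$2$2 * z" for t
  define w1 w2 where "w1 t = A1 t x$1$1 * y + A1 t x$1$2 * z" and "w2 t = A1 t x$2$1 * y + A1 t x$2$2 * z" for t
  have d1: "(v1 has_real_derivative w1 t) (at t)" and d2: "(v2 has_real_derivative w2 t) (at t)" if "t \<in> J" for t
    unfolding v1_def v2_def w1_def w2_def using der[OF that] by (auto intro!: derivative_eq_intros)
  have nz: "Complex (v1 t) (v2 t) \<noteq> 0" if "t \<in> J" for t
  proof
    assume "Complex (v1 t) (v2 t) = 0"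
    then have v: "v1 t = 0" "v2 t = 0" by (auto simp: complex_eq_iff)
    have "(A t x$1$1 * A t x$2$2 - A t x$1$2 * A t x$2$1) * y = A t x$2$2 * v1 t - A t x$1$2 * v2 t"
      "(A t x$1$1 * A t x$2$2 - A t x$1$2 * A t x$2$1) * z = A t x$1$1 * v2 t - A t x$2$1 * v1 t"
      by (simp_all add: v1_def v2_def algebra_simps)
    then show False using v yz det[OF that] by (simp add: det_2)
  qed
  have cont: "continuous_on J (\<lambda>t. Complex (v1 t) (v2 t))"
    using d1 d2 by (intro continuous_on_Complex continuous_at_imp_continuous_on ballI) (auto intro: DERIV_isCont)
  obtain g where g: "continuous_on J g" "\<And>t. t \<in> J \<Longrightarrow> Complex (v1 t) (v2 t) = exp (g t)"
    using continuous_logarithm_on_contractible[OF cont convex_imp_contractible nz] J(2) by (auto simp: is_interval_convex_1)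
  define \<phi> where "\<phi> t = Im (g t)" for t
  define n where "n t = exp (Re (g t))" for t
  have v: "v1 t = n t * cos (\<phi> t)" "v2 t = n t * sin (\<phi> t)" if "t \<in> J" for t
    using g(2)[OF that] by (auto simp: complex_eq_iff Re_exp Im_exp n_def \<phi>_def)
  define p :: "real^2" where "p = vector [y, z]"
  have "p \<noteq> 0" using yz by (auto simp: p_def vec_eq_iff forall_2)
  have Ap: "A t x *v p = vector [v1 t, v2 t]" for t
    by (simp add: vec_eq_iff forall_2 p_def matrix_vector_mult_def sum_2 v1_def v2_def)
  have "argument_determination J (\<lambda>t. A t x *v p) \<phi>"
    unfolding argument_determination_def
  proof (intro conjI ballI)
    show "continuous_on J \<phi>" unfolding \<phi>_def by (intro continuous_intros g)
    fix t assume t: "t \<in> J"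
    have "(norm (A t x *v p))\<^sup>2 = (n t)\<^sup>2 * ((cos (\<phi> t))\<^sup>2 + (sin (\<phi> t))\<^sup>2)"
      unfolding Ap norm_vec2 by (simp only: vector_2 v[OF t] power_mult_distrib distrib_left)
    then have "norm (A t x *v p) = n t" by (simp add: n_def power2_eq_iff_nonneg)
    then show "A t x *v p = norm (A t x *v p) *\<^sub>R vector [cos (\<phi> t), sin (\<phi> t)]"
      unfolding Ap by (simp add: vec_eq_iff forall_2 v[OF t])
  qed
  with mono \<open>p \<noteq> 0\<close> \<theta> obtain d where d: "0 < d" "(\<phi> has_real_derivative d) (at \<theta>)"
    unfolding monotonic_family_def by blast
  have "((\<lambda>t. v1 t * sin (\<phi> t) - v2 t * cos (\<phi> t)) has_real_derivative
      (w1 \<theta> * sin (\<phi> \<theta>) + v1 \<theta> * (cos (\<phi> \<theta>) * d)) - (w2 \<theta> * cos (\<phi> \<theta>) - v2 \<theta> * (sin (\<phi> \<theta>) * d))) (at \<theta>)"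
    by (auto intro!: derivative_eq_intros d1[OF \<theta>] d2[OF \<theta>] d(2))
  moreover have "((\<lambda>t. v1 t * sin (\<phi> t) - v2 t * cos (\<phi> t)) has_real_derivative 0) (at \<theta>)"
    by (rule has_field_derivative_transform_within_open[OF DERIV_const J(1) \<theta>, of 0]) (simp add: v)
  ultimately have "(w1 \<theta> * sin (\<phi> \<theta>) + v1 \<theta> * (cos (\<phi> \<theta>) * d)) - (w2 \<theta> * cos (\<phi> \<theta>) - v2 \<theta> * (sin (\<phi> \<theta>) * d)) = 0"
    by (rule DERIV_unique)
  then have "n \<theta> * d * ((cos (\<phi> \<theta>))\<^sup>2 + (sin (\<phi> \<theta>))\<^sup>2) = w2 \<theta> * cos (\<phi> \<theta>) - w1 \<theta> * sin (\<phi> \<theta>)"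
    unfolding v[OF \<theta>] by algebra
  then have nd: "n \<theta> * d = w2 \<theta> * cos (\<phi> \<theta>) - w1 \<theta> * sin (\<phi> \<theta>)" by simp
  have "n \<theta> * (n \<theta> * d) = v1 \<theta> * w2 \<theta> - v2 \<theta> * w1 \<theta>"
    unfolding nd v[OF \<theta>] by (simp add: algebra_simps)
  moreover have "0 < n \<theta> * (n \<theta> * d)" using d(1) by (simp add: n_def)
  ultimately show ?thesis by (simp add: qform_def v1_def v2_def w1_def w2_def)
qed

lemma qform_polar: "qform P Q (r * y) (r * z) = r\<^sup>2 * qform P Q y z"
  by (simp add: qform_def power2_eq_square algebra_simps)

text \<open>
  A slightly larger interval \<open>{a..b}\<close> is kept inside \<open>J\<close> so that difference quotients at points of \<open>{\<alpha>..\<beta>}\<close> are defined.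
  The constant \<open>\<kappa>\<close> is the minimum of a positive continuous function on the compact product of the parameter interval, the base and the
  circle of directions.
\<close>

lemma family_on_compact_interval:
  fixes f :: "'a::metric_space \<Rightarrow> 'a" and M :: "'a measure" and A :: "real \<Rightarrow> 'a \<Rightarrow> real^2^2"
  assumes X: "compact (UNIV :: 'a set)" and f: "continuous_on UNIV f"
    and M: "prob_space M" "sets M = sets borel" "distr M M f = M" and e: "0 < \<epsilon>"
    and J: "open J" "is_interval J"
    and cont: "\<And>\<theta>. \<theta> \<in> J \<Longrightarrow> continuous_on UNIV (A \<theta>)" and SL2: "\<And>\<theta> x. \<theta> \<in> J \<Longrightarrow> A \<theta> x \<in> SL2"
    and mono: "monotonic_family J A" and Cr: "Cr_family (2 + \<epsilon>) J A"
    and ab: "a < \<alpha>" "\<alpha> < \<beta>" "\<beta> < b" "{a..b} \<subseteq> J"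
  shows "\<exists>A1 A2 \<kappa> C. twisting_cocycle f A A1 A2 \<alpha> \<beta> \<kappa> C M"
proof -
  define r where "r = 2 + \<epsilon>"
  have k: "2 \<le> nat \<lfloor>r\<rfloor>" using e by (simp add: r_def le_nat_iff le_floor_iff)
  then have k01: "0 < nat \<lfloor>r\<rfloor>" "1 < nat \<lfloor>r\<rfloor>" by linarith+
  obtain K where K: "compactin (Cr_topology r J SL2) K" and mem: "\<And>x. restrict (\<lambda>\<theta>. A \<theta> x) J \<in> K"
    using Cr unfolding Cr_family_def r_def by blast
  define G where "G x = restrict (\<lambda>\<theta>. A \<theta> x) J" for x
  have a_b: "a < b" using ab by linarith
  note bounded = compactin_Cr_bounded[OF K J(1) ab(4) a_b]
  have G: "G x \<in> Cr_space r J SL2" for x using bounded(1) mem by (auto simp: G_def)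
  define A1 where "A1 \<theta> x = vderiv 1 (G x) \<theta>" for \<theta> x
  define A2 where "A2 \<theta> x = vderiv 2 (G x) \<theta>" for \<theta> x
  have der1: "((\<lambda>\<theta>. A \<theta> x) has_vector_derivative A1 \<theta> x) (at \<theta>)" if "\<theta> \<in> J" for \<theta> x
  proof -
    have "(G x has_vector_derivative A1 \<theta> x) (at \<theta>)"
      using Cr_space_has_derivative[OF G[of x] k01(1) that] by (simp add: A1_def)
    then show ?thesis
      by (rule has_vector_derivative_transform_within_open[OF _ J(1) that]) (simp add: G_def)
  qed
  have der2: "((\<lambda>\<theta>. A1 \<theta> x) has_vector_derivative A2 \<theta> x) (at \<theta>)" if "\<theta> \<in> J" for \<theta> x
    using Cr_space_has_derivative[OF G[of x] k01(2) that] by (simp add: A1_def[abs_def] A2_def numeral_2_eq_2)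
  have comp: "((\<lambda>\<theta>. u \<theta> $ i $ j) has_real_derivative u' $ i $ j) (at \<theta>)"
    if "(u has_vector_derivative u') (at \<theta>)" for u :: "real \<Rightarrow> real^2^2" and u' \<theta> i j
    unfolding has_real_derivative_iff_has_vector_derivative
    by (intro bounded_linear.has_vector_derivative[OF bounded_linear_vec_nth] that)
  obtain B0 B1 B2 where B: "\<And>x t. t \<in> {a..b} \<Longrightarrow> norm (A t x) \<le> B0" "\<And>x t. t \<in> {a..b} \<Longrightarrow> norm (A1 t x) \<le> B1"
    "\<And>x t. t \<in> {a..b} \<Longrightarrow> norm (A2 t x) \<le> B2"
  proof -
    have k': "0 \<le> nat \<lfloor>r\<rfloor>" "1 \<le> nat \<lfloor>r\<rfloor>" using k by auto
    obtain B0 where B0: "\<forall>h\<in>K. \<forall>t\<in>{a..b}. norm (vderiv 0 h t) \<le> B0" using bounded(2)[OF k'(1)] by blast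
    obtain B1 where B1: "\<forall>h\<in>K. \<forall>t\<in>{a..b}. norm (vderiv 1 h t) \<le> B1" using bounded(2)[OF k'(2)] by blast
    obtain B2 where B2: "\<forall>h\<in>K. \<forall>t\<in>{a..b}. norm (vderiv 2 h t) \<le> B2" using bounded(2)[OF k] by blast
    have "norm (A t x) \<le> B0" if "t \<in> {a..b}" for t x
      using B0[rule_format, OF mem[of x] that] that ab(4) by (auto simp: subset_iff)
    then show thesis using that[of B0 B1 B2] B1 B2 mem unfolding A1_def A2_def G_def by blast
  qed
  have lip0: "norm (A s x - A t x) \<le> B1 * \<bar>s - t\<bar>" and lip1: "norm (A1 s x - A1 t x) \<le> B2 * \<bar>s - t\<bar>"
    if "s \<in> {a..b}" "t \<in> {a..b}" for s t x
    using der1 der2 B ab(4) that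
    by (auto intro!: has_vector_derivative_bound[of a b "\<lambda>t. A t x" "\<lambda>t. A1 t x"]
        has_vector_derivative_bound[of a b "\<lambda>t. A1 t x" "\<lambda>t. A2 t x"])
  have cont1: "continuous_on UNIV (A1 \<theta>)" if "\<theta> \<in> {\<alpha>..\<beta>}" for \<theta>
    by (rule derivative_continuous_in_parameter[where a = a and b = b and u = A and B = B2])
       (use der1 lip1 cont ab that in auto)
  have sub: "{\<alpha>..\<beta>} \<subseteq> {a..b}" using ab by auto
  have inJ: "\<theta> \<in> J" if "\<theta> \<in> {\<alpha>..\<beta>}" for \<theta> using that sub ab(4) by blast
  have jA: "continuous_on ({\<alpha>..\<beta>} \<times> UNIV) (\<lambda>p. A (fst p) (snd p))"
    by (rule jointly_continuous[where B = B1]) (use cont[OF inJ] lip0 sub in auto)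
  have jA1: "continuous_on ({\<alpha>..\<beta>} \<times> UNIV) (\<lambda>p. A1 (fst p) (snd p))"
    by (rule jointly_continuous[where B = B2]) (use cont1 lip1 sub in auto)
  have det: "det (A \<theta> x) = 1" if "\<theta> \<in> J" for \<theta> x using SL2[OF that, of x] by (simp add: SL2_def)
  define S where "S = {\<alpha>..\<beta>} \<times> (UNIV :: 'a set) \<times> {0..2 * pi}"
  define q where "q p = qform (A (fst p) (fst (snd p))) (A1 (fst p) (fst (snd p))) (cos (snd (snd p))) (sin (snd (snd p)))" for p
  have "compact S" unfolding S_def by (intro compact_Times X compact_Icc)
  moreover have "S \<noteq> {}" using ab by (auto simp: S_def)
  moreover have "continuous_on S q"
  proof -
    have m: "continuous_on S (\<lambda>p. (fst p, fst (snd p)))" by (intro continuous_intros)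
    have im: "(\<lambda>p. (fst p, fst (snd p))) ` S \<subseteq> {\<alpha>..\<beta>} \<times> UNIV" by (auto simp: S_def)
    have "continuous_on S (\<lambda>p. A (fst p) (fst (snd p)))" "continuous_on S (\<lambda>p. A1 (fst p) (fst (snd p)))"
      using continuous_on_compose2[OF jA m im] continuous_on_compose2[OF jA1 m im] by simp_all
    then show ?thesis unfolding q_def qform_def by (intro continuous_intros)
  qed
  ultimately have "\<exists>p0\<in>S. \<forall>p\<in>S. q p0 \<le> q p" by (rule continuous_attains_inf)
  then obtain p0 where p0: "p0 \<in> S" "\<And>p. p \<in> S \<Longrightarrow> q p0 \<le> q p" by blast
  have pos: "0 < qform (A \<theta> x) (A1 \<theta> x) y z" if "\<theta> \<in> J" "(y, z) \<noteq> (0, 0)" for \<theta> x y z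
    by (rule monotonic_imp_qform_pos[OF mono J det comp[OF der1] that])
  have "0 < q p0"
  proof -
    have "(cos (snd (snd p0)), sin (snd (snd p0))) \<noteq> (0, 0)"
      by (auto dest: sin_zero_norm_cos_one)
    then show ?thesis unfolding q_def using p0(1) sub ab(4) by (intro pos) (auto simp: S_def)
  qed
  define \<kappa> where "\<kappa> = min 1 (q p0)"
  define C where "C = 1 + B0\<^sup>2 + B1\<^sup>2 + B2\<^sup>2"
  have kq: "\<kappa> * (y\<^sup>2 + z\<^sup>2) \<le> qform (A \<theta> x) (A1 \<theta> x) y z" if th: "\<theta> \<in> {\<alpha>..\<beta>}" for \<theta> x y z
  proof (cases "(y, z) = (0, 0)")
    case True then show ?thesis by (simp add: qform_def)
  next
    case False
    define \<rho> where "\<rho> = sqrt (y\<^sup>2 + z\<^sup>2)"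
    have rho: "0 < \<rho>" "\<rho>\<^sup>2 = y\<^sup>2 + z\<^sup>2" using False by (auto simp: \<rho>_def sum_power2_gt_zero_iff)
    have "(y / \<rho>)\<^sup>2 + (z / \<rho>)\<^sup>2 = 1" 
      unfolding power_divide add_divide_distrib[symmetric] rho(2)[symmetric] using rho(1) by simp
    then obtain t where t: "0 \<le> t" "t < 2 * pi" "y / \<rho> = cos t" "z / \<rho> = sin t" using sincos_total_2pi by metis
    have yz: "y = \<rho> * cos t" "z = \<rho> * sin t" using t(3,4) rho(1) by (auto simp: field_simps)
    have "q p0 \<le> q (\<theta>, x, t)" by (rule p0(2)) (use th t in \<open>auto simp: S_def\<close>)
    then have "\<kappa> \<le> qform (A \<theta> x) (A1 \<theta> x) (cos t) (sin t)" by (simp add: \<kappa>_def q_def)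
    then have "\<rho>\<^sup>2 * \<kappa> \<le> \<rho>\<^sup>2 * qform (A \<theta> x) (A1 \<theta> x) (cos t) (sin t)" by (rule mult_left_mono) simp
    then show ?thesis using qform_polar[of "A \<theta> x" "A1 \<theta> x" \<rho> "cos t" "sin t"] yz rho(2) by (simp add: mult.commute)
  qed
  have trace: "A \<theta> x$1$1 * A1 \<theta> x$2$2 + A \<theta> x$2$2 * A1 \<theta> x$1$1 - A \<theta> x$1$2 * A1 \<theta> x$2$1 - A \<theta> x$2$1 * A1 \<theta> x$1$2 = 0"
    if th: "\<theta> \<in> J" for \<theta> x
  proof -
    note d = comp[OF der1[OF th, of x]]
    have "((\<lambda>\<theta>. A \<theta> x$1$1 * A \<theta> x$2$2 - A \<theta> x$1$2 * A \<theta> x$2$1) has_real_derivative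
       (A1 \<theta> x$1$1 * A \<theta> x$2$2 + A1 \<theta> x$2$2 * A \<theta> x$1$1) - (A1 \<theta> x$1$2 * A \<theta> x$2$1 + A1 \<theta> x$2$1 * A \<theta> x$1$2)) (at \<theta>)"
      by (intro DERIV_diff DERIV_mult d)
    moreover have "((\<lambda>\<theta>. A \<theta> x$1$1 * A \<theta> x$2$2 - A \<theta> x$1$2 * A \<theta> x$2$1) has_real_derivative 0) (at \<theta>)"
      by (rule has_field_derivative_transform_within_open[OF DERIV_const J(1) th, of 1]) (use det in \<open>simp add: det_2\<close>)
    ultimately show ?thesis using DERIV_unique by (fastforce simp: algebra_simps)
  qed
  have meas: "u \<in> borel_measurable M" if "continuous_on UNIV u" for u :: "'a \<Rightarrow> real^2^2"
    using borel_measurable_continuous_onI[OF that] M(2) measurable_cong_sets by blast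
  have "twisting_cocycle f A A1 A2 \<alpha> \<beta> \<kappa> C M"
  proof (intro twisting_cocycle.intro twisting_family.intro twisting_cocycle_axioms.intro)
    show "\<alpha> < \<beta>" "0 < \<kappa>" "\<kappa> \<le> 1" "1 \<le> C" using ab \<open>0 < q p0\<close> by (auto simp: \<kappa>_def C_def)
    show "distr M M f = M" by (rule M(3))
    show "f \<in> measurable M M"
      using borel_measurable_continuous_onI[OF f] M(2) measurable_cong_sets by blast
    show "tangent \<kappa> (A \<theta> x) (A1 \<theta> x)" if "\<theta> \<in> {\<alpha>..\<beta>}" for \<theta> x
      unfolding tangent_def using kq[OF that] trace[of \<theta> x] det[of \<theta> x] that sub ab(4) by (auto simp: det_2 subset_iff)
    show "((\<lambda>\<theta>. A \<theta> x $ i $ j) has_real_derivative A1 \<theta> x $ i $ j) (at \<theta> within {\<alpha>..\<beta>})"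
      if "\<theta> \<in> {\<alpha>..\<beta>}" for \<theta> x i j
      by (rule has_field_derivative_at_within[OF comp[OF der1]]) (use that sub ab(4) in auto)
    show "((\<lambda>\<theta>. A1 \<theta> x $ i $ j) has_real_derivative A2 \<theta> x $ i $ j) (at \<theta> within {\<alpha>..\<beta>})"
      if "\<theta> \<in> {\<alpha>..\<beta>}" for \<theta> x i j
      by (rule has_field_derivative_at_within[OF comp[OF der2]]) (use that sub ab(4) in auto)
    show "continuous_on {\<alpha>..\<beta>} (\<lambda>\<theta>. A2 \<theta> x $ i $ j)" for x i j
      unfolding A2_def
      by (intro continuous_intros continuous_on_subset[OF Cr_space_continuous[OF G k]]) (use sub ab(4) in auto)
    have sq: "(norm P)\<^sup>2 \<le> B\<^sup>2" if "norm P \<le> B" for P :: "real^2^2" and B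
      using that by (rule power_mono) simp
    show "frob (A \<theta> x) \<le> C" "frob (A1 \<theta> x) \<le> C" "frob (A2 \<theta> x) \<le> C" if "\<theta> \<in> {\<alpha>..\<beta>}" for \<theta> x
      using sq[OF B(1)[of \<theta> x]] sq[OF B(2)[of \<theta> x]] sq[OF B(3)[of \<theta> x]] that sub
      unfolding frob_eq_norm C_def
      by (smt (verit) subset_iff zero_le_power2)+
    show "A \<theta> \<in> borel_measurable M" if "\<theta> \<in> {\<alpha>..\<beta>}" for \<theta>
      by (rule meas[OF cont]) (use that sub ab(4) in auto)
    show "A1 \<theta> \<in> borel_measurable M" if "\<theta> \<in> {\<alpha>..\<beta>}" for \<theta>
      by (rule meas[OF cont1[OF that]])
    show "prob_space M" by (rule M(1))
  qed
  then show ?thesis by blast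
qed

text \<open>
  Countably many compact intervals with rational end points cover \<open>J\<close>, and on each of them \<open>AE_conjugate\<close> applies.
\<close>

theorem theorem1p7:
  fixes f :: "'a::metric_space \<Rightarrow> 'a"
    and M :: "'a measure"
    and A :: "real \<Rightarrow> 'a \<Rightarrow> real^2^2"
    and J :: "real set"
    and \<epsilon> :: real
  assumes "compact (UNIV :: 'a set)"
    and "\<exists>g. homeomorphism UNIV UNIV f g"
    and "prob_space M" and "sets M = sets borel" and "distr M M f = M"
    and "0 < \<epsilon>"
    and "open J" and "is_interval J"
    and "\<And>\<theta>. \<theta> \<in> J \<Longrightarrow> continuous_on UNIV (A \<theta>)"
    and "\<And>\<theta> x. \<theta> \<in> J \<Longrightarrow> A \<theta> x \<in> SL2"
    and "monotonic_family J A"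
    and "Cr_family (2 + \<epsilon>) J A"
  shows "AE \<theta> in lebesgue. \<theta> \<in> J \<longrightarrow> lyapunov M f (A \<theta>) = 0
           \<longrightarrow> L2_conjugate_to_rotations M f (A \<theta>)"
proof -
  let ?P = "\<lambda>\<theta>. lyapunov M f (A \<theta>) = 0 \<longrightarrow> L2_conjugate_to_rotations M f (A \<theta>)"
  have f: "continuous_on UNIV f" using assms(2) by (auto simp: homeomorphism_def)
  define Q where "Q = {(\<alpha>, \<beta>) \<in> \<rat> \<times> \<rat>. \<exists>a b. a < \<alpha> \<and> \<alpha> < \<beta> \<and> \<beta> < b \<and> {a..b} \<subseteq> J}"
  have "countable Q"
    unfolding Q_def by (rule countable_subset[of _ "\<rat> \<times> \<rat>"]) (auto intro: countable_rat)
  moreover have "AE \<theta> in lborel. \<theta> \<in> {fst p..snd p} \<longrightarrow> ?P \<theta>" if "p \<in> Q" for p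
  proof -
    obtain a b where ab: "a < fst p" "fst p < snd p" "snd p < b" "{a..b} \<subseteq> J" using \<open>p \<in> Q\<close> by (auto simp: Q_def)
    obtain A1 A2 \<kappa> C where "twisting_cocycle f A A1 A2 (fst p) (snd p) \<kappa> C M"
      using family_on_compact_interval[OF assms(1) f assms(3-12) ab] by blast
    then show ?thesis by (rule twisting_cocycle.AE_conjugate)
  qed
  ultimately have "AE \<theta> in lborel. \<forall>p\<in>Q. \<theta> \<in> {fst p..snd p} \<longrightarrow> ?P \<theta>" by (subst AE_ball_countable) auto
  then have "AE \<theta> in lborel. \<theta> \<in> J \<longrightarrow> ?P \<theta>"
  proof eventually_elim
    case (elim \<theta>)
    show ?case
    proof
      assume "\<theta> \<in> J"
      then obtain e where e: "0 < e" "cball \<theta> e \<subseteq> J" using assms(7) open_contains_cball by blast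
      obtain \<alpha> where \<alpha>: "\<alpha> \<in> \<rat>" "\<theta> - e < \<alpha>" "\<alpha> < \<theta>" using Rats_dense_in_real[of "\<theta> - e" \<theta>] e(1) by auto
      obtain \<beta> where \<beta>: "\<beta> \<in> \<rat>" "\<theta> < \<beta>" "\<beta> < \<theta> + e" using Rats_dense_in_real[of \<theta> "\<theta> + e"] e(1) by auto
      have "\<exists>a b. a < \<alpha> \<and> \<alpha> < \<beta> \<and> \<beta> < b \<and> {a..b} \<subseteq> J"
        using \<alpha> \<beta> e(2) by (intro exI[of _ "\<theta> - e"] exI[of _ "\<theta> + e"]) (auto simp: cball_eq_atLeastAtMost)
      then have "(\<alpha>, \<beta>) \<in> Q" unfolding Q_def using \<alpha> \<beta> by simp
      then show "?P \<theta>" using elim \<alpha> \<beta> by fastforce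
    qed
  qed
  then show ?thesis by (rule AE_completion)
qed

end
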